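(* Let $q$ be a prime power, let $n\ge 5$ be odd, and put $m=\frac{q^n+1}{q+1}$ and $s=\frac{m-1}{q^2-q}$ (an integer). Let $P\in \mathcal{GK}_{2,n}(\mathbb{F}_{q^2})$. Then the Weierstrass semigroup $H(P)$ at $P$ is \begin{itemize} \item $H(P)=\langle\, mq+i(q^2-q),\ q^n+1 \mid i=0,\dots,s\,\rangle$, if $P$ is an ideal point (point at infinity) of $\mathcal{GK}_{2,n}$; \item $H(P)=\langle\, q^n+1-m,\ q^n+1-k \mid k=0,\dots,\tfrac{m-1}{q^2-q}\,\rangle$, otherwise. \end{itemize}
   Context: For a prime power $q$ and odd $n\ge 3$, with $m=(q^n+1)/(q+1)$, $\mathcal{GK}_{2,n}$ is the non-singular projective geometrically irreducible curve over $\mathbb{F}_{q^{2n}}$ with function field $\mathbb{F}_{q^{2n}}(x,y,z)$, where $$y^{q+1}=x^{q+1}-1,\qquad z^m=y\,\frac{x^{q^2}-x}{x^{q+1}-1}.$$ It covers the Hermitian curve $\mathcal{H}_q: Y^{q+1}=X^{q+1}-1$ via $(x,y)$, and the $q^3+1$ points of $\mathcal{H}_q(\mathbb{F}_{q^2})$ are totally ramified in this covering (each has exactly one point above it). $\mathcal{GK}_{2,n}(\mathbb{F}_{q^2})$ is the set of the $q^3+1$ points above $\mathcal{H}_q(\mathbb{F}_{q^2})$; the ideal points are the $q+1$ points above the points at infinity of $\mathcal{H}_q$, i.e. the points $(1:a:0:0)$ with $a^{q+1}=1$ in homogeneous coordinates $(X:Y:Z:T)$; the others are the $q^3-q$ affine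 $\mathbb{F}_{q^2}$-rational points (where $z=0$). The Weierstrass semigroup $H(P)$ is the set of all integers $k\ge 0$ for which there is a rational function on the curve with pole divisor $kP$. $\langle A\rangle$ denotes the additive submonoid of $\mathbb{N}=\{0,1,2,\dots\}$ generated by $A$. *)

theory Defs
  imports "HOL-Number_Theory.Prime_Powers" "HOL-Computational_Algebra.Polynomial"
begin

section \<open>Function fields and their places\<close>

text \<open>Throughout, the function field of the curve is the whole type \<open>'a\<close>, and the field of
  constants is a subset \<open>K\<close> of it.\<close>

definition subfield_of_type :: "'a::field set \<Rightarrow> bool" where
  "subfield_of_type K \<longleftrightarrow> 0 \<in> K \<and> 1 \<in> K \<and>
     (\<forall>a\<in>K. \<forall>b\<in>K. a + b \<in> K \<and> a * b \<in> K) \<and>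
     (\<forall>a\<in>K. - a \<in> K \<and> inverse a \<in> K)"

definition field_adjoin :: "'a::field set \<Rightarrow> 'a set \<Rightarrow> 'a set" where
  "field_adjoin K A = \<Inter>{L. subfield_of_type L \<and> K \<subseteq> L \<and> A \<subseteq> L}"

definition transcendental_over :: "'a::field set \<Rightarrow> 'a \<Rightarrow> bool" where
  "transcendental_over K t \<longleftrightarrow>
     (\<forall>p::'a poly. (\<forall>i. coeff p i \<in> K) \<and> poly p t = 0 \<longrightarrow> p = 0)"

text \<open>A place of the function field over \<open>K\<close> (a closed point of the non-singular projective
  model) is given by its normalised discrete valuation.  The value at \<open>0\<close>, mathematically
  \<open>\<infinity>\<close>, is fixed to the dummy value \<open>0\<close>, so that distinct functions \<open>P\<close> are distinct places.\<close>

definition place :: "'a::field set \<Rightarrow> ('a \<Rightarrow> int) \<Rightarrow> bool" where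
  "place K P \<longleftrightarrow> P 0 = 0 \<and> surj P \<and>
     (\<forall>c\<in>K. P c = 0) \<and>
     (\<forall>f g. f \<noteq> 0 \<longrightarrow> g \<noteq> 0 \<longrightarrow> P (f * g) = P f + P g) \<and>
     (\<forall>f g. f \<noteq> 0 \<longrightarrow> g \<noteq> 0 \<longrightarrow> f + g \<noteq> 0 \<longrightarrow> min (P f) (P g) \<le> P (f + g))"

text \<open>\<open>f(P) = c\<close>, i.e. \<open>f - c\<close> lies in the maximal ideal of the valuation ring of \<open>P\<close>.\<close>

definition has_value_at :: "('a::field \<Rightarrow> int) \<Rightarrow> 'a \<Rightarrow> 'a \<Rightarrow> bool" where
  "has_value_at P f c \<longleftrightarrow> f = c \<or> P (f - c) > 0"

text \<open>The coefficient at \<open>P\<close> of the pole divisor of a function \<open>f \<noteq> 0\<close>.\<close>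

definition pole_order :: "('a::field \<Rightarrow> int) \<Rightarrow> 'a \<Rightarrow> nat" where
  "pole_order P f = nat (- P f)"

definition weierstrass_semigroup :: "'a::field set \<Rightarrow> ('a \<Rightarrow> int) \<Rightarrow> nat set" where
  "weierstrass_semigroup K P =
     {k. \<exists>f. f \<noteq> 0 \<and> (\<forall>Q. place K Q \<longrightarrow> pole_order Q f = (if Q = P then k else 0))}"

inductive_set submonoid_gen :: "nat set \<Rightarrow> nat set" for A :: "nat set" where
  zero: "0 \<in> submonoid_gen A"
| add: "a \<in> A \<Longrightarrow> k \<in> submonoid_gen A \<Longrightarrow> a + k \<in> submonoid_gen A"


section \<open>The curve\<close>

definition gk_m :: "nat \<Rightarrow> nat \<Rightarrow> nat" where
  "gk_m q n = (q ^ n + 1) div (q + 1)"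

definition gk_s :: "nat \<Rightarrow> nat \<Rightarrow> nat" where
  "gk_s q n = (gk_m q n - 1) div (q\<^sup>2 - q)"

text \<open>The quotients are exact.\<close>

lemma gk_m_exact:
  assumes "odd n"
  shows "gk_m q n * (q + 1) = q ^ n + 1"
proof -
  have "int q - (-1) dvd int q ^ n - (-1) ^ n"
    by (metis dvd_triv_left power_diff_sumr2)
  then have "int (q + 1) dvd int (q ^ n + 1)"
    using assms by (simp add: add.commute)
  then have "q + 1 dvd q ^ n + 1"
    by (simp only: int_dvd_int_iff)
  then show ?thesis
    unfolding gk_m_def by (rule dvd_div_mult_self)
qed

lemma gk_s_exact:
  assumes "odd n" "q > 0"
  shows "gk_s q n * (q\<^sup>2 - q) = gk_m q n - 1"
proof -
  obtain k where n: "n = 2 * k + 1"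
    using assms(1) oddE by blast
  have "int q ^ 2 - 1 dvd (int q ^ 2) ^ k - 1 ^ k"
    by (metis dvd_triv_left power_diff_sumr2)
  then obtain t where t: "(int q ^ 2) ^ k - 1 = (int q ^ 2 - 1) * t"
    by (auto elim: dvdE)
  have "int (gk_m q n * (q + 1)) = int (q ^ n + 1)"
    using gk_m_exact[OF assms(1)] by simp
  then have m: "int (gk_m q n) * (int q + 1) = int q ^ n + 1"
    by (simp add: algebra_simps)
  have "(int q + 1) * (int (gk_m q n) - 1) = int q * ((int q ^ 2) ^ k - 1)"
    using m by (simp add: n algebra_simps flip: power_mult)
  also have "\<dots> = (int q + 1) * ((int q ^ 2 - int q) * t)"
    unfolding t by (simp add: algebra_simps power2_eq_square)
  finally have *: "int (gk_m q n) - 1 = (int q ^ 2 - int q) * t"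
    by simp
  have "gk_m q n \<noteq> 0"
    using gk_m_exact[OF assms(1), of q] by (intro notI) simp
  moreover have "q \<le> q\<^sup>2"
    using assms(2) by (simp add: power2_eq_square)
  ultimately have "int (gk_m q n - 1) = int (q\<^sup>2 - q) * t"
    using * by (simp add: of_nat_diff)
  then have "q\<^sup>2 - q dvd gk_m q n - 1"
    by (metis dvd_triv_left int_dvd_int_iff)
  then show ?thesis
    by (simp add: gk_s_def)
qed

text \<open>The type \<open>'a\<close> is the function field of \<open>\<G>\<K>\<close>: \<open>K\<close> is the field with \<open>q\<^sup>2\<^sup>n\<close> elements and
  \<open>'a = K(x, y, z)\<close>.  Transcendence of \<open>x\<close> makes this a function field in one variable; as the
  two equations are irreducible over \<open>K(x)\<close> and \<open>K(x, y)\<close>, it is unique up to isomorphism.\<close>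

locale gk_function_field =
  fixes K :: "'a::field set" and q n :: nat and x y z :: 'a
  assumes subfield_K: "subfield_of_type K"
    and card_K: "card K = q ^ (2 * n)"
    and transcendental_x: "transcendental_over K x"
    and generated: "field_adjoin K {x, y, z} = UNIV"
    and hermitian_eq: "y ^ (q + 1) = x ^ (q + 1) - 1"
    and gk_eq: "z ^ gk_m q n = y * ((x ^ q\<^sup>2 - x) / (x ^ (q + 1) - 1))"

text \<open>The subfield with \<open>q\<^sup>2\<close> elements of \<open>K\<close>.\<close>

definition F_q2 :: "'a::field set \<Rightarrow> nat \<Rightarrow> 'a set" where
  "F_q2 K q = {c \<in> K. c ^ q\<^sup>2 = c}"

text \<open>Places above the affine \<open>\<bbbF>\<close>-rational points \<open>(a, b)\<close>, respectively above the points at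
  infinity \<open>(1 : a : 0)\<close>, of the Hermitian curve in the coordinates \<open>(X : Y : T)\<close>, where
  \<open>\<bbbF>\<close> has \<open>q\<^sup>2\<close> elements.\<close>

definition gk_affine_points :: "'a::field set \<Rightarrow> nat \<Rightarrow> 'a \<Rightarrow> 'a \<Rightarrow> ('a \<Rightarrow> int) set" where
  "gk_affine_points K q x y =
     {P. place K P \<and>
         (\<exists>a\<in>F_q2 K q. \<exists>b\<in>F_q2 K q. b ^ (q + 1) = a ^ (q + 1) - 1 \<and>
            has_value_at P x a \<and> has_value_at P y b)}"

definition gk_ideal_points :: "'a::field set \<Rightarrow> nat \<Rightarrow> 'a \<Rightarrow> 'a \<Rightarrow> ('a \<Rightarrow> int) set" where
  "gk_ideal_points K q x y =
     {P. place K P \<and>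
         (\<exists>a\<in>F_q2 K q. a ^ (q + 1) = 1 \<and>
            has_value_at P (y / x) a \<and> has_value_at P (1 / x) 0)}"

definition gk_rational_points :: "'a::field set \<Rightarrow> nat \<Rightarrow> 'a \<Rightarrow> 'a \<Rightarrow> ('a \<Rightarrow> int) set" where
  "gk_rational_points K q x y = gk_affine_points K q x y \<union> gk_ideal_points K q x y"

end

theory Submission
  imports Defs
begin

text \<open>Let \<open>H = K(x, y)\<close> be the function field of the Hermitian curve.  The extension \<open>H(z)\<close> of \<open>H\<close> is
  a Kummer extension of degree \<open>m\<close>, totally ramified at \<open>P\<close>.  So a function \<open>f\<close> is a unique sum of
  components \<open>f\<^sub>j z\<^sup>j\<close> with \<open>f\<^sub>j\<close> in \<open>H\<close> and \<open>j < m\<close>, the values of the components at \<open>P\<close> are distinct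
  modulo \<open>m\<close>, and if \<open>f\<close> has no pole outside \<open>P\<close>, then neither has any component
  (\<open>z_component_regular\<close>).  The pole order of \<open>f\<close> is therefore that of a single component, and the
  problem moves down to the Hermitian curve.

  Away from \<open>P\<close>, the function \<open>z\<close> has value \<open>1\<close> at the affine rational points, value \<open>-(q\<^sup>2 - q)\<close> at
  the ideal points and value \<open>0\<close> elsewhere.  As the values of functions in \<open>H\<close> at rational points
  are multiples of \<open>m = s (q\<^sup>2 - q) + 1\<close>, regularity of \<open>f\<^sub>j z\<^sup>j\<close> outside \<open>P\<close> means that \<open>f\<^sub>j\<close> has no
  poles there and, on the Hermitian curve, zeros of order at least \<open>c = \<lceil>j / s\<rceil>\<close> at the ideal points
  other than \<open>P\<close>.  Let \<open>t = 0\<close> be the tangent of the Hermitian curve at the point below \<open>P\<close>.  It meets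
  the curve only there, so \<open>t\<close> has simple poles at the other ideal points, and \<open>f\<^sub>j t\<^sup>c\<close> is a function
  whose only pole is below \<open>P\<close>.  The pole orders of such functions are the elements of the semigroup
  generated by \<open>q\<close> and \<open>q + 1\<close> (\<open>E_regular_value\<close>).  Collecting these contributions gives exactly the
  generators in the statement (\<open>pole_value_decomposition\<close>); conversely each generator is the pole
  order of an evident product of powers of \<open>u\<close>, \<open>w\<close> and \<open>z\<close>.

  Here \<open>u\<close> and \<open>w\<close> are coordinates of the Hermitian curve adapted to the point: their only pole is
  there, of orders \<open>q\<close> and \<open>q + 1\<close>, and \<open>w\<^sup>q + w = u\<^sup>q\<^sup>+\<^sup>1 \<plusminus> 1\<close>.  The values of the monomials
  \<open>c(u) w\<^sup>i z\<^sup>j\<close> with \<open>i < q\<close> and \<open>j < m\<close> at a pole of \<open>u\<close> are pairwise distinct.  This one fact yields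
  linear independence of the monomials over \<open>K(u)\<close>, the total ramification, and the uniqueness of
  the place \<open>P\<close> (\<open>unique_pole\<close>).

  Both descents, from \<open>f\<close> to its components and from a function in \<open>H\<close> to its coefficients in
  \<open>K(u)\<close>, are Galois arguments: replace \<open>z\<close> by \<open>\<zeta> z\<close> with \<open>\<zeta>\<^sup>m = 1\<close>, and \<open>w\<close> by \<open>w + \<gamma>\<close> with
  \<open>\<gamma>\<^sup>q + \<gamma> = 0\<close>, and recover the coefficients from the conjugates by interpolation at constants
  (\<open>coeffs_in_module\<close>).  Conjugates of an integral element are integral.  What makes this applicable
  is that a function without poles outside \<open>P\<close> is integral over \<open>K[u]\<close>
  (\<open>exists_place_with_pole\<close>): otherwise a maximality argument gives a valuation ring that contains
  \<open>K[u]\<close> but not the function, and its value group is infinite cyclic because the function field is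
  finite over \<open>K(u)\<close>.\<close>


section \<open>Subrings, subfields and polynomials over them\<close>

definition subring_of_type :: "'a::field set \<Rightarrow> bool" where
  "subring_of_type A \<longleftrightarrow> 0 \<in> A \<and> 1 \<in> A \<and>
     (\<forall>a\<in>A. \<forall>b\<in>A. a + b \<in> A \<and> a * b \<in> A) \<and> (\<forall>a\<in>A. - a \<in> A)"

lemma subfield_imp_subring: "subfield_of_type L \<Longrightarrow> subring_of_type L"
  by (auto simp: subfield_of_type_def subring_of_type_def)

lemma subringD:
  assumes "subring_of_type A"
  shows "0 \<in> A" "1 \<in> A" "a \<in> A \<Longrightarrow> b \<in> A \<Longrightarrow> a + b \<in> A" "a \<in> A \<Longrightarrow> b \<in> A \<Longrightarrow> a * b \<in> A"
    "a \<in> A \<Longrightarrow> - a \<in> A" "a \<in> A \<Longrightarrow> b \<in> A \<Longrightarrow> a - b \<in> A" "a \<in> A \<Longrightarrow> a ^ k \<in> A"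
proof -
  show 1: "0 \<in> A" "1 \<in> A" "a \<in> A \<Longrightarrow> b \<in> A \<Longrightarrow> a + b \<in> A" "a \<in> A \<Longrightarrow> - a \<in> A"
    "a \<in> A \<Longrightarrow> b \<in> A \<Longrightarrow> a * b \<in> A" for a b
    using assms by (auto simp: subring_of_type_def)
  show "a \<in> A \<Longrightarrow> b \<in> A \<Longrightarrow> a - b \<in> A"
    using 1(3)[of a "- b"] 1(4)[of b] by simp
  show "a \<in> A \<Longrightarrow> a ^ k \<in> A"
    by (induction k) (auto intro: 1)
qed

lemma subring_sum:
  assumes "subring_of_type A" "\<And>i. i \<in> I \<Longrightarrow> f i \<in> A"
  shows "sum f I \<in> A"
  using assms(2)
  by (induction I rule: infinite_finite_induct) (auto intro: subringD[OF assms(1)])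

lemma subfieldD:
  assumes "subfield_of_type L"
  shows "a \<in> L \<Longrightarrow> inverse a \<in> L" "a \<in> L \<Longrightarrow> b \<in> L \<Longrightarrow> a / b \<in> L"
  using assms by (auto simp: subfield_of_type_def divide_inverse)

definition polys_over :: "'a::field set \<Rightarrow> 'a poly set" where
  "polys_over A = {p. \<forall>i. coeff p i \<in> A}"

lemma polys_over_0: "0 \<in> A \<Longrightarrow> 0 \<in> polys_over A"
  by (simp add: polys_over_def)

lemma polys_over_closed:
  assumes A: "subring_of_type A"
  shows "c \<in> A \<Longrightarrow> [:c:] \<in> polys_over A"
    and "c \<in> A \<Longrightarrow> monom c k \<in> polys_over A"
    and "p \<in> polys_over A \<Longrightarrow> r \<in> polys_over A \<Longrightarrow> p + r \<in> polys_over A"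
    and "p \<in> polys_over A \<Longrightarrow> r \<in> polys_over A \<Longrightarrow> p - r \<in> polys_over A"
    and "p \<in> polys_over A \<Longrightarrow> - p \<in> polys_over A"
    and "p \<in> polys_over A \<Longrightarrow> r \<in> polys_over A \<Longrightarrow> p * r \<in> polys_over A"
    and "c \<in> A \<Longrightarrow> p \<in> polys_over A \<Longrightarrow> smult c p \<in> polys_over A"
    and "c \<in> A \<Longrightarrow> p \<in> polys_over A \<Longrightarrow> pCons c p \<in> polys_over A"
    and "1 \<in> polys_over A"
  using subringD[OF A]
  by (auto simp: polys_over_def coeff_pCons coeff_mult intro!: subring_sum[OF A] split: nat.splits)

lemma polys_over_sum:
  assumes A: "subring_of_type A" "\<And>i. i \<in> I \<Longrightarrow> f i \<in> polys_over A"
  shows "sum f I \<in> polys_over A"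
  using assms(2)
  by (induction I rule: infinite_finite_induct)
     (auto intro!: polys_over_closed[OF A(1)] polys_over_0 subringD[OF A(1)])

lemma polys_over_pConsD:
  assumes "pCons c p \<in> polys_over A"
  shows "c \<in> A" "p \<in> polys_over A"
proof -
  have "coeff (pCons c p) i \<in> A" for i
    using assms by (simp add: polys_over_def)
  from this[of 0] this[of "Suc i" for i] show "c \<in> A" "p \<in> polys_over A"
    by (simp_all add: polys_over_def)
qed

lemma polys_over_pcompose:
  assumes A: "subring_of_type A" "p \<in> polys_over A" "r \<in> polys_over A"
  shows "pcompose p r \<in> polys_over A"
  using assms(2)
proof (induction p)
  case 0
  then show ?case by simp
next
  case (pCons c p)
  have "c \<in> A" "p \<in> polys_over A"
    using polys_over_pConsD[OF pCons.prems] by auto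
  then show ?case
    using pCons.IH assms(3) by (auto simp: pcompose_pCons intro!: polys_over_closed[OF A(1)])
qed

lemma poly_polys_over:
  assumes A: "subring_of_type A" "p \<in> polys_over A" "f \<in> A"
  shows "poly p f \<in> A"
  unfolding poly_altdef using assms
  by (intro subring_sum) (auto simp: polys_over_def intro!: subringD)

lemma polys_over_mono: "A \<subseteq> B \<Longrightarrow> polys_over A \<subseteq> polys_over B"
  by (auto simp: polys_over_def)

lemma monom_minus_const:
  fixes c :: "'a::field"
  assumes "k > 0"
  shows "degree (monom 1 k - [:c:]) = k" "lead_coeff (monom 1 k - [:c:]) = 1"
proof -
  have co: "coeff (monom 1 k - [:c:]) i = (if i = k then 1 else 0)" if "i \<ge> k" for i
    using that assms by (auto simp: coeff_pCons split: nat.splits)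
  have "degree (monom 1 k - [:c:]) \<le> k"
    by (rule degree_le) (auto simp: coeff_pCons split: nat.splits)
  moreover have "k \<le> degree (monom 1 k - [:c:])"
    by (rule le_degree) (use co[of k] in simp)
  ultimately show 1: "degree (monom 1 k - [:c:]) = k" by simp
  show "lead_coeff (monom 1 k - [:c:]) = 1"
    unfolding 1 using co[of k] by simp
qed

text \<open>Long division by a monic polynomial never leaves the ring of coefficients.\<close>

lemma monic_division:
  assumes A: "subring_of_type A" and M: "M \<in> polys_over A" "lead_coeff M = 1"
    and p: "p \<in> polys_over A"
  shows "\<exists>s\<in>polys_over A. \<exists>r\<in>polys_over A. p = s * M + r \<and> (r = 0 \<or> degree r < degree M)"
  using p
proof (induction "degree p" arbitrary: p rule: less_induct)
  case less
  show ?case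
  proof (cases "p = 0 \<or> degree p < degree M")
    case True
    then show ?thesis
      using less.prems by (intro bexI[of _ 0] bexI[of _ p]) (auto intro: polys_over_0 subringD[OF A])
  next
    case False
    define c where "c = monom (lead_coeff p) (degree p - degree M)"
    define p' where "p' = p - c * M"
    have c: "c \<in> polys_over A"
      using less.prems unfolding c_def by (intro polys_over_closed[OF A]) (auto simp: polys_over_def)
    have p': "p' \<in> polys_over A"
      unfolding p'_def using c less.prems M by (intro polys_over_closed[OF A])
    have M0: "M \<noteq> 0"
      using M by auto
    have dc: "degree (c * M) = degree p"
    proof -
      have "lead_coeff p \<noteq> 0"
        using False by simp
      then have "degree c = degree p - degree M" "c \<noteq> 0"
        unfolding c_def by (rule degree_monom_eq, simp add: monom_eq_0_iff)
      then show ?thesis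
        using False M0 by (simp add: degree_mult_eq)
    qed
    have lc: "lead_coeff (c * M) = lead_coeff p"
      using M(2) by (simp only: c_def lead_coeff_mult lead_coeff_monom mult_1_right)
    have small: "p' = 0 \<or> degree p' < degree p"
    proof (cases "degree p = 0")
      case True
      have "coeff p' 0 = 0"
        using lc dc True by (simp add: p'_def)
      moreover have "degree p' \<le> 0"
        unfolding p'_def using dc True by (intro degree_diff_le) auto
      ultimately show ?thesis
        by (metis le_zero_eq leading_coeff_0_iff)
    next
      case nz: False
      have "degree p' \<le> degree p"
        unfolding p'_def using dc by (intro degree_diff_le) auto
      moreover have "coeff p' (degree p) = 0"
        using lc dc by (simp add: p'_def)
      ultimately show ?thesis
        by (metis leading_coeff_0_iff nat_less_le)
    qed
    then obtain s r where "s \<in> polys_over A" "r \<in> polys_over A" "p' = s * M + r"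
      "r = 0 \<or> degree r < degree M"
    proof (elim disjE)
      assume "p' = 0"
      then show thesis
        using that[of 0 0] polys_over_0 subringD[OF A] by auto
    next
      assume "degree p' < degree p"
      from less.hyps[OF this p'] show thesis
        using that by blast
    qed
    then show ?thesis
      using c by (intro bexI[of _ "s + c"] bexI[of _ r])
         (auto simp: p'_def algebra_simps intro: polys_over_closed[OF A])
  qed
qed

lemma subfield_division:
  assumes L: "subfield_of_type L" and M: "M \<in> polys_over L" "M \<noteq> 0" and p: "p \<in> polys_over L"
  shows "\<exists>s\<in>polys_over L. \<exists>r\<in>polys_over L. p = s * M + r \<and> (r = 0 \<or> degree r < degree M)"
proof -
  note R = subfield_imp_subring[OF L]
  define c where "c = inverse (lead_coeff M)"
  have c: "c \<in> L" "c \<noteq> 0"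
    using M by (auto simp: c_def polys_over_def intro: subfieldD[OF L])
  have "smult c M \<in> polys_over L" "lead_coeff (smult c M) = 1"
    using M c by (auto simp: c_def intro: polys_over_closed[OF R])
  from monic_division[OF R this p] obtain s r where
    "s \<in> polys_over L" "r \<in> polys_over L" "p = s * smult c M + r" "r = 0 \<or> degree r < degree M"
    using c by auto
  then show ?thesis
    using c by (intro bexI[of _ "smult c s"] bexI[of _ r]) (auto intro: polys_over_closed[OF R])
qed

definition ring_adjoin :: "'a::field set \<Rightarrow> 'a \<Rightarrow> 'a set" where
  "ring_adjoin A t = (\<lambda>p. poly p t) ` polys_over A"

lemma ring_adjoinI: "p \<in> polys_over A \<Longrightarrow> poly p t \<in> ring_adjoin A t"
  by (simp add: ring_adjoin_def)

lemma ring_adjoin_base: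
  assumes "subring_of_type A"
  shows "A \<subseteq> ring_adjoin A t" "t \<in> ring_adjoin A t"
proof
  show "c \<in> ring_adjoin A t" if "c \<in> A" for c
    using ring_adjoinI[OF polys_over_closed(1)[OF assms that], of t] by simp
  have "[:0, 1:] \<in> polys_over A"
    using subringD[OF assms] by (auto intro!: polys_over_closed[OF assms] polys_over_0)
  from ring_adjoinI[OF this, of t] show "t \<in> ring_adjoin A t"
    by simp
qed

lemma subring_ring_adjoin:
  assumes A: "subring_of_type A"
  shows "subring_of_type (ring_adjoin A t)"
proof -
  have "poly p t + poly r t \<in> ring_adjoin A t" "poly p t * poly r t \<in> ring_adjoin A t"
    "- poly p t \<in> ring_adjoin A t"
    if "p \<in> polys_over A" "r \<in> polys_over A" for p r
    using ring_adjoinI[OF polys_over_closed(3)[OF A that], of t]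
      ring_adjoinI[OF polys_over_closed(6)[OF A that], of t]
      ring_adjoinI[OF polys_over_closed(5)[OF A that(1)], of t] by auto
  moreover have "0 \<in> ring_adjoin A t" "1 \<in> ring_adjoin A t"
    using ring_adjoin_base[OF A, of t] subringD[OF A] by auto
  ultimately show ?thesis
    by (auto simp: subring_of_type_def ring_adjoin_def)
qed

lemma ring_adjoin_least:
  "subring_of_type R \<Longrightarrow> A \<subseteq> R \<Longrightarrow> t \<in> R \<Longrightarrow> ring_adjoin A t \<subseteq> R"
  using polys_over_mono[of A R] by (auto simp: ring_adjoin_def intro!: poly_polys_over)

text \<open>Since \<open>a / 0 = 0\<close>, zero denominators add no further elements.\<close>

definition fractions :: "'a::field set \<Rightarrow> 'a set" where
  "fractions A = {a / b | a b. a \<in> A \<and> b \<in> A}"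

lemma fractionsE:
  assumes "subring_of_type A" "f \<in> fractions A"
  obtains a b where "a \<in> A" "b \<in> A" "b \<noteq> 0" "f = a / b"
proof -
  obtain a b where "a \<in> A" "b \<in> A" "f = a / b"
    using assms(2) by (auto simp: fractions_def)
  then show thesis
    using that[of a b] that[of 0 1] subringD[OF assms(1)] by (cases "b = 0") auto
qed

lemma subring_subset_fractions: "subring_of_type A \<Longrightarrow> A \<subseteq> fractions A"
proof
  fix a assume A: "subring_of_type A" "a \<in> A"
  then have "a / 1 \<in> fractions A"
    unfolding fractions_def using subringD(2) by blast
  then show "a \<in> fractions A" by simp
qed

lemma fractionsI: "a \<in> A \<Longrightarrow> b \<in> A \<Longrightarrow> a / b \<in> fractions A"
  by (auto simp: fractions_def)

lemma subfield_fractions: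
  assumes A: "subring_of_type A"
  shows "subfield_of_type (fractions A)"
  unfolding subfield_of_type_def
proof (intro conjI ballI)
  show "0 \<in> fractions A" "1 \<in> fractions A"
    using subring_subset_fractions[OF A] subringD[OF A] by auto
next
  fix f g assume "f \<in> fractions A" "g \<in> fractions A"
  then obtain a b c d where *: "a \<in> A" "b \<in> A" "b \<noteq> 0" "f = a / b" "c \<in> A" "d \<in> A" "d \<noteq> 0" "g = c / d"
    by (metis fractionsE[OF A])
  have "(a * d + c * b) / (b * d) \<in> fractions A" "(a * c) / (b * d) \<in> fractions A"
    using * by (auto intro!: fractionsI subringD[OF A])
  then show "f + g \<in> fractions A" "f * g \<in> fractions A"
    using * by (simp_all add: add_frac_eq mult.commute)
next
  fix f assume "f \<in> fractions A"
  then obtain a b where *: "a \<in> A" "b \<in> A" "b \<noteq> 0" "f = a / b"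
    by (metis fractionsE[OF A])
  have "(- a) / b \<in> fractions A" "b / a \<in> fractions A"
    using * by (intro fractionsI subringD[OF A]; simp)+
  then show "- f \<in> fractions A" "inverse f \<in> fractions A"
    using * by simp_all
qed

section \<open>Linear dependence over a subfield\<close>

definition lin_combs :: "'a::field set \<Rightarrow> ('i \<Rightarrow> 'a) \<Rightarrow> 'i set \<Rightarrow> 'a set" where
  "lin_combs L b J = {\<Sum>j\<in>J. c j * b j | c. \<forall>j\<in>J. c j \<in> L}"

lemma lin_combs_lincomb:
  assumes L: "subring_of_type L" and f: "f \<in> lin_combs L b J" and g: "g \<in> lin_combs L b J" and d: "d \<in> L"
  shows "f - d * g \<in> lin_combs L b J"
proof -
  obtain c c' where *: "f = (\<Sum>j\<in>J. c j * b j)" "\<forall>j\<in>J. c j \<in> L"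
     "g = (\<Sum>j\<in>J. c' j * b j)" "\<forall>j\<in>J. c' j \<in> L"
    using f g by (auto simp: lin_combs_def)
  have "f - d * g = (\<Sum>j\<in>J. (c j - d * c' j) * b j)"
    by (simp add: * sum_distrib_left algebra_simps flip: sum_subtractf)
  then show ?thesis
    unfolding lin_combs_def using * d by (auto intro!: exI[of _ "\<lambda>j. c j - d * c' j"] subringD[OF L])
qed

text \<open>Gaussian elimination: a vector with a nonzero coefficient at one basis vector serves to
  clear that coefficient in all the others.\<close>

lemma lin_combs_dependent:
  assumes L: "subfield_of_type L" and "finite J" "finite I" "card J < card I"
    and "\<And>i. i \<in> I \<Longrightarrow> v i \<in> lin_combs L b J"
  shows "\<exists>c. (\<forall>i\<in>I. c i \<in> L) \<and> (\<exists>i\<in>I. c i \<noteq> 0) \<and> (\<Sum>i\<in>I. c i * v i) = 0"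
  using assms(2-)
proof (induction J arbitrary: I v rule: finite_induct)
  case empty
  then have "v i = 0" if "i \<in> I" for i
    using that by (auto simp: lin_combs_def)
  moreover have "I \<noteq> {}"
    using empty by auto
  ultimately show ?case
    using subringD[OF subfield_imp_subring[OF L]] by (intro exI[of _ "\<lambda>_. 1"]) auto
next
  case (insert j J)
  note R = subfield_imp_subring[OF L]
  have "\<exists>a r. a \<in> L \<and> r \<in> lin_combs L b J \<and> v i = a * b j + r" if i: "i \<in> I" for i
  proof -
    obtain c where c: "v i = (\<Sum>j\<in>insert j J. c j * b j)" "\<forall>j\<in>insert j J. c j \<in> L"
      using insert.prems(3)[OF i] by (auto simp: lin_combs_def)
    then show ?thesis
      using insert.hyps by (intro exI[of _ "c j"] exI[of _ "\<Sum>j\<in>J. c j * b j"]) (auto simp: lin_combs_def)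
  qed
  then obtain a r where ar: "\<And>i. i \<in> I \<Longrightarrow> a i \<in> L" "\<And>i. i \<in> I \<Longrightarrow> r i \<in> lin_combs L b J"
    "\<And>i. i \<in> I \<Longrightarrow> v i = a i * b j + r i"
    by metis
  show ?case
  proof (cases "\<exists>i\<in>I. a i \<noteq> 0")
    case False
    then have "v i \<in> lin_combs L b J" if "i \<in> I" for i
      using ar that by auto
    then show ?thesis
      using insert by (intro insert.IH) auto
  next
    case True
    then obtain k where k: "k \<in> I" "a k \<noteq> 0" by blast
    define I' where "I' = I - {k}"
    define v' where "v' i = v i - a i / a k * v k" for i
    have "v' i \<in> lin_combs L b J" if "i \<in> I'" for i
    proof -
      have "v' i = r i - a i / a k * r k"
        using that k by (simp add: I'_def v'_def ar field_simps)
      then show ?thesis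
        using that k lin_combs_lincomb[OF R ar(2) ar(2) subfieldD(2)[OF L ar(1) ar(1)], of i k i k]
        by (simp add: I'_def)
    qed
    moreover have "card J < card I'" "finite I'"
      using insert.prems insert.hyps k by (auto simp: I'_def)
    ultimately obtain c where c: "\<forall>i\<in>I'. c i \<in> L" "\<exists>i\<in>I'. c i \<noteq> 0" "(\<Sum>i\<in>I'. c i * v' i) = 0"
      using insert.IH[of I' v'] by blast
    define c' where "c' i = (if i = k then - (\<Sum>i\<in>I'. c i * (a i / a k)) else c i)" for i
    have "(\<Sum>i\<in>I. c' i * v i) = c' k * v k + (\<Sum>i\<in>I'. c' i * v i)"
      using insert.prems k by (simp add: I'_def sum.remove)
    also have "(\<Sum>i\<in>I'. c' i * v i) = (\<Sum>i\<in>I'. c i * v i)"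
      by (intro sum.cong) (auto simp: I'_def c'_def)
    also have "c' k * v k + \<dots> = (\<Sum>i\<in>I'. c i * v' i)"
      by (simp add: c'_def v'_def sum_distrib_left algebra_simps sum_subtractf)
    finally have "(\<Sum>i\<in>I. c' i * v i) = 0"
      using c by simp
    moreover have "c' i \<in> L" if "i \<in> I" for i
      using that c k ar
      by (auto simp: c'_def I'_def intro!: subringD[OF R] subring_sum[OF R] subfieldD[OF L])
    moreover have "\<exists>i\<in>I. c' i \<noteq> 0"
      using c by (auto simp: c'_def I'_def)
    ultimately show ?thesis by blast
  qed
qed

lemma power_relation:
  assumes L: "subfield_of_type L" "finite J" and f: "\<And>k. f ^ k \<in> lin_combs L b J"
  shows "\<exists>p\<in>polys_over L. p \<noteq> 0 \<and> degree p \<le> card J \<and> poly p f = 0"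
proof -
  note R = subfield_imp_subring[OF L(1)]
  obtain c where c: "\<forall>i\<in>{..card J}. c i \<in> L" "\<exists>i\<in>{..card J}. c i \<noteq> 0" "(\<Sum>i\<le>card J. c i * f ^ i) = 0"
    using lin_combs_dependent[OF L(1,2), of "{..card J}" "\<lambda>k. f ^ k" b] f by auto
  define p where "p = (\<Sum>i\<le>card J. monom (c i) i)"
  have co: "coeff p i = (if i \<le> card J then c i else 0)" for i
    by (simp add: p_def coeff_sum)
  have "p \<in> polys_over L"
    using c subringD[OF R] by (auto simp: polys_over_def co)
  moreover have "p \<noteq> 0"
    using c co by (metis atMost_iff coeff_0)
  moreover have "degree p \<le> card J"
    by (rule degree_le) (simp add: co)
  moreover have "poly p f = 0"
    using c by (simp add: p_def poly_sum poly_monom)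
  ultimately show ?thesis by blast
qed

text \<open>The lowest nonzero coefficient of an algebraic equation for \<open>f\<close> gives \<open>1 / f\<close> as a
  polynomial in \<open>f\<close>.\<close>

lemma inverse_in_subring_of_algebraic:
  assumes L: "subfield_of_type L" and R: "subring_of_type R" "L \<subseteq> R" and f: "f \<in> R" "f \<noteq> 0"
    and p: "p \<in> polys_over L" "p \<noteq> 0" "poly p f = 0"
  shows "inverse f \<in> R"
  using p
proof (induction p)
  case 0
  then show ?case by simp
next
  case (pCons c p)
  have c: "c \<in> L" and p: "p \<in> polys_over L"
    using polys_over_pConsD[OF pCons.prems(1)] by auto
  show ?case
  proof (cases "c = 0")
    case True
    then have "poly p f = 0" "p \<noteq> 0"
      using pCons.prems f by auto
    then show ?thesis
      using pCons.IH p by simp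
  next
    case False
    have "f * poly p f = - c"
      using pCons.prems by (simp add: eq_neg_iff_add_eq_0 add.commute)
    then have "inverse f = - inverse c * poly p f"
      using False f by (simp add: field_simps)
    then show ?thesis
      using polys_over_mono[OF R(2)] R(2) c p f
      by (auto intro!: subringD[OF R(1)] poly_polys_over[OF R(1)] subfieldD[OF L] simp: subset_iff)
  qed
qed

lemma ring_adjoin_reduce:
  assumes A: "subring_of_type A" and M: "M \<in> polys_over A" "lead_coeff M = 1" "degree M > 0" "poly M t = 0"
    and f: "f \<in> ring_adjoin A t"
  obtains r where "r \<in> polys_over A" "degree r < degree M" "f = poly r t"
proof -
  obtain p where p: "p \<in> polys_over A" "f = poly p t"
    using f by (auto simp: ring_adjoin_def)
  obtain s r where "s \<in> polys_over A" "r \<in> polys_over A" "p = s * M + r" "r = 0 \<or> degree r < degree M"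
    using monic_division[OF A M(1,2) p(1)] by blast
  then show thesis
    using that[of r] M p by auto
qed

lemma poly_eq_sum_lessThan:
  fixes t :: "'a::field"
  assumes "degree p < N"
  shows "poly p t = (\<Sum>i<N. coeff p i * t ^ i)"
proof -
  have "poly p t = (\<Sum>i\<le>degree p. coeff p i * t ^ i)"
    by (rule poly_altdef)
  also have "\<dots> = (\<Sum>i<N. coeff p i * t ^ i)"
    using assms by (intro sum.mono_neutral_cong_left) (auto simp: coeff_eq_0)
  finally show ?thesis .
qed

lemma subfield_ring_adjoin:
  assumes L: "subfield_of_type L"
    and M: "M \<in> polys_over L" "lead_coeff M = 1" "degree M > 0" "poly M t = 0"
  shows "subfield_of_type (ring_adjoin L t)"
proof -
  note R = subfield_imp_subring[OF L]
  note R' = subring_ring_adjoin[OF R, of t]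
  have "inverse f \<in> ring_adjoin L t" if f: "f \<in> ring_adjoin L t" for f
  proof (cases "f = 0")
    case True
    then show ?thesis using f by simp
  next
    case False
    have "f ^ k \<in> lin_combs L (\<lambda>i. t ^ i) {..<degree M}" for k
    proof -
      have "f ^ k \<in> ring_adjoin L t"
        using f by (intro subringD[OF R'])
      then obtain r where "r \<in> polys_over L" "degree r < degree M" "f ^ k = poly r t"
        using ring_adjoin_reduce[OF R M] by blast
      then show ?thesis
        by (auto simp: lin_combs_def poly_eq_sum_lessThan polys_over_def)
    qed
    from power_relation[OF L _ this] obtain p where "p \<in> polys_over L" "p \<noteq> 0" "poly p f = 0"
      by auto
    then show ?thesis
      using inverse_in_subring_of_algebraic[OF L R' ring_adjoin_base(1)[OF R] f False] by blast
  qed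
  then show ?thesis
    using R' by (auto simp: subring_of_type_def subfield_of_type_def)
qed

text \<open>If the powers of \<open>t\<close> below the degree of \<open>M\<close> are independent, then \<open>M\<close> is the minimal
  polynomial of \<open>t\<close>, so its other roots satisfy every algebraic equation that \<open>t\<close> satisfies.\<close>

lemma conjugate_root:
  assumes A: "subring_of_type A" and M: "M \<in> polys_over A" "lead_coeff M = 1" "poly M t = 0" "poly M t' = 0"
    and indep: "\<And>r. r \<in> polys_over A \<Longrightarrow> degree r < degree M \<Longrightarrow> poly r t = 0 \<Longrightarrow> r = 0"
    and p: "p \<in> polys_over A" "poly p t = 0"
  shows "poly p t' = 0"
proof -
  obtain s r where *: "s \<in> polys_over A" "r \<in> polys_over A" "p = s * M + r" "r = 0 \<or> degree r < degree M"
    using monic_division[OF A M(1,2) p(1)] by blast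
  then have "poly r t = 0"
    using p M by simp
  then have "r = 0"
    using * indep by blast
  then show ?thesis
    using * M by simp
qed

section \<open>Valuation rings and existence of places\<close>

definition integral_over :: "'a::field set \<Rightarrow> 'a \<Rightarrow> bool" where
  "integral_over A f \<longleftrightarrow> (\<exists>p\<in>polys_over A. lead_coeff p = 1 \<and> poly p f = 0)"

definition valuation_ring :: "'a::field set \<Rightarrow> bool" where
  "valuation_ring R \<longleftrightarrow> subring_of_type R \<and> (\<forall>f. f \<in> R \<or> inverse f \<in> R)"

text \<open>Reversing the coefficients of an expression of \<open>1 / g\<close> as a polynomial in \<open>g\<close> gives an integral
  equation for \<open>1 / g\<close>.\<close>

lemma inverse_notin_ring_adjoin:
  assumes A: "subring_of_type A" and g: "g \<noteq> 0" "\<not> integral_over A (inverse g)"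
  shows "inverse g \<notin> ring_adjoin A g"
proof
  assume "inverse g \<in> ring_adjoin A g"
  then obtain p where p: "p \<in> polys_over A" "inverse g = poly p g"
    by (auto simp: ring_adjoin_def)
  define N where "N = degree p"
  define M where "M = monom 1 (Suc N) - reflect_poly p"
  have "reflect_poly p \<in> polys_over A"
    using p subringD(1)[OF A] by (auto simp: polys_over_def coeff_reflect_poly)
  then have "M \<in> polys_over A"
    unfolding M_def using subringD[OF A] by (intro polys_over_closed[OF A])
  moreover have "lead_coeff M = 1"
  proof -
    have dr: "degree (reflect_poly p) < Suc N"
      using degree_reflect_poly_le[of p] by (simp add: N_def)
    have "degree (monom 1 (Suc N) :: 'a poly) = Suc N"
      by (rule degree_monom_eq) simp
    then have "degree M = Suc N"
      unfolding M_def using dr by (metis degree_add_eq_left degree_minus uminus_add_conv_diff diff_conv_add_uminus)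
    then show ?thesis
      using dr by (simp add: M_def coeff_eq_0)
  qed
  moreover have "poly M (inverse g) = 0"
    using g(1) by (simp add: M_def poly_monom poly_reflect_poly_nz N_def flip: p(2))
  ultimately show False
    using g by (auto simp: integral_over_def)
qed

text \<open>In a ring that is maximal among those not containing \<open>1 / g\<close>, the elements \<open>1 + g r\<close>
  are invertible: otherwise the ring of fractions with these denominators would be larger.\<close>

lemma maximal_imp_local:
  assumes R: "subring_of_type R" "g \<in> R" "g \<noteq> 0" "inverse g \<notin> R"
    and max: "\<And>R'. subring_of_type R' \<Longrightarrow> R \<subseteq> R' \<Longrightarrow> inverse g \<notin> R' \<Longrightarrow> R' = R"
    and r: "r \<in> R"
  shows "inverse (1 + g * r) \<in> R"
proof -
  have nz: "1 + g * r \<noteq> 0" if "r \<in> R" for r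
  proof
    assume "1 + g * r = 0"
    then have "inverse g = - r"
      using R(3) by (simp add: field_simps add_eq_0_iff)
    then show False
      using that R subringD(5)[OF R(1)] by auto
  qed
  define R' where "R' = {a / (1 + g * r) | a r. a \<in> R \<and> r \<in> R}"
  have mem: "x \<in> R'" if "x = a / (1 + g * r)" "a \<in> R" "r \<in> R" for x a r
    using that by (auto simp: R'_def)
  have sub: "R \<subseteq> R'"
  proof
    fix a assume "a \<in> R"
    then show "a \<in> R'"
      by (intro mem[of _ a 0]) (auto intro: subringD[OF R(1)])
  qed
  have "subring_of_type R'"
    unfolding subring_of_type_def
  proof (intro conjI ballI)
    show "0 \<in> R'" "1 \<in> R'"
      using sub subringD[OF R(1)] by auto
  next
    fix x y assume "x \<in> R'" "y \<in> R'"
    then obtain a r b s where *: "a \<in> R" "r \<in> R" "b \<in> R" "s \<in> R"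
      "x = a / (1 + g * r)" "y = b / (1 + g * s)"
      by (auto simp: R'_def)
    have d: "(1 + g * r) * (1 + g * s) = 1 + g * (r + s + g * r * s)"
      by (simp add: algebra_simps)
    have "x + y = (a * (1 + g * s) + b * (1 + g * r)) / (1 + g * (r + s + g * r * s))"
      unfolding * d[symmetric] using nz * by (simp add: add_frac_eq)
    then show "x + y \<in> R'"
      by (rule mem) (use * R in \<open>auto intro!: subringD[OF R(1)]\<close>)
    have "x * y = (a * b) / (1 + g * (r + s + g * r * s))"
      unfolding * d[symmetric] by simp
    then show "x * y \<in> R'"
      by (rule mem) (use * R in \<open>auto intro!: subringD[OF R(1)]\<close>)
  next
    fix x assume "x \<in> R'"
    then obtain a r where *: "a \<in> R" "r \<in> R" "x = a / (1 + g * r)"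
      by (auto simp: R'_def)
    then show "- x \<in> R'"
      by (intro mem[of _ "- a" r]) (auto intro: subringD[OF R(1)])
  qed
  moreover have "inverse g \<notin> R'"
  proof
    assume "inverse g \<in> R'"
    then obtain a r where *: "a \<in> R" "r \<in> R" "inverse g = a / (1 + g * r)"
      by (auto simp: R'_def)
    then have "inverse g = a - r"
      using nz[of r] R(3) by (simp add: field_simps)
    then show False
      using * R subringD(6)[OF R(1)] by auto
  qed
  ultimately have "R' = R"
    using max sub by blast
  moreover have "inverse (1 + g * r) \<in> R'"
    using r subringD(2)[OF R(1)] by (intro mem[of _ 1 r]) (auto simp: inverse_eq_divide)
  ultimately show ?thesis by simp
qed

text \<open>A relation \<open>1 = g p(f)\<close> of positive degree can be shortened by means of a relation
  \<open>1 = g r(1/f)\<close> of at most the same degree, as the latter expresses the top power of \<open>f\<close>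
  by lower ones.\<close>

lemma shorten_relation:
  assumes R: "subring_of_type R" "g \<in> R" "g \<noteq> 0" "inverse g \<notin> R"
    and loc: "\<And>r. r \<in> R \<Longrightarrow> inverse (1 + g * r) \<in> R"
    and f: "f \<noteq> 0"
    and p: "p \<in> polys_over R" "g * poly p f = 1"
    and r: "r \<in> polys_over R" "g * poly r (inverse f) = 1" "degree r \<le> degree p"
  shows "\<exists>p'\<in>polys_over R. g * poly p' f = 1 \<and> degree p' < degree p"
proof -
  define n k where "n = degree p" and "k = degree r"
  have cr: "coeff r i \<in> R" for i
    using r by (simp add: polys_over_def)
  have cp: "coeff p i \<in> R" for i
    using p by (simp add: polys_over_def)
  have k: "k > 0"
  proof (rule ccontr)
    assume "\<not> k > 0"
    then obtain c where c: "r = [:c:]"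
      by (metis degree_eq_zeroE gr0I k_def)
    then have "inverse g = c"
      using r R(3) by (simp add: field_simps)
    then show False
      using R(4) cr[of 0] c by simp
  qed
  define e where "e = inverse (1 + g * (- coeff r 0))"
  have e: "e \<in> R"
    unfolding e_def using cr R by (intro loc subringD[OF R(1)])
  have enz: "1 + g * (- coeff r 0) \<noteq> 0"
  proof
    assume "1 + g * (- coeff r 0) = 0"
    then have "inverse g = coeff r 0"
      using R(3) by (simp add: field_simps)
    then show False
      using cr[of 0] R by simp
  qed
  define h where "h = (\<Sum>i\<in>{1..k}. monom (coeff r i) (n - i))"
  have hR: "h \<in> polys_over R"
    unfolding h_def using cr by (intro polys_over_sum[OF R(1)] polys_over_closed[OF R(1)])
  have "poly r (inverse f) = (\<Sum>i\<le>k. coeff r i * inverse f ^ i)"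
    by (simp add: poly_altdef k_def)
  also have "{..k} = insert 0 {1..k}"
    by auto
  finally have "poly r (inverse f) = coeff r 0 + (\<Sum>i\<in>{1..k}. coeff r i * inverse f ^ i)"
    by simp
  then have "g * (coeff r 0 + (\<Sum>i\<in>{1..k}. coeff r i * inverse f ^ i)) = 1"
    using r(2) by simp
  then have "g * (\<Sum>i\<in>{1..k}. coeff r i * inverse f ^ i) = 1 + g * (- coeff r 0)"
    unfolding distrib_left by (simp add: eq_diff_eq add.commute)
  then have "f ^ n * (g * (\<Sum>i\<in>{1..k}. coeff r i * inverse f ^ i)) = f ^ n * (1 + g * (- coeff r 0))"
    by simp
  also have "f ^ n * (g * (\<Sum>i\<in>{1..k}. coeff r i * inverse f ^ i)) = g * (\<Sum>i\<in>{1..k}. coeff r i * f ^ (n - i))"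
    unfolding sum_distrib_left
  proof (intro sum.cong refl)
    fix i assume "i \<in> {1..k}"
    then have "f ^ n = f ^ (n - i) * f ^ i"
      using r(3) by (simp add: n_def k_def flip: power_add)
    then show "f ^ n * (g * (coeff r i * inverse f ^ i)) = g * (coeff r i * f ^ (n - i))"
      using f by (simp add: field_simps)
  qed
  finally have fn: "e * (g * poly h f) = f ^ n"
    using enz by (simp add: h_def e_def poly_sum poly_monom field_simps)
  define p' where "p' = p - monom (coeff p n) n + smult (coeff p n * e * g) h"
  have "p' \<in> polys_over R"
    unfolding p'_def using cp e R p hR
    by (intro polys_over_closed[OF R(1)] subringD[OF R(1)]) 
  moreover have "poly p' f = poly p f"
    using fn by (simp add: p'_def poly_monom algebra_simps)
  moreover have "degree p' < n"
  proof (rule degree_lessI)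
    show "p' \<noteq> 0 \<or> 0 < n"
      using k r(3) by (simp add: n_def k_def)
    show "\<forall>i\<ge>n. coeff p' i = 0"
    proof (intro allI impI)
      fix i assume i: "n \<le> i"
      then have "n - j = i \<longleftrightarrow> False" if "j \<in> {1..k}" for j
        using that k r(3) by (auto simp: n_def k_def)
      then have "coeff h i = 0"
        unfolding h_def coeff_sum by (intro sum.neutral) auto
      then show "coeff p' i = 0"
        using i by (cases "i = n") (auto simp: p'_def n_def coeff_eq_0)
    qed
  qed
  ultimately show ?thesis
    using p by (intro bexI[of _ p']) (auto simp: n_def)
qed

text \<open>Chevalley's extension theorem: a ring that is maximal among those containing \<open>A\<close> and \<open>g\<close>
  but not \<open>1 / g\<close> is a valuation ring.  Such rings exist as soon as \<open>1 / g\<close> is not integral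
  over \<open>A\<close>.\<close>

lemma exists_valuation_ring:
  fixes A :: "'a::field set"
  assumes A: "subring_of_type A" and g: "g \<noteq> 0" "\<not> integral_over A (inverse g)"
  shows "\<exists>R. valuation_ring R \<and> A \<subseteq> R \<and> g \<in> R \<and> inverse g \<notin> R"
proof -
  define S where "S = {R. subring_of_type R \<and> A \<subseteq> R \<and> g \<in> R \<and> inverse g \<notin> R}"
  have "ring_adjoin A g \<in> S"
    using inverse_notin_ring_adjoin[OF A g] ring_adjoin_base[OF A] subring_ring_adjoin[OF A]
    by (auto simp: S_def)
  then have "S \<noteq> {}" by blast
  moreover have "\<Union>C \<in> S" if C: "C \<noteq> {}" "subset.chain S C" for C
  proof -
    have CS: "C \<subseteq> S"
      using C by (auto simp: subset.chain_def)
    have common: "\<exists>X\<in>C. x \<in> X \<and> y \<in> X" if "x \<in> \<Union>C" "y \<in> \<Union>C" for x y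
      using that C(2) unfolding subset_chain_def by blast
    have "subring_of_type (\<Union>C)"
      unfolding subring_of_type_def
    proof (intro conjI ballI)
      fix x y assume "x \<in> \<Union>C" "y \<in> \<Union>C"
      from common[OF this] obtain X where X: "X \<in> C" "x \<in> X" "y \<in> X" by blast
      then have "subring_of_type X"
        using CS by (auto simp: S_def)
      then show "x + y \<in> \<Union>C" "x * y \<in> \<Union>C"
        using X subringD by blast+
    next
      fix x assume "x \<in> \<Union>C"
      then obtain X where X: "X \<in> C" "x \<in> X" by blast
      then have "subring_of_type X"
        using CS by (auto simp: S_def)
      then show "- x \<in> \<Union>C"
        using X subringD by blast
    next
      obtain X where X: "X \<in> C" using C by blast
      then have "subring_of_type X"
        using CS by (auto simp: S_def)
      then show "0 \<in> \<Union>C" "1 \<in> \<Union>C"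
        using X subringD by blast+
    qed
    then show ?thesis
      using CS C(1) by (auto simp: S_def)
  qed
  ultimately obtain R where R: "R \<in> S" and max: "\<And>X. X \<in> S \<Longrightarrow> R \<subseteq> X \<Longrightarrow> X = R"
    using subset_Zorn_nonempty[of S] by blast
  have R': "subring_of_type R" "g \<in> R" "inverse g \<notin> R" "A \<subseteq> R"
    using R by (auto simp: S_def)
  have max': "X = R" if "subring_of_type X" "R \<subseteq> X" "inverse g \<notin> X" for X
    using that R' by (intro max) (auto simp: S_def)
  have loc: "inverse (1 + g * r) \<in> R" if "r \<in> R" for r
    using maximal_imp_local[OF R'(1,2) g(1) R'(3)] max' that by blast
  have rel: "\<exists>p. p \<in> polys_over R \<and> g * poly p f = 1" if f: "f \<notin> R" for f
  proof -
    have "ring_adjoin R f \<noteq> R"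
      using ring_adjoin_base[OF R'(1)] f by auto
    then have "inverse g \<in> ring_adjoin R f"
      using max'[OF subring_ring_adjoin[OF R'(1)] ring_adjoin_base(1)[OF R'(1)]] by blast
    then obtain p where "p \<in> polys_over R" "inverse g = poly p f"
      by (auto simp: ring_adjoin_def)
    then show ?thesis
      using g(1) by (intro exI[of _ p]) (simp flip: \<open>inverse g = poly p f\<close>)
  qed
  have "f \<in> R \<or> inverse f \<in> R" for f
  proof (rule ccontr)
    assume *: "\<not> (f \<in> R \<or> inverse f \<in> R)"
    have f: "f \<noteq> 0"
      using * subringD(1)[OF R'(1)] by auto
    define P where "P h p \<longleftrightarrow> p \<in> polys_over R \<and> g * poly p h = 1" for h p
    have ex: "\<exists>p. P h p \<and> (\<forall>p'. P h p' \<longrightarrow> degree p \<le> degree p')" if "h \<notin> R" for h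
      using ex_has_least_nat[of "P h" _ degree] rel[OF that] by (auto simp: P_def)
    obtain p where p: "P f p" "\<And>p'. P f p' \<Longrightarrow> degree p \<le> degree p'"
      using ex[of f] * by blast
    obtain r where r: "P (inverse f) r" "\<And>p'. P (inverse f) p' \<Longrightarrow> degree r \<le> degree p'"
      using ex[of "inverse f"] * by blast
    note sh = shorten_relation[OF R'(1,2) g(1) R'(3) loc, simplified]
    have "\<exists>p'. P f p' \<and> degree p' < degree p" if "degree r \<le> degree p"
      using sh[OF f, of p r] p(1) r(1) that by (auto simp: P_def)
    moreover have "\<exists>p'. P (inverse f) p' \<and> degree p' < degree r" if "degree p \<le> degree r"
      using sh[of "inverse f" r p] f p(1) r(1) that by (auto simp: P_def)
    ultimately show False
      using p(2) r(2) by (metis linorder_not_less nat_le_linear)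
  qed
  then show ?thesis
    using R' by (auto simp: valuation_ring_def)
qed

definition vunit :: "'a::field set \<Rightarrow> 'a \<Rightarrow> bool" where
  "vunit R e \<longleftrightarrow> e \<noteq> 0 \<and> e \<in> R \<and> inverse e \<in> R"

context
  fixes R :: "'a::field set"
  assumes R: "valuation_ring R"
begin

lemma vring_subring: "subring_of_type R"
  using R by (simp add: valuation_ring_def)

lemma vring_cases: "f \<in> R \<or> inverse f \<in> R"
  using R by (simp add: valuation_ring_def)

lemma vunit_mult: "vunit R a \<Longrightarrow> vunit R b \<Longrightarrow> vunit R (a * b)"
  using subringD(4)[OF vring_subring] by (auto simp: vunit_def)

lemma vunit_inverse: "vunit R a \<Longrightarrow> vunit R (inverse a)"
  by (auto simp: vunit_def)

lemma vunit_divide: "vunit R a \<Longrightarrow> vunit R b \<Longrightarrow> vunit R (a / b)"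
  unfolding divide_inverse by (intro vunit_mult vunit_inverse)

lemma vunit_1: "vunit R 1"
  using subringD(2)[OF vring_subring] by (auto simp: vunit_def)

lemma vunit_power: "vunit R a \<Longrightarrow> vunit R (a ^ k)"
  by (induction k) (auto intro: vunit_mult vunit_1)

lemma vunit_prod_left: "vunit R (a * b) \<Longrightarrow> a \<in> R \<Longrightarrow> b \<in> R \<Longrightarrow> vunit R a"
proof -
  assume *: "vunit R (a * b)" "a \<in> R" "b \<in> R"
  then have "b * inverse (a * b) \<in> R"
    by (intro subringD[OF vring_subring]) (auto simp: vunit_def)
  moreover have ab: "a \<noteq> 0" "b \<noteq> 0"
    using * by (auto simp: vunit_def)
  then have "b * inverse (a * b) = inverse a"
    by (simp add: field_simps)
  ultimately show ?thesis
    using ab * unfolding vunit_def by metis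
qed

text \<open>One of \<open>a / b\<close> and \<open>b / a\<close> lies in \<open>R\<close>, so one of the two summands can be factored out of the sum.\<close>

lemma nonunit_add:
  assumes "a \<in> R" "\<not> vunit R a" "b \<in> R" "\<not> vunit R b"
  shows "\<not> vunit R (a + b)"
proof
  have *: False if "a \<in> R" "\<not> vunit R a" "b \<in> R" "\<not> vunit R b" "b \<noteq> 0" "a / b \<in> R" "vunit R (a + b)" for a b
  proof -
    have "a + b = b * (a / b + 1)"
      using that by (simp add: field_simps)
    moreover have "a / b + 1 \<in> R"
      using that subringD[OF vring_subring] by blast
    ultimately show False
      using that vunit_prod_left[of b "a / b + 1"] by auto
  qed
  assume **: "vunit R (a + b)"
  show False
  proof (cases "a = 0 \<or> b = 0")
    case True
    then show ?thesis using assms ** by auto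
  next
    case False
    have "a / b \<in> R \<or> b / a \<in> R"
      using vring_cases[of "a / b"] by simp
    then show ?thesis
      using *[of a b] *[of b a] assms ** False by (auto simp: add.commute)
  qed
qed

lemma nonunit_sum:
  assumes "\<And>i. i \<in> I \<Longrightarrow> T i \<in> R \<and> \<not> vunit R (T i)"
  shows "sum T I \<in> R \<and> \<not> vunit R (sum T I)"
  using assms
proof (induction I rule: infinite_finite_induct)
  case (insert i I)
  then have "T i \<in> R" "\<not> vunit R (T i)" "sum T I \<in> R" "\<not> vunit R (sum T I)"
    by auto
  then show ?case
    using insert.hyps nonunit_add subringD(3)[OF vring_subring] by simp
qed (auto simp: vunit_def intro: subringD[OF vring_subring])

lemma dominant_term:
  assumes "finite I" "I \<noteq> {}" "\<And>i. i \<in> I \<Longrightarrow> T i \<noteq> 0"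
  shows "\<exists>j\<in>I. \<forall>i\<in>I. T i / T j \<in> R"
  using assms
proof (induction I rule: finite_ne_induct)
  case (singleton i)
  then show ?case
    using subringD(2)[OF vring_subring] by simp
next
  case (insert k I)
  then obtain j where j: "j \<in> I" "\<forall>i\<in>I. T i / T j \<in> R"
    by auto
  show ?case
  proof (cases "T k / T j \<in> R")
    case True
    then show ?thesis
      using j by blast
  next
    case False
    then have *: "T j / T k \<in> R"
      using vring_cases[of "T k / T j"] by simp
    have "T i / T k \<in> R" if "i \<in> I" for i
    proof -
      have "T j \<noteq> 0"
        using insert.prems j by blast
      then have "T i / T k = (T i / T j) * (T j / T k)"
        by simp
      moreover have "T i / T j \<in> R"
        using j that by blast
      ultimately show ?thesis
        using subringD(4)[OF vring_subring _ *] by metis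
    qed
    moreover have "T k / T k \<in> R"
      using insert.prems subringD(2)[OF vring_subring] by simp
    ultimately show ?thesis
      by blast
  qed
qed

end

context
  fixes R :: "'a::field set"
  assumes R: "valuation_ring R"
begin

text \<open>Otherwise all terms but a dominant one, divided by the latter, would be nonunits with sum \<open>-1\<close>.\<close>

lemma vanishing_sum_associates:
  assumes "finite I" "I \<noteq> {}" "\<And>i. i \<in> I \<Longrightarrow> T i \<noteq> 0" "sum T I = 0"
  shows "\<exists>i\<in>I. \<exists>j\<in>I. i \<noteq> j \<and> vunit R (T i / T j)"
proof (rule ccontr)
  assume *: "\<not> ?thesis"
  have "\<exists>j\<in>I. \<forall>i\<in>I. T i / T j \<in> R"
    by (rule dominant_term[OF R assms(1,2), of T]) (rule assms(3))
  then obtain j where j: "j \<in> I" "\<forall>i\<in>I. T i / T j \<in> R"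
    by (elim bexE)
  have "T i / T j \<in> R \<and> \<not> vunit R (T i / T j)" if "i \<in> I - {j}" for i
    using that j * by blast
  then have "\<not> vunit R (\<Sum>i\<in>I - {j}. T i / T j)"
    using nonunit_sum[OF R, where T = "\<lambda>i. T i / T j" and I = "I - {j}"] by simp
  moreover have "(\<Sum>i\<in>I - {j}. T i / T j) = - 1"
  proof -
    have "0 = (\<Sum>i\<in>I. T i / T j)"
      unfolding sum_divide_distrib[symmetric] assms(4) by simp
    also have "\<dots> = T j / T j + (\<Sum>i\<in>I - {j}. T i / T j)"
      using assms(1) j(1) by (rule sum.remove)
    finally have "1 + (\<Sum>i\<in>I - {j}. T i / T j) = 0"
      using assms(3)[OF j(1)] by simp
    then show ?thesis
      unfolding add_eq_0_iff .
  qed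
  moreover have "vunit R (- 1)"
    using vunit_1[OF R] subringD(5)[OF vring_subring[OF R], of 1] by (simp add: vunit_def)
  ultimately show False by simp
qed

lemma vunit_powi_nonunit:
  assumes "vunit R (d powi k)" "d \<in> R" "d \<noteq> 0" "\<not> vunit R d"
  shows "k = 0"
proof -
  have *: False if "vunit R (d ^ Suc j)" for j
    using vunit_prod_left[OF R, of d "d ^ j"] that assms subringD(7)[OF vring_subring[OF R]] by auto
  have **: False if "vunit R (d ^ j)" "j > 0" for j
    using *[of "j - 1"] that by simp
  show ?thesis
  proof (rule ccontr)
    assume k: "k \<noteq> 0"
    show False
    proof (cases "k > 0")
      case True
      then have "d powi k = d ^ nat k"
        by (simp add: power_int_def)
      then show ?thesis using **[of "nat k"] True assms(1) by simp
    next
      case False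
      then have "inverse (d powi k) = d ^ nat (- k)"
        using k by (auto simp: power_int_def power_inverse)
      then show ?thesis using **[of "nat (- k)"] False assms k vunit_inverse[OF R, of "d powi k"] by auto
    qed
  qed
qed

text \<open>The rational number \<open>k / N\<close> is the value of \<open>f\<close> relative to that of \<open>d\<close>.  As the
  denominators are bounded, the value group is infinite cyclic.\<close>

lemma place_of_valuation_ring:
  assumes K: "subfield_of_type K" "K \<subseteq> R"
    and d: "d \<in> R" "d \<noteq> 0" "\<not> vunit R d"
    and N: "N > 0" "\<And>f. f \<noteq> 0 \<Longrightarrow> \<exists>k. vunit R (f ^ N / d powi k)"
  shows "\<exists>Q. place K Q \<and> (\<forall>f. 0 \<le> Q f \<longleftrightarrow> f \<in> R)"
proof -
  define v where "v f = (SOME k. vunit R (f ^ N / d powi k))" for f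
  have v: "vunit R (f ^ N / d powi (v f))" if "f \<noteq> 0" for f
    unfolding v_def using N(2)[OF that] by (rule someI_ex)
  have v_eq: "v f = k" if "f \<noteq> 0" "vunit R (f ^ N / d powi k)" for f k
  proof -
    have "(f ^ N / d powi k) / (f ^ N / d powi (v f)) = d powi (v f) / d powi k"
      using that d by auto
    also have "\<dots> = d powi (v f - k)"
      using d by (simp add: power_int_diff)
    finally show ?thesis
      using vunit_divide[OF R that(2) v[OF that(1)]] vunit_powi_nonunit[OF _ d, of "v f - k"] by auto
  qed
  have v_mult: "v (f * g) = v f + v g" if "f \<noteq> 0" "g \<noteq> 0" for f g
  proof (rule v_eq)
    have "(f * g) ^ N / d powi (v f + v g) = (f ^ N / d powi (v f)) * (g ^ N / d powi (v g))"
      using d by (simp add: power_int_add power_mult_distrib)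
    then show "vunit R ((f * g) ^ N / d powi (v f + v g))"
      using vunit_mult[OF R v v] that by metis
  qed (use that in auto)
  have v_1: "v 1 = 0"
    by (rule v_eq) (auto intro: vunit_1[OF R])
  have v_inv: "v (inverse f) = - v f" if "f \<noteq> 0" for f
    using v_mult[of f "inverse f"] that v_1 by simp
  have v_pow: "v (f ^ k) = int k * v f" if "f \<noteq> 0" for f k
    using that by (induction k) (auto simp: v_1 v_mult algebra_simps)
  have v_powi: "v (f powi k) = k * v f" if "f \<noteq> 0" for f k
    using that by (auto simp: power_int_def v_pow v_inv)
  have v_d: "v d = int N"
    by (rule v_eq) (use d vunit_1[OF R] in auto)
  have v_nonneg: "0 \<le> v f" if "f \<in> R" "f \<noteq> 0" for f
  proof (rule ccontr)
    assume "\<not> 0 \<le> v f"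
    then obtain j where j: "v f = - int (Suc j)"
      by (metis int_cases not_less of_nat_0_le_iff)
    have "f ^ N / d powi (v f) = d * (d ^ j * f ^ N)"
      unfolding j power_int_minus power_int_of_nat by (simp add: divide_inverse ac_simps)
    then show False
      using v[OF that(2)] vunit_prod_left[OF R, of d "d ^ j * f ^ N"] d that
        subringD(4,7)[OF vring_subring[OF R]] by simp
  qed
  have v_nonneg_iff: "0 \<le> v f \<longleftrightarrow> f \<in> R" if f: "f \<noteq> 0" for f
  proof
    assume "0 \<le> v f"
    show "f \<in> R"
    proof (rule ccontr)
      assume *: "f \<notin> R"
      then have **: "inverse f \<in> R"
        using vring_cases[OF R] by blast
      then have "v f = 0"
        using v_nonneg[of "inverse f"] v_inv f \<open>0 \<le> v f\<close> by simp
      then have "f ^ N \<in> R"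
        using v[OF f] by (simp add: vunit_def)
      then have "f ^ N * inverse f ^ (N - 1) \<in> R"
        using ** subringD(4)[OF vring_subring[OF R]] subringD(7)[OF vring_subring[OF R]] by blast
      moreover have "f ^ N * inverse f ^ (N - 1) = f"
      proof -
        obtain N' where "N = Suc N'"
          using N(1) gr0_implies_Suc by blast
        then show ?thesis
          using f by (simp add: power_inverse)
      qed
      ultimately show False using * by simp
    qed
  qed (use v_nonneg f in blast)
  define pos where "pos k \<longleftrightarrow> k > 0 \<and> (\<exists>f. f \<noteq> 0 \<and> v f = int k)" for k
  have "pos N"
    using N d v_d by (auto simp: pos_def)
  define e where "e = (LEAST k. pos k)"
  have e: "pos e" "\<And>k. pos k \<Longrightarrow> e \<le> k"
    unfolding e_def using \<open>pos N\<close> by (auto intro: LeastI Least_le)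
  obtain g where g: "g \<noteq> 0" "v g = int e"
    using e by (auto simp: pos_def)
  have e0: "e > 0" using e by (simp add: pos_def)
  have dvd: "int e dvd v f" if f: "f \<noteq> 0" for f
  proof -
    have "v (f * g powi (- (v f div int e))) = v f mod int e"
      using f g by (simp add: v_mult v_powi minus_div_mult_eq_mod[symmetric])
    moreover have "f * g powi (- (v f div int e)) \<noteq> 0"
      using f g by simp
    ultimately have "pos (nat (v f mod int e))" if "0 < v f mod int e"
      using that unfolding pos_def by (metis int_nat_eq less_le_not_le zero_less_nat_eq)
    then have "\<not> 0 < v f mod int e"
      using e(2)[of "nat (v f mod int e)"] e0 pos_mod_bound[of "int e" "v f"] by linarith
    moreover have "0 \<le> v f mod int e"
      using e0 by simp
    ultimately show ?thesis
      by (simp add: dvd_eq_mod_eq_0)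
  qed
  define Q where "Q f = (if f = 0 then 0 else v f div int e)" for f
  have Qv: "v f = int e * Q f" if "f \<noteq> 0" for f
    using dvd[OF that] that by (simp add: Q_def)
  have Q_iff: "0 \<le> Q f \<longleftrightarrow> f \<in> R" for f
  proof (cases "f = 0")
    case True
    then show ?thesis using subringD(1)[OF vring_subring[OF R]] by (simp add: Q_def)
  next
    case False
    then have "0 \<le> Q f \<longleftrightarrow> 0 \<le> v f"
      using Qv[OF False] e0 by (simp add: zero_le_mult_iff)
    then show ?thesis
      using v_nonneg_iff[OF False] by simp
  qed
  have Q_mult: "Q (f * g) = Q f + Q g" if "f \<noteq> 0" "g \<noteq> 0" for f g
  proof -
    have "int e * Q (f * g) = int e * (Q f + Q g)"
      using Qv[of "f * g"] Qv[of f] Qv[of g] v_mult[OF that] that by (simp add: algebra_simps)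
    then show ?thesis using e0 by simp
  qed
  have Q_1: "Q 1 = 0"
    by (simp add: Q_def v_1)
  have Q_inv: "Q (inverse f) = - Q f" if "f \<noteq> 0" for f
    using Q_mult[of f "inverse f"] that Q_1 by simp
  have Q_add: "min (Q f) (Q g) \<le> Q (f + g)" if "f \<noteq> 0" "g \<noteq> 0" "f + g \<noteq> 0" for f g
  proof -
    have *: "Q f \<le> Q (f + g)" if "Q f \<le> Q g" "f \<noteq> 0" "g \<noteq> 0" "f + g \<noteq> 0" for f g
    proof -
      have "0 \<le> Q (g * inverse f)"
        using that by (simp add: Q_mult Q_inv)
      then have "g * inverse f + 1 \<in> R"
        using Q_iff subringD[OF vring_subring[OF R]] by blast
      moreover have "g * inverse f + 1 = (f + g) * inverse f"
        using that by (simp add: field_simps)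
      ultimately have "0 \<le> Q ((f + g) * inverse f)"
        using Q_iff by metis
      then show ?thesis
        using that by (simp add: Q_mult Q_inv)
    qed
    show ?thesis
      using *[of f g] *[of g f] that by (auto simp: add.commute min_def)
  qed
  have Q_K: "Q c = 0" if "c \<in> K" for c
  proof (cases "c = 0")
    case True
    then show ?thesis by (simp add: Q_def)
  next
    case False
    have "0 \<le> Q c" "0 \<le> Q (inverse c)"
      using K that subfieldD(1)[OF K(1) that] by (auto simp: Q_iff)
    then show ?thesis
      using Q_inv[OF False] by simp
  qed
  have "surj Q"
  proof (rule surjI)
    show "Q (g powi k) = k" for k
      using g v_powi[of g k] e0 by (simp add: Q_def)
  qed
  then have "place K Q"
    using Q_mult Q_add Q_K by (simp add: place_def Q_def)
  then show ?thesis
    using Q_iff by blast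
qed

end

text \<open>The valuation ring comes from Chevalley's theorem.  In it, every nonzero \<open>c(u)\<close> is a power of a nonunit \<open>D(u)\<close> of smallest degree
  times a unit; and by an algebraic equation of bounded degree some power \<open>f\<^sup>k\<close> with
  \<open>k \<le> card J\<close> has the value of an element of \<open>K(u)\<close>.  Hence the values of all functions are
  multiples of that of \<open>D(u)\<close> divided by \<open>(card J)!\<close>.\<close>

theorem exists_place_with_pole:
  fixes K :: "'a::field set" and b :: "'i \<Rightarrow> 'a"
  assumes K: "subfield_of_type K" and u: "transcendental_over K u"
    and J: "finite J" "lin_combs (fractions (ring_adjoin K u)) b J = UNIV"
    and f: "\<not> integral_over (ring_adjoin K u) f"
  shows "\<exists>Q. place K Q \<and> 0 \<le> Q u \<and> Q f < 0"
proof -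
  note KR = subfield_imp_subring[OF K]
  define A where "A = ring_adjoin K u"
  have A: "subring_of_type A"
    unfolding A_def by (rule subring_ring_adjoin[OF KR])
  define L where "L = fractions A"
  have L: "subfield_of_type L"
    unfolding L_def by (rule subfield_fractions[OF A])
  have "integral_over A 0"
    unfolding integral_over_def using subringD[OF A]
    by (intro bexI[of _ "[:0, 1:]"]) (auto intro!: polys_over_closed[OF A] polys_over_0)
  then have f0: "f \<noteq> 0"
    using f by (auto simp: A_def)
  obtain R where R: "valuation_ring R" "A \<subseteq> R" "inverse f \<in> R" "f \<notin> R"
    using exists_valuation_ring[OF A, of "inverse f"] f f0 by (auto simp: A_def)
  note RR = vring_subring[OF R(1)]
  have KA: "K \<subseteq> A" "u \<in> A"
    using ring_adjoin_base[OF KR] by (auto simp: A_def)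
  have relation: "\<exists>p\<in>polys_over L. p \<noteq> 0 \<and> degree p \<le> card J \<and> poly p h = 0" for h
    using power_relation[OF L J(1), of h b] J(2) by (auto simp: L_def A_def)
  have nz: "poly p u \<noteq> 0" if "p \<in> polys_over K" "p \<noteq> 0" for p
    using u that by (auto simp: transcendental_over_def polys_over_def)
  define good where "good p \<longleftrightarrow> p \<in> polys_over K \<and> p \<noteq> 0 \<and> \<not> vunit R (poly p u)" for p
  have inR: "poly p u \<in> R" if "p \<in> polys_over K" for p
    using that R(2) ring_adjoinI[of p K u] by (auto simp: A_def)
  have "\<exists>p. good p"
  proof (rule ccontr)
    assume *: "\<nexists>p. good p"
    have "a / c \<in> R" if ac: "a \<in> A" "c \<in> A" for a c
    proof (cases "c = 0")
      case True
      then show ?thesis using subringD(1)[OF RR] by simp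
    next
      case False
      obtain p where "p \<in> polys_over K" "c = poly p u"
        using ac by (auto simp: A_def ring_adjoin_def)
      then have "inverse c \<in> R"
        using * False by (auto simp: good_def vunit_def)
      then show ?thesis
        unfolding divide_inverse using ac R subringD(4)[OF RR] by blast
    qed
    then have "L \<subseteq> R"
      by (auto simp: L_def fractions_def)
    moreover obtain p where "p \<in> polys_over L" "p \<noteq> 0" "poly p (inverse f) = 0"
      using relation by blast
    ultimately have "inverse (inverse f) \<in> R"
      using inverse_in_subring_of_algebraic[OF L RR _ R(3)] f0 by auto
    then show False using R by simp
  qed
  then obtain D where D: "good D" "\<And>p. good p \<Longrightarrow> degree D \<le> degree p"
    using ex_has_least_nat[of good _ degree] by blast
  define d where "d = poly D u"
  have d: "d \<in> R" "d \<noteq> 0" "\<not> vunit R d"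
    using D(1) inR nz by (auto simp: good_def d_def)
  have Dpos: "degree D > 0"
  proof (rule ccontr)
    assume "\<not> degree D > 0"
    then obtain c where c: "D = [:c:]"
      using degree_eq_zeroE by auto
    have "coeff D 0 \<in> K"
      using D(1) by (simp add: good_def polys_over_def)
    then have "c \<in> K" "c \<noteq> 0"
      using D(1) c by (auto simp: good_def)
    then have "vunit R d"
      using subfieldD(1)[OF K \<open>c \<in> K\<close>] KA R(2) by (auto simp: vunit_def d_def c)
    then show False using d by simp
  qed
  have dpow: "\<exists>k::nat. vunit R (poly p u / d ^ k)" if "p \<in> polys_over K" "p \<noteq> 0" for p
    using that
  proof (induction "degree p" arbitrary: p rule: less_induct)
    case less
    obtain s r where sr: "s \<in> polys_over K" "r \<in> polys_over K" "p = s * D + r"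
      "r = 0 \<or> degree r < degree D"
      using subfield_division[OF K _ _ less.prems(1), of D] D(1) by (auto simp: good_def)
    show ?case
    proof (cases "r = 0")
      case True
      then have s0: "s \<noteq> 0"
        using sr less.prems by auto
      then have "degree s < degree p"
      proof -
        have "D \<noteq> 0" "p = s * D"
          using D(1) True sr(3) by (auto simp: good_def)
        then show ?thesis
          using s0 Dpos by (simp add: degree_mult_eq)
      qed
      then obtain k where "vunit R (poly s u / d ^ k)"
        using less.hyps[of s] sr s0 by blast
      moreover have "poly p u / d ^ Suc k = poly s u / d ^ k"
        using True sr d by (simp add: d_def)
      ultimately show ?thesis by metis
    next
      case False
      then have r: "vunit R (poly r u)"
        using D(2)[of r] sr by (auto simp: good_def)
      have "\<not> vunit R (- (d * poly s u))"
      proof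
        assume "vunit R (- (d * poly s u))"
        then have "vunit R (d * (- poly s u))"
          by simp
        then show False
          using vunit_prod_left[OF R(1)] d inR[OF sr(1)] subringD(5)[OF RR] by blast
      qed
      then have "vunit R (poly p u)"
        using nonunit_add[OF R(1), of "poly p u" "- (d * poly s u)"] inR[OF less.prems(1)] r d
          inR[OF sr(1)] subringD(4,5)[OF RR] sr(3) by (auto simp: d_def algebra_simps)
      then show ?thesis
        by (intro exI[of _ 0]) simp
    qed
  qed
  have Lpow: "\<exists>k::int. vunit R (c / d powi k)" if c: "c \<in> L" "c \<noteq> 0" for c
  proof -
    obtain a a' where "a \<in> A" "a' \<in> A" "a' \<noteq> 0" "c = a / a'"
      by (rule fractionsE[OF A c(1)[unfolded L_def]])
    then obtain p p' where p: "p \<in> polys_over K" "p' \<in> polys_over K" "poly p u \<noteq> 0" "poly p' u \<noteq> 0"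
      "c = poly p u / poly p' u"
      using c(2) by (auto simp: A_def ring_adjoin_def)
    then obtain k k' where k: "vunit R (poly p u / d ^ k)" "vunit R (poly p' u / d ^ k')"
      using dpow[of p] dpow[of p'] p by (metis poly_0)
    have "c / d powi (int k - int k') = (poly p u / d ^ k) / (poly p' u / d ^ k')"
      using d p by (simp add: power_int_diff)
    then show ?thesis
      using vunit_divide[OF R(1) k] by metis
  qed
  define N where "N = (fact (card J) :: nat)"
  have "\<exists>k. vunit R (h ^ N / d powi k)" if h: "h \<noteq> 0" for h
  proof -
    obtain p where p: "p \<in> polys_over L" "p \<noteq> 0" "degree p \<le> card J" "poly p h = 0"
      using relation by blast
    define I where "I = {i. i \<le> degree p \<and> coeff p i \<noteq> 0}"
    define T where "T i = coeff p i * h ^ i" for i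
    have "sum T I = 0"
    proof -
      have "poly p h = (\<Sum>i\<le>degree p. T i)"
        by (simp add: poly_altdef T_def)
      also have "\<dots> = sum T I"
        by (intro sum.mono_neutral_right) (auto simp: I_def T_def)
      finally show ?thesis using p by simp
    qed
    moreover have "degree p \<in> I"
      using p by (simp add: I_def)
    then have "finite I" "I \<noteq> {}"
      by (auto simp: I_def)
    moreover have "T i \<noteq> 0" if "i \<in> I" for i
      using that h by (simp add: I_def T_def)
    ultimately obtain i j where ij: "i \<in> I" "j \<in> I" "i \<noteq> j" "vunit R (T i / T j)"
      using vanishing_sum_associates[OF R(1), of I T] by metis
    have main: "\<exists>e k. 0 < e \<and> e \<le> card J \<and> vunit R (h ^ e / d powi k)"
      if ij: "i \<in> I" "j \<in> I" "j < i" "vunit R (T i / T j)" for i j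
    proof -
      obtain k k' where k: "vunit R (coeff p i / d powi k)" "vunit R (coeff p j / d powi k')"
        using Lpow[of "coeff p i"] Lpow[of "coeff p j"] ij p(1) by (auto simp: I_def polys_over_def)
      have "h ^ i = h ^ (i - j) * h ^ j"
        using ij by (simp flip: power_add)
      then have "h ^ (i - j) / d powi (k' - k) =
          (T i / T j) * ((coeff p j / d powi k') / (coeff p i / d powi k))"
        using ij h d by (simp add: T_def I_def power_int_diff)
      then have "vunit R (h ^ (i - j) / d powi (k' - k))"
        using vunit_mult[OF R(1) ij(4) vunit_divide[OF R(1) k(2,1)]] by simp
      moreover have "0 < i - j" "i - j \<le> card J"
        using ij p(3) by (auto simp: I_def)
      ultimately show ?thesis by blast
    qed
    have "\<exists>e k. 0 < e \<and> e \<le> card J \<and> vunit R (h ^ e / d powi k)"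
    proof (cases "j < i")
      case True
      then show ?thesis using main ij by blast
    next
      case False
      moreover have "vunit R (T j / T i)"
        using vunit_inverse[OF R(1) ij(4)] by simp
      ultimately show ?thesis using main[of j i] ij by simp
    qed
    then obtain e k where ek: "0 < e" "e \<le> card J" "vunit R (h ^ e / d powi k)"
      by blast
    then obtain t where t: "N = e * t"
      unfolding N_def using dvd_fact[of e "card J"] by (auto elim: dvdE)
    have "(h ^ e / d powi k) ^ t = h ^ N / d powi (k * int t)"
      by (simp add: t power_divide power_mult power_int_mult)
    then show ?thesis
      using vunit_power[OF R(1) ek(3), of t] by metis
  qed
  moreover have "N > 0"
    by (simp add: N_def)
  ultimately obtain Q where Q: "place K Q" "\<And>f. 0 \<le> Q f \<longleftrightarrow> f \<in> R"
    using place_of_valuation_ring[OF R(1) K _ d, of N] KA R(2) by blast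
  then show ?thesis
    using R KA by (intro exI[of _ Q]) (auto simp flip: Q(2) simp: not_le[symmetric])
qed

section \<open>Arithmetic of a place\<close>

text \<open>The value of \<open>0\<close> should be \<open>\<infinity>\<close> but is the dummy \<open>0\<close>, hence the separate case.  For the bound
  \<open>k = 0\<close> the dummy value does no harm.\<close>

definition at_least :: "('a::field \<Rightarrow> int) \<Rightarrow> int \<Rightarrow> 'a \<Rightarrow> bool" where
  "at_least Q k f \<longleftrightarrow> f = 0 \<or> k \<le> Q f"

context
  fixes K :: "'a::field set" and Q :: "'a \<Rightarrow> int"
  assumes Q: "place K Q"
begin

lemma place_0: "Q 0 = 0"
  using Q by (simp add: place_def)

lemma place_const: "c \<in> K \<Longrightarrow> Q c = 0"
  using Q by (simp add: place_def)

lemma place_mult: "f \<noteq> 0 \<Longrightarrow> g \<noteq> 0 \<Longrightarrow> Q (f * g) = Q f + Q g"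
  using Q by (simp add: place_def)

lemma place_add: "f \<noteq> 0 \<Longrightarrow> g \<noteq> 0 \<Longrightarrow> f + g \<noteq> 0 \<Longrightarrow> min (Q f) (Q g) \<le> Q (f + g)"
  using Q by (simp add: place_def)

lemma place_1: "Q 1 = 0"
  using place_mult[of 1 1] by simp

lemma place_minus: "Q (- f) = Q f"
proof (cases "f = 0")
  case False
  have "Q (- 1) = 0"
    using place_mult[of "- 1" "- 1"] place_1 by simp
  then show ?thesis
    using place_mult[of "- 1" f] False by simp
qed simp

lemma place_inverse: "Q (inverse f) = - Q f"
proof (cases "f = 0")
  case True
  then show ?thesis by (simp add: place_0)
next
  case False
  then show ?thesis
    using place_mult[of f "inverse f"] place_1 by simp
qed

lemma place_divide: "f \<noteq> 0 \<Longrightarrow> g \<noteq> 0 \<Longrightarrow> Q (f / g) = Q f - Q g"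
  by (simp add: divide_inverse place_mult place_inverse)

lemma place_power: "Q (f ^ k) = int k * Q f"
proof (cases "f = 0")
  case True
  then show ?thesis by (cases k) (auto simp: place_0 place_1)
next
  case False
  then show ?thesis by (induction k) (auto simp: place_1 place_mult algebra_simps)
qed

lemma at_least_0: "at_least Q 0 f \<longleftrightarrow> 0 \<le> Q f"
  by (auto simp: at_least_def place_0)

lemma at_least_add: "at_least Q k f \<Longrightarrow> at_least Q k g \<Longrightarrow> at_least Q k (f + g)"
  using place_add[of f g] by (fastforce simp: at_least_def min_le_iff_disj)

lemma at_least_minus: "at_least Q k f \<Longrightarrow> at_least Q k (- f)"
  by (auto simp: at_least_def place_minus)

lemma at_least_diff: "at_least Q k f \<Longrightarrow> at_least Q k g \<Longrightarrow> at_least Q k (f - g)"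
  using at_least_add[of k f "- g"] at_least_minus[of k g] by simp

lemma at_least_sum: "(\<And>i. i \<in> I \<Longrightarrow> at_least Q k (T i)) \<Longrightarrow> at_least Q k (sum T I)"
  by (induction I rule: infinite_finite_induct) (auto intro: at_least_add simp: at_least_def[of Q k 0])

lemma at_least_mult: "at_least Q k f \<Longrightarrow> at_least Q l g \<Longrightarrow> at_least Q (k + l) (f * g)"
  by (cases "f = 0 \<or> g = 0") (auto simp: at_least_def place_mult)

lemma at_least_mono: "at_least Q k f \<Longrightarrow> l \<le> k \<Longrightarrow> at_least Q l f"
  by (auto simp: at_least_def)

lemma subring_regular: "subring_of_type {f. 0 \<le> Q f}"
  using at_least_add[of 0] at_least_mult[of 0 _ 0]
  by (auto simp: subring_of_type_def place_0 place_1 place_minus at_least_0)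

lemma dominant_summand:
  assumes "f \<noteq> 0" "at_least Q (Q f + 1) g"
  shows "f + g \<noteq> 0 \<and> Q (f + g) = Q f"
proof (cases "g = 0")
  case True
  then show ?thesis using assms by simp
next
  case False
  then have *: "Q f < Q g"
    using assms by (simp add: at_least_def)
  have nz: "f + g \<noteq> 0"
  proof
    assume "f + g = 0"
    then have "g = - f"
      by (simp add: add_eq_0_iff)
    then show False
      using * place_minus by simp
  qed
  have "min (Q (f + g)) (Q (- g)) \<le> Q (f + g + - g)"
    using nz False assms by (intro place_add) auto
  then have "min (Q (f + g)) (Q g) \<le> Q f"
    by (simp add: place_minus)
  then show ?thesis
    using place_add[of f g] nz assms False * by auto
qed

lemma place_sum_distinct:
  assumes "finite I" "inj_on (\<lambda>i. Q (T i)) {i\<in>I. T i \<noteq> 0}" "\<exists>i\<in>I. T i \<noteq> 0"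
  shows "sum T I \<noteq> 0 \<and> (\<exists>i\<in>I. T i \<noteq> 0 \<and> Q (sum T I) = Q (T i) \<and> (\<forall>j\<in>I. T j \<noteq> 0 \<longrightarrow> Q (T i) \<le> Q (T j)))"
proof -
  define J where "J = {i\<in>I. T i \<noteq> 0}"
  have J: "finite J" "J \<noteq> {}"
    using assms by (auto simp: J_def)
  obtain i where i: "i \<in> J" "\<And>j. j \<in> J \<Longrightarrow> Q (T i) \<le> Q (T j)"
    using arg_min_if_finite[OF J, of "\<lambda>i. Q (T i)"] by (metis not_less)
  have "Q (T i) < Q (T j)" if "j \<in> J - {i}" for j
  proof -
    have "Q (T i) \<noteq> Q (T j)"
      using that i assms(2) by (auto simp: J_def inj_on_def)
    then show ?thesis
      using i(2)[of j] that by simp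
  qed
  then have "at_least Q (Q (T i) + 1) (\<Sum>j\<in>J - {i}. T j)"
    by (intro at_least_sum) (force simp: at_least_def)
  moreover have "sum T I = T i + (\<Sum>j\<in>J - {i}. T j)"
  proof -
    have "sum T I = sum T J"
      using assms(1) by (intro sum.mono_neutral_right) (auto simp: J_def)
    also have "\<dots> = T i + (\<Sum>j\<in>J - {i}. T j)"
      using J i by (intro sum.remove) auto
    finally show ?thesis .
  qed
  ultimately have "sum T I \<noteq> 0 \<and> Q (sum T I) = Q (T i)"
    using dominant_summand[of "T i"] i by (simp add: J_def)
  then show ?thesis
    using i by (auto simp: J_def intro!: bexI[of _ i])
qed

text \<open>At a pole of \<open>f\<close> the leading term of a polynomial in \<open>f\<close> dominates.\<close>

lemma place_poly_at_pole:
  assumes "Q f < 0" "p \<noteq> 0" "\<And>i. 0 \<le> Q (coeff p i)" "Q (lead_coeff p) = 0"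
  shows "poly p f \<noteq> 0 \<and> Q (poly p f) = int (degree p) * Q f"
proof -
  define n where "n = degree p"
  have f0: "f \<noteq> 0"
    using assms(1) place_0 by auto
  have "poly p f = lead_coeff p * f ^ n + (\<Sum>i<n. coeff p i * f ^ i)"
    by (simp add: poly_altdef n_def flip: lessThan_Suc_atMost)
  moreover have lt: "lead_coeff p * f ^ n \<noteq> 0" "Q (lead_coeff p * f ^ n) = int n * Q f"
    using assms f0 by (auto simp: place_mult place_power)
  moreover have "at_least Q (int n * Q f + 1) (\<Sum>i<n. coeff p i * f ^ i)"
  proof (intro at_least_sum)
    fix i assume "i \<in> {..<n}"
    then have "int i + 1 \<le> int n" by simp
    then have "int n * Q f \<le> (int i + 1) * Q f"
      using assms(1) by (intro mult_right_mono_neg) auto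
    then have "int n * Q f + 1 \<le> int i * Q f"
      using assms(1) by (simp add: algebra_simps)
    then show "at_least Q (int n * Q f + 1) (coeff p i * f ^ i)"
      using assms(3)[of i] f0 by (cases "coeff p i = 0") (simp_all add: at_least_def place_mult place_power)
  qed
  ultimately show ?thesis
    using dominant_summand[of "lead_coeff p * f ^ n"] by (simp add: n_def)
qed

lemma regular_if_integral:
  assumes "\<And>a. a \<in> A \<Longrightarrow> 0 \<le> Q a" "integral_over A f"
  shows "0 \<le> Q f"
proof (rule ccontr)
  assume "\<not> 0 \<le> Q f"
  then have "Q f < 0" by simp
  obtain p where p: "p \<in> polys_over A" "lead_coeff p = 1" "poly p f = 0"
    using assms(2) by (auto simp: integral_over_def)
  moreover have "p \<noteq> 0" "Q (lead_coeff p) = 0"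
    using p(2) place_1 by auto
  ultimately show False
    using place_poly_at_pole[OF \<open>Q f < 0\<close>, of p] assms(1) unfolding polys_over_def by blast
qed

lemma regular_ring_adjoin:
  assumes "0 \<le> Q u" "f \<in> ring_adjoin K u"
  shows "0 \<le> Q f"
proof -
  have "K \<subseteq> {f. 0 \<le> Q f}"
    by (auto simp: place_const)
  then show ?thesis
    using assms ring_adjoin_least[OF subring_regular, of K u] by auto
qed

lemma place_poly_const_at_pole:
  assumes "subfield_of_type K" "Q u < 0" "p \<in> polys_over K" "p \<noteq> 0"
  shows "poly p u \<noteq> 0 \<and> Q (poly p u) = int (degree p) * Q u"
  using assms by (intro place_poly_at_pole) (auto simp: polys_over_def place_const)

lemma transcendental_at_pole:
  assumes "subfield_of_type K" "Q u < 0"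
  shows "transcendental_over K u"
  using place_poly_const_at_pole[OF assms] by (auto simp: transcendental_over_def polys_over_def)

end

text \<open>The multiple \<open>k\<close>, a difference of degrees, is the same for all places.\<close>

lemma place_fraction_at_pole:
  assumes K: "subfield_of_type K" and c: "c \<in> fractions (ring_adjoin K u)" "c \<noteq> 0"
  shows "\<exists>k. \<forall>Q. place K Q \<longrightarrow> Q u < 0 \<longrightarrow> Q c = k * Q u"
proof -
  note A = subring_ring_adjoin[OF subfield_imp_subring[OF K], of u]
  obtain a b where "a \<in> ring_adjoin K u" "b \<in> ring_adjoin K u" "b \<noteq> 0" "c = a / b"
    by (rule fractionsE[OF A c(1)])
  then obtain p r where p: "p \<in> polys_over K" "r \<in> polys_over K" "poly p u \<noteq> 0" "poly r u \<noteq> 0"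
      "c = poly p u / poly r u"
    using c(2) by (auto simp: ring_adjoin_def)
  then have "p \<noteq> 0" "r \<noteq> 0" by auto
  then have "Q c = (int (degree p) - int (degree r)) * Q u" if "place K Q" "Q u < 0" for Q
    using place_poly_const_at_pole[OF that(1) K that(2)] p place_divide[OF that(1) p(3,4)]
    by (simp add: left_diff_distrib)
  then show ?thesis by blast
qed

section \<open>The polynomial ring is integrally closed\<close>

text \<open>The denominators common to all powers of \<open>c\<close> form an ideal of \<open>K[u]\<close>, which is closed under
  multiplication by \<open>c\<close> too.  So \<open>c\<close> times a generator \<open>D\<close> is a multiple of \<open>D\<close>.\<close>

lemma polynomial_ring_integrally_closed:
  assumes K: "subfield_of_type K" and u: "transcendental_over K u"
    and c: "c \<in> fractions (ring_adjoin K u)" "integral_over (ring_adjoin K u) c"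
  shows "c \<in> ring_adjoin K u"
proof -
  note KR = subfield_imp_subring[OF K]
  define A where "A = ring_adjoin K u"
  have A: "subring_of_type A"
    unfolding A_def by (rule subring_ring_adjoin[OF KR])
  define J where "J E \<longleftrightarrow> E \<in> polys_over K \<and> (\<forall>i. poly E u * c ^ i \<in> A)" for E
  obtain a b where ab: "a \<in> A" "b \<in> A" "b \<noteq> 0" "c = a / b"
    by (rule fractionsE[OF A c(1)[folded A_def]])
  obtain B where B: "B \<in> polys_over K" "b = poly B u"
    using ab by (auto simp: A_def ring_adjoin_def)
  obtain M where M: "M \<in> polys_over A" "lead_coeff M = 1" "poly M c = 0"
    using c(2) by (auto simp: A_def integral_over_def)
  have degM: "degree M > 0"
  proof (rule ccontr)
    assume "\<not> degree M > 0"
    then obtain d where d: "M = [:d:]"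
      using degree_eq_zeroE by auto
    then show False using M by auto
  qed
  have Bpow: "B ^ k \<in> polys_over K" for k
    by (induction k) (auto intro: polys_over_closed[OF KR] B)
  have "J (B ^ degree M)"
    unfolding J_def
  proof (intro conjI allI Bpow)
    fix i
    have "c ^ i \<in> ring_adjoin A c"
      using ring_adjoin_base[OF A] subring_ring_adjoin[OF A] by (intro subringD) auto
    then obtain r where r: "r \<in> polys_over A" "degree r < degree M" "c ^ i = poly r c"
      using ring_adjoin_reduce[OF A M(1,2) degM M(3)] by blast
    have "poly (B ^ degree M) u * c ^ i = (\<Sum>j<degree M. coeff r j * (b ^ degree M * c ^ j))"
      unfolding r(3) poly_eq_sum_lessThan[OF r(2)] by (simp add: B sum_distrib_left algebra_simps)
    also have "\<dots> = (\<Sum>j<degree M. coeff r j * (b ^ (degree M - j) * a ^ j))"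
    proof (rule sum.cong[OF refl])
      fix j assume "j \<in> {..<degree M}"
      then have "b ^ degree M = b ^ (degree M - j) * b ^ j"
        by (simp flip: power_add)
      then have "b ^ degree M * c ^ j = b ^ (degree M - j) * a ^ j"
        using ab by (simp add: power_divide)
      then show "coeff r j * (b ^ degree M * c ^ j) = coeff r j * (b ^ (degree M - j) * a ^ j)"
        by simp
    qed
    also have "\<dots> \<in> A"
      using r(1) ab by (intro subring_sum[OF A] subringD(4)[OF A] subringD(7)[OF A]) (auto simp: polys_over_def)
    finally show "poly (B ^ degree M) u * c ^ i \<in> A" .
  qed
  moreover have "B ^ degree M \<noteq> 0"
    using B ab by auto
  ultimately have "\<exists>E. J E \<and> E \<noteq> 0" by blast
  then obtain D where D: "J D" "D \<noteq> 0" "\<And>E. J E \<and> E \<noteq> 0 \<Longrightarrow> degree D \<le> degree E"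
    using ex_has_least_nat[of "\<lambda>E. J E \<and> E \<noteq> 0" _ degree] by blast
  have "poly D u * c ^ 1 \<in> A"
    using D(1) unfolding J_def by blast
  then obtain E where E: "E \<in> polys_over K" "poly D u * c = poly E u"
    by (auto simp: A_def ring_adjoin_def)
  have JE: "J E"
    unfolding J_def
  proof (intro conjI allI E)
    fix i
    have "poly E u * c ^ i = poly D u * c ^ Suc i"
      by (simp flip: E(2))
    then show "poly E u * c ^ i \<in> A"
      using D(1) unfolding J_def by metis
  qed
  have DK: "D \<in> polys_over K"
    using D(1) by (simp add: J_def)
  obtain s r where sr: "s \<in> polys_over K" "r \<in> polys_over K" "E = s * D + r" "r = 0 \<or> degree r < degree D"
    using subfield_division[OF K DK D(2) E(1)] by blast
  have "J r"
    unfolding J_def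
  proof (intro conjI allI sr)
    fix i
    have "poly s u \<in> A"
      using sr by (auto simp: A_def intro: ring_adjoinI)
    then have "poly E u * c ^ i - poly s u * (poly D u * c ^ i) \<in> A"
      using D(1) JE unfolding J_def by (blast intro: subringD(6)[OF A] subringD(4)[OF A])
    then show "poly r u * c ^ i \<in> A"
      by (simp add: sr(3) algebra_simps)
  qed
  then have "r = 0"
    using D(3)[of r] sr(4) by (meson not_less)
  then have "poly D u * c = poly D u * poly s u"
    using E sr by simp
  moreover have "poly D u \<noteq> 0"
    using u DK D(2) by (auto simp: transcendental_over_def polys_over_def)
  ultimately have "c = poly s u" by simp
  then show ?thesis
    using sr by (auto intro: ring_adjoinI)
qed

section \<open>Recovering coefficients from values\<close>

text \<open>Newton interpolation: the differences of the nodes are units, so the coefficients are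
  combinations of the values with constant coefficients.\<close>

lemma coeffs_in_module:
  assumes K: "subfield_of_type K"
    and B: "0 \<in> B" "\<And>f g. f \<in> B \<Longrightarrow> g \<in> B \<Longrightarrow> f + g \<in> B" "\<And>c f. c \<in> K \<Longrightarrow> f \<in> B \<Longrightarrow> c * f \<in> B"
    and S: "finite S" "S \<subseteq> K" "degree r < card S" "\<And>c. c \<in> S \<Longrightarrow> poly r c \<in> B"
  shows "coeff r i \<in> B"
  using S
proof (induction S arbitrary: r i rule: finite_induct)
  case empty
  then show ?case by simp
next
  case (insert c S)
  note KR = subfield_imp_subring[OF K]
  have B_diff: "f - g \<in> B" if "f \<in> B" "g \<in> B" for f g
  proof -
    have "f + (- 1) * g \<in> B"
      using that subringD(5)[OF KR subringD(2)[OF KR]] by (intro B)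
    then show ?thesis by simp
  qed
  define r' where "r' = synthetic_div r c"
  have r: "r = [:- c, 1:] * r' + [:poly r c:]"
    unfolding r'_def by (rule synthetic_div_correct'[symmetric])
  have c: "c \<in> K" "poly r c \<in> B"
    using insert.prems by auto
  have "coeff r' i \<in> B" for i
  proof (cases "degree r = 0")
    case True
    then have "r' = 0"
      by (simp add: r'_def synthetic_div_eq_0_iff)
    then show ?thesis using B by simp
  next
    case False
    show ?thesis
    proof (rule insert.IH)
      show "S \<subseteq> K"
        using insert.prems by simp
      show "degree r' < card S"
        using insert.prems insert.hyps False by (simp add: r'_def degree_synthetic_div)
      fix d assume d: "d \<in> S"
      then have "d \<noteq> c" "d \<in> K" "poly r d \<in> B"
        using insert by auto
      have "poly r d = (d - c) * poly r' d + poly r c"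
        by (subst r) (simp add: algebra_simps)
      then have "poly r' d = inverse (d - c) * (poly r d - poly r c)"
        using \<open>d \<noteq> c\<close> by simp
      also have "\<dots> \<in> B"
        using \<open>d \<in> K\<close> c \<open>poly r d \<in> B\<close> by (intro B B_diff subfieldD[OF K] subringD[OF KR])
      finally show "poly r' d \<in> B" .
    qed
  qed
  moreover have "coeff r i = (case i of 0 \<Rightarrow> poly r c | Suc j \<Rightarrow> coeff r' j) - c * coeff r' i"
    by (subst r) (auto simp: coeff_pCons split: nat.splits)
  ultimately show ?case
    using c B by (auto split: nat.splits intro!: B_diff)
qed

section \<open>Coordinates adapted to a rational point\<close>

lemma eq_if_dvd_diff:
  fixes i j k :: nat
  assumes "i < k" "j < k" "int k dvd int i - int j"
  shows "i = j"
  using assms zdvd_not_zless[of "\<bar>int i - int j\<bar>" "int k"] by force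

text \<open>The values of the terms are known only up to an unknown factor \<open>e\<close>, which may depend on the place.
  As the same multiple \<open>k\<close> of it arises at all places, the lemma serves to compare places.\<close>

lemma place_sum_scaled:
  assumes I: "finite I" "\<exists>i\<in>I. T i \<noteq> 0" and t: "inj_on t {i\<in>I. T i \<noteq> 0}"
  shows "\<exists>k\<in>t ` {i\<in>I. T i \<noteq> 0}. \<forall>Q e. place K Q \<longrightarrow> e > 0 \<longrightarrow> (\<forall>i\<in>I. T i \<noteq> 0 \<longrightarrow> Q (T i) = t i * e) \<longrightarrow>
    sum T I \<noteq> 0 \<and> Q (sum T I) = k * (e :: int)"
proof -
  define J where "J = {i\<in>I. T i \<noteq> 0}"
  have J: "finite J" "J \<noteq> {}"
    using I by (auto simp: J_def)
  have "sum T I \<noteq> 0 \<and> Q (sum T I) = Min (t ` J) * e"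
    if Q: "place K Q" and e: "e > 0" and v: "\<forall>i\<in>I. T i \<noteq> 0 \<longrightarrow> Q (T i) = t i * e" for Q e
  proof -
    have "inj_on (\<lambda>i. Q (T i)) {i\<in>I. T i \<noteq> 0}"
    proof (rule inj_onI)
      fix i j assume ij: "i \<in> {i\<in>I. T i \<noteq> 0}" "j \<in> {i\<in>I. T i \<noteq> 0}" "Q (T i) = Q (T j)"
      then have "Q (T i) = t i * e" "Q (T j) = t j * e"
        using v by blast+
      then have "t i = t j"
        using ij(3) e by simp
      then show "i = j"
        using inj_onD[OF t] ij(1,2) by blast
    qed
    from place_sum_distinct[OF Q I(1) this I(2)] obtain i where i: "sum T I \<noteq> 0" "i \<in> J" "Q (sum T I) = Q (T i)"
      "\<forall>j\<in>J. Q (T i) \<le> Q (T j)"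
      unfolding J_def by (elim conjE bexE) simp
    have "t i = Min (t ` J)"
    proof (rule Min_eqI[symmetric])
      show "finite (t ` J)" "t i \<in> t ` J"
        using J i by auto
      fix y assume "y \<in> t ` J"
      then obtain j where j: "j \<in> J" "y = t j" by blast
      then have "Q (T i) \<le> Q (T j)" "Q (T i) = t i * e" "Q (T j) = t j * e"
        using i(2,4) v unfolding J_def by blast+
      then have "t i * e \<le> t j * e"
        by simp
      then show "t i \<le> y"
        using j e by simp
    qed
    moreover have "Q (T i) = t i * e"
      using i(2) v unfolding J_def by blast
    ultimately show ?thesis
      using i(1,3) by simp
  qed
  moreover have "Min (t ` J) \<in> t ` J"
    using J by (intro Min_in) auto
  ultimately show ?thesis
    unfolding J_def by (intro bexI[of _ "Min (t ` {i\<in>I. T i \<noteq> 0})"]) simp_all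
qed

text \<open>An integral equation for \<open>p(t)\<close> is an algebraic equation for \<open>t\<close>, which \<open>t'\<close> inherits.  This does
  the work of an automorphism that maps \<open>t\<close> to \<open>t'\<close>.\<close>

lemma integral_conjugate:
  assumes A': "subring_of_type A'" "A \<subseteq> A'"
    and M: "M \<in> polys_over A'" "lead_coeff M = 1" "poly M t = 0" "poly M t' = 0"
    and indep: "\<And>r. r \<in> polys_over A' \<Longrightarrow> degree r < degree M \<Longrightarrow> poly r t = 0 \<Longrightarrow> r = 0"
    and p: "p \<in> polys_over A'" "integral_over A (poly p t)"
  shows "integral_over A (poly p t')"
proof -
  obtain G where G: "G \<in> polys_over A" "lead_coeff G = 1" "poly G (poly p t) = 0"
    using p(2) by (auto simp: integral_over_def)
  have "pcompose G p \<in> polys_over A'"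
    using G(1) polys_over_mono[OF A'(2)] p(1) by (intro polys_over_pcompose[OF A'(1)]) auto
  moreover have "poly (pcompose G p) t = 0"
    using G(3) by (simp add: poly_pcompose)
  ultimately have "poly (pcompose G p) t' = 0"
    using conjugate_root[OF A'(1) M, of "pcompose G p"] indep by blast
  then have "poly G (poly p t') = 0"
    by (simp add: poly_pcompose)
  then show ?thesis
    using G(1,2) unfolding integral_over_def by blast
qed

text \<open>For \<open>w\<close> algebraic over \<open>K(u)\<close> this ring is the field \<open>K(u, w)\<close>.\<close>

definition adjoin2 :: "'a::field set \<Rightarrow> 'a \<Rightarrow> 'a \<Rightarrow> 'a set" where
  "adjoin2 K u w = ring_adjoin (fractions (ring_adjoin K u)) w"

text \<open>The equation of the Hermitian curve in coordinates whose only pole is a given rational point.  It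
  forces the pole orders of \<open>u\<close> and \<open>w\<close> to have the ratio \<open>q : q + 1\<close>.\<close>

locale hermitian_coordinates =
  fixes K :: "'a::field set" and q :: nat and u w eps :: 'a
  assumes K: "subfield_of_type K" and q: "q \<ge> 2"
    and eps: "eps \<in> K"
    and eq: "w ^ q + w = u ^ (q + 1) + eps"
begin

abbreviation "L \<equiv> fractions (ring_adjoin K u)"
abbreviation "E \<equiv> adjoin2 K u w"

lemma KR: "subring_of_type K"
  by (rule subfield_imp_subring[OF K])

lemma AR: "subring_of_type (ring_adjoin K u)"
  by (rule subring_ring_adjoin[OF KR])

lemma L: "subfield_of_type L"
  by (rule subfield_fractions[OF AR])

lemma LR: "subring_of_type L"
  by (rule subfield_imp_subring[OF L])

lemma in_A: "c \<in> K \<Longrightarrow> c \<in> ring_adjoin K u" "u \<in> ring_adjoin K u"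
  using ring_adjoin_base[OF KR] by auto

lemma A_sub_L: "ring_adjoin K u \<subseteq> L"
  by (rule subring_subset_fractions[OF AR])

text \<open>The minimal polynomial of \<open>w\<close> over \<open>K(u)\<close>, as soon as some place is a pole of \<open>u\<close>.\<close>

definition Mw where "Mw = monom 1 q + monom 1 1 - [:u ^ (q + 1) + eps:]"

lemma Mw_A: "Mw \<in> polys_over (ring_adjoin K u)"
  unfolding Mw_def using eps subringD[OF AR] in_A by (intro polys_over_closed[OF AR]) auto

lemma Mw: "Mw \<in> polys_over L" "lead_coeff Mw = 1" "degree Mw = q" "poly Mw w = 0"
proof -
  show "Mw \<in> polys_over L"
    using Mw_A polys_over_mono[OF A_sub_L] by blast
  have co: "coeff Mw i = (if i = q then 1 else 0)" if "i \<ge> q" for i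
    using that q by (auto simp: Mw_def coeff_pCons split: nat.splits)
  have "degree Mw \<le> q"
    by (rule degree_le) (simp add: co)
  moreover have "q \<le> degree Mw"
    by (rule le_degree) (simp add: co)
  ultimately show "degree Mw = q" by simp
  then show "lead_coeff Mw = 1"
    by (simp add: co)
  show "poly Mw w = 0"
    using eq by (simp add: Mw_def poly_monom)
qed

lemma E_subfield: "subfield_of_type E"
  unfolding adjoin2_def using Mw q by (intro subfield_ring_adjoin[OF L, of Mw]) auto

lemma ER: "subring_of_type E"
  by (rule subfield_imp_subring[OF E_subfield])

lemma L_sub_E: "L \<subseteq> E" and w_E: "w \<in> E"
  using ring_adjoin_base[OF LR] by (auto simp: adjoin2_def)

lemma E_rep:
  assumes "f \<in> E"
  obtains p where "p \<in> polys_over L" "degree p < q" "f = poly p w"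
  using ring_adjoin_reduce[OF LR Mw(1,2) _ Mw(4), of f] assms q Mw(3)
  by (auto simp: adjoin2_def)

text \<open>The value at \<open>Q\<close> of the local parameter \<open>u / w\<close> of the Hermitian curve, if \<open>Q\<close> is a pole of \<open>u\<close>; that is,
  the ramification index, which turns out to be \<open>m\<close>.\<close>

definition scale :: "('a \<Rightarrow> int) \<Rightarrow> int" where "scale Q = Q u - Q w"

lemma value_at_pole_w:
  assumes Q: "place K Q" "Q w < 0"
  shows "w ^ q + w \<noteq> 0 \<and> Q (w ^ q + w) = int q * Q w"
proof -
  have "w \<noteq> 0"
    using Q place_0[OF Q(1)] by auto
  moreover have "int q * Q w \<le> 2 * Q w"
    using q Q by (intro mult_right_mono_neg) auto
  then have "at_least Q (Q (w ^ q) + 1) w"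
    using Q unfolding at_least_def place_power[OF Q(1), of w q] by linarith
  ultimately show ?thesis
    using dominant_summand[OF Q(1), of "w ^ q" w] place_power[OF Q(1), of w q] by simp
qed

lemma pole_values:
  assumes Q: "place K Q" "Q u < 0"
  shows "scale Q > 0" "Q u = - int q * scale Q" "Q w = - int (q + 1) * scale Q"
proof -
  have u0: "u \<noteq> 0"
    using Q place_0[OF Q(1)] by auto
  have "int (q + 1) * Q u < 0"
    using Q by (simp add: mult_pos_neg)
  then have "at_least Q (Q (u ^ (q + 1)) + 1) eps"
    using place_const[OF Q(1) eps] place_power[OF Q(1), of u "q + 1"] by (simp add: at_least_def)
  then have rhs: "w ^ q + w \<noteq> 0" "Q (w ^ q + w) = int (q + 1) * Q u"
    using dominant_summand[OF Q(1), of "u ^ (q + 1)" eps] u0 place_power[OF Q(1), of u "q + 1"]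
    unfolding eq by auto
  have Qw: "Q w < 0"
  proof (rule ccontr)
    assume "\<not> Q w < 0"
    then have "w ^ q + w \<in> {f. 0 \<le> Q f}"
      by (intro subringD(3,7)[OF subring_regular[OF Q(1)]]) auto
    then show False
      using rhs \<open>int (q + 1) * Q u < 0\<close> by simp
  qed
  have *: "int q * Q w = int (q + 1) * Q u"
    using rhs value_at_pole_w[OF Q(1) Qw] by simp
  then show 1: "Q u = - int q * scale Q"
    by (simp add: scale_def algebra_simps)
  then show "Q w = - int (q + 1) * scale Q"
    by (simp add: scale_def algebra_simps)
  show "scale Q > 0"
    using 1 Q(2) q by (simp add: zero_less_mult_iff)
qed

lemma pole_u_if_pole_w:
  assumes Q: "place K Q" "Q w < 0"
  shows "Q u < 0"
proof (rule ccontr)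
  assume "\<not> Q u < 0"
  then have "u ^ (q + 1) + eps \<in> {f. 0 \<le> Q f}"
    using place_const[OF Q(1) eps]
    by (intro subringD(3,7)[OF subring_regular[OF Q(1)]]) auto
  then have "0 \<le> Q (w ^ q + w)"
    unfolding eq by simp
  then show False
    using value_at_pole_w[OF Q] q Q(2) by (simp add: zero_le_mult_iff)
qed

end

text \<open>The integer \<open>r\<close> is the value of \<open>z\<close> at the point.  By the assumptions on roots, \<open>K\<close> contains the
  constants by which the conjugates of \<open>w\<close> and \<open>z\<close> differ.\<close>

locale adapted_coordinates = hermitian_coordinates +
  fixes m :: nat and z :: 'a and r :: int and P :: "'a \<Rightarrow> int"
  assumes m: "m > 0"
    and frobenius: "\<And>f g :: 'a. (f + g) ^ q = f ^ q + g ^ q"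
    and kernel: "card {c\<in>K. c ^ q + c = 0} = q"
    and roots: "card {c\<in>K. c ^ m = 1} = m"
    and coprime: "coprime r (int m)"
    and zm: "z ^ m \<in> adjoin2 K u w"
    and generated: "ring_adjoin (adjoin2 K u w) z = UNIV"
    and z_value: "\<And>Q. place K Q \<Longrightarrow> Q u < 0 \<Longrightarrow> int m * Q z = r * (Q u - Q w)"
    and z_nonzero: "z \<noteq> 0"
    and P: "place K P" "P u < 0"
begin

text \<open>The minimal polynomial of \<open>z\<close> over \<open>K(u, w)\<close>.\<close>

definition Mz where "Mz = monom 1 m - [:z ^ m:]"

lemma Mz: "Mz \<in> polys_over E" "lead_coeff Mz = 1" "degree Mz = m" "poly Mz z = 0"
proof -
  show "Mz \<in> polys_over E"
    unfolding Mz_def using zm subringD[OF ER] by (intro polys_over_closed[OF ER]) auto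
  show "degree Mz = m" "lead_coeff Mz = 1"
    unfolding Mz_def using monom_minus_const[OF m] by blast+
  show "poly Mz z = 0"
    by (simp add: Mz_def poly_monom)
qed

lemma z_rep:
  obtains p where "p \<in> polys_over E" "degree p < m" "f = poly p z"
  using ring_adjoin_reduce[OF ER Mz(1,2) _ Mz(4), of f] generated m Mz(3) by auto

lemma trans_u: "transcendental_over K u"
  using transcendental_at_pole[OF P(1) K P(2)] .

text \<open>The values of the monomials \<open>c w\<^sup>i\<close> with \<open>i < q\<close> are distinct modulo \<open>q\<close> times the scale.\<close>

lemma E_value:
  assumes p: "p \<in> polys_over L" "degree p < q" "p \<noteq> 0"
  shows "poly p w \<noteq> 0 \<and> (\<exists>k. \<forall>Q. place K Q \<longrightarrow> Q u < 0 \<longrightarrow> Q (poly p w) = k * scale Q)"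
proof -
  define T where "T i = coeff p i * w ^ i" for i
  have w0: "w \<noteq> 0"
    using pole_values[OF P] place_0[OF P(1)] by auto
  have sum: "poly p w = sum T {..<q}"
    unfolding T_def by (rule poly_eq_sum_lessThan[OF p(2)])
  have "\<exists>k. \<forall>Q. place K Q \<longrightarrow> Q u < 0 \<longrightarrow> Q (coeff p i) = k * Q u" if "coeff p i \<noteq> 0" for i
    using place_fraction_at_pole[OF K _ that] p(1) by (auto simp: polys_over_def)
  then obtain k where k: "\<And>i Q. coeff p i \<noteq> 0 \<Longrightarrow> place K Q \<Longrightarrow> Q u < 0 \<Longrightarrow> Q (coeff p i) = k i * Q u"
    by metis
  define t where "t i = - (k i * int q + int i * int (q + 1))" for i
  have "inj_on t {i\<in>{..<q}. T i \<noteq> 0}"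
  proof (rule inj_onI)
    fix i j assume ij: "i \<in> {i\<in>{..<q}. T i \<noteq> 0}" "j \<in> {i\<in>{..<q}. T i \<noteq> 0}" "t i = t j"
    then have "int i - int j = int q * (k j - k i + int j - int i)"
      by (simp add: t_def algebra_simps)
    then have "int q dvd int i - int j"
      by simp
    then show "i = j"
      using ij by (intro eq_if_dvd_diff[of i q j]) auto
  qed
  moreover have "T (degree p) \<noteq> 0"
    using p(3) w0 by (simp add: T_def)
  then have "\<exists>i\<in>{..<q}. T i \<noteq> 0"
    using p(2) by blast
  ultimately obtain k' where k': "\<And>Q e. place K Q \<Longrightarrow> e > 0 \<Longrightarrow> (\<forall>i\<in>{..<q}. T i \<noteq> 0 \<longrightarrow> Q (T i) = t i * e) \<Longrightarrow>
    sum T {..<q} \<noteq> 0 \<and> Q (sum T {..<q}) = k' * e"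
    using place_sum_scaled[of "{..<q}" T t K] by blast
  have "sum T {..<q} \<noteq> 0 \<and> Q (sum T {..<q}) = k' * scale Q" if Q: "place K Q" "Q u < 0" for Q
  proof (rule k')
    show "place K Q" "scale Q > 0"
      using Q pole_values by auto
    show "\<forall>i\<in>{..<q}. T i \<noteq> 0 \<longrightarrow> Q (T i) = t i * scale Q"
    proof (intro ballI impI)
      fix i assume "T i \<noteq> 0"
      then have ci: "coeff p i \<noteq> 0"
        by (auto simp: T_def)
      have "Q (T i) = k i * Q u + int i * Q w"
        using ci w0 k[OF ci Q] by (simp add: T_def place_mult[OF Q(1)] place_power[OF Q(1)])
      then show "Q (T i) = t i * scale Q"
        unfolding pole_values(2)[OF Q] pole_values(3)[OF Q] by (simp add: t_def algebra_simps)
    qed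
  qed
  then show ?thesis
    unfolding sum using P by blast
qed

lemma E_value':
  assumes "f \<in> E" "f \<noteq> 0"
  shows "\<exists>k. \<forall>Q. place K Q \<longrightarrow> Q u < 0 \<longrightarrow> Q f = k * scale Q"
proof -
  obtain p where p: "p \<in> polys_over L" "degree p < q" "f = poly p w"
    by (rule E_rep[OF assms(1)])
  then have "p \<noteq> 0"
    using assms(2) by auto
  then show ?thesis
    using E_value[OF p(1,2)] p(3) by blast
qed

lemma m_dvd_scale:
  assumes "place K Q" "Q u < 0"
  shows "int m dvd scale Q"
proof -
  have "int m dvd r * scale Q"
    using z_value[OF assms] unfolding scale_def by (metis dvd_triv_left)
  then show ?thesis
    using coprime by (simp add: coprime_dvd_mult_right_iff coprime_commute)
qed

lemma value_z_scaled:
  assumes Q: "place K Q" "Q u < 0"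
  shows "Q z = r * (scale Q div int m)" "scale Q div int m > 0" "scale Q = int m * (scale Q div int m)"
proof -
  show 1: "scale Q = int m * (scale Q div int m)"
    using m_dvd_scale[OF Q] by simp
  have "int m * Q z = int m * (r * (scale Q div int m))"
    using z_value[OF Q] 1 unfolding scale_def by (metis mult.left_commute)
  then show "Q z = r * (scale Q div int m)"
    using m by simp
  show "scale Q div int m > 0"
    using 1 pole_values(1)[OF Q] m by (metis mult_pos_pos of_nat_0_less_iff zero_less_mult_pos)
qed

text \<open>As \<open>r\<close> is prime to \<open>m\<close>, the values of \<open>f\<^sub>j z\<^sup>j\<close> with \<open>j < m\<close> are distinct modulo \<open>m\<close> times
  their unit.\<close>

lemma z_sum_value:
  assumes p: "p \<in> polys_over E" "degree p < m" "p \<noteq> 0"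
  shows "poly p z \<noteq> 0 \<and> (\<exists>k j. j < m \<and> coeff p j \<noteq> 0 \<and> (\<forall>Q. place K Q \<longrightarrow> Q u < 0 \<longrightarrow>
    Q (poly p z) = k * (scale Q div int m) \<and> Q (poly p z) = Q (coeff p j * z ^ j)))"
proof -
  define T where "T i = coeff p i * z ^ i" for i
  have sum: "poly p z = sum T {..<m}"
    unfolding T_def by (rule poly_eq_sum_lessThan[OF p(2)])
  have "\<exists>k. \<forall>Q. place K Q \<longrightarrow> Q u < 0 \<longrightarrow> Q (coeff p i) = k * scale Q" if "coeff p i \<noteq> 0" for i
    using E_value'[OF _ that] p(1) by (auto simp: polys_over_def)
  then obtain k where k: "\<And>i Q. coeff p i \<noteq> 0 \<Longrightarrow> place K Q \<Longrightarrow> Q u < 0 \<Longrightarrow> Q (coeff p i) = k i * scale Q"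
    by metis
  define t where "t i = k i * int m + int i * r" for i
  have "inj_on t {i\<in>{..<m}. T i \<noteq> 0}"
  proof (rule inj_onI)
    fix i j assume ij: "i \<in> {i\<in>{..<m}. T i \<noteq> 0}" "j \<in> {i\<in>{..<m}. T i \<noteq> 0}" "t i = t j"
    then have "r * (int i - int j) = int m * (k j - k i)"
      by (simp add: t_def algebra_simps)
    then have "int m dvd r * (int i - int j)"
      by (metis dvd_triv_left)
    then have "int m dvd int i - int j"
      using coprime by (simp add: coprime_dvd_mult_right_iff coprime_commute)
    then show "i = j"
      using ij by (intro eq_if_dvd_diff[of i m j]) auto
  qed
  moreover have "T (degree p) \<noteq> 0"
    using p(3) z_nonzero by (simp add: T_def)
  then have "\<exists>i\<in>{..<m}. T i \<noteq> 0"
    using p(2) by blast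
  ultimately obtain k' where k'T: "k' \<in> t ` {i\<in>{..<m}. T i \<noteq> 0}" and
    k': "\<And>Q e. place K Q \<Longrightarrow> e > 0 \<Longrightarrow> (\<forall>i\<in>{..<m}. T i \<noteq> 0 \<longrightarrow> Q (T i) = t i * e) \<Longrightarrow>
    sum T {..<m} \<noteq> 0 \<and> Q (sum T {..<m}) = k' * e"
    using place_sum_scaled[of "{..<m}" T t K] by blast
  have T_val: "Q (T i) = t i * (scale Q div int m)" if Q: "place K Q" "Q u < 0" and i: "T i \<noteq> 0" for Q i
  proof -
    have ci: "coeff p i \<noteq> 0"
      using i by (auto simp: T_def)
    have "Q (T i) = k i * scale Q + int i * Q z"
      using ci z_nonzero k[OF ci Q] by (simp add: T_def place_mult[OF Q(1)] place_power[OF Q(1)])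
    also have "\<dots> = k i * (int m * (scale Q div int m)) + int i * (r * (scale Q div int m))"
      using value_z_scaled(1,3)[OF Q] by simp
    finally show ?thesis
      by (simp add: t_def algebra_simps)
  qed
  obtain j where j: "j < m" "T j \<noteq> 0" "k' = t j"
    using k'T by auto
  have main: "sum T {..<m} \<noteq> 0 \<and> Q (sum T {..<m}) = k' * (scale Q div int m)" if Q: "place K Q" "Q u < 0" for Q
    using T_val[OF Q] value_z_scaled(2)[OF Q] by (intro k' Q) auto
  have "coeff p j \<noteq> 0"
    using j by (auto simp: T_def)
  moreover have "Q (sum T {..<m}) = Q (coeff p j * z ^ j)" if Q: "place K Q" "Q u < 0" for Q
    using main[OF Q] T_val[OF Q j(2)] j(3) by (simp add: T_def)
  ultimately show ?thesis
    unfolding sum using P main j(1) by blast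
qed

lemma value_multiple:
  assumes "f \<noteq> 0"
  shows "\<exists>k. \<forall>Q. place K Q \<longrightarrow> Q u < 0 \<longrightarrow> Q f = k * (scale Q div int m)"
proof -
  obtain p where p: "p \<in> polys_over E" "degree p < m" "f = poly p z"
    by (rule z_rep)
  then have "p \<noteq> 0"
    using assms by auto
  then show ?thesis
    using z_sum_value[OF p(1,2)] p(3) by blast
qed

text \<open>A place is onto the integers, which fixes its scale.\<close>

lemma scale_eq:
  assumes Q: "place K Q" "Q u < 0"
  shows "scale Q = int m"
proof -
  have "surj Q"
    using Q(1) by (simp add: place_def)
  then obtain f where f: "1 = Q f"
    by (rule surjE)
  then have "f \<noteq> 0"
    using place_0[OF Q(1)] by auto
  then obtain k where "Q f = k * (scale Q div int m)"
    using value_multiple[of f] Q by blast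
  then have "k * (scale Q div int m) = 1"
    using f by simp
  then have "scale Q div int m = 1"
    using value_z_scaled(2)[OF Q] by (simp add: zmult_eq_1_iff)
  then show ?thesis
    using value_z_scaled(3)[OF Q] by simp
qed

lemma normalized_values:
  assumes Q: "place K Q" "Q u < 0"
  shows "Q u = - int (q * m)" "Q w = - int ((q + 1) * m)" "Q z = r" "f \<in> E \<Longrightarrow> int m dvd Q f"
proof -
  show "Q u = - int (q * m)" "Q w = - int ((q + 1) * m)"
    using pole_values(2,3)[OF Q] unfolding scale_eq[OF Q] by (simp_all add: algebra_simps)
  show "Q z = r"
    using value_z_scaled(1)[OF Q] scale_eq[OF Q] m by simp
  assume "f \<in> E"
  then show "int m dvd Q f"
    using E_value'[of f] place_0[OF Q(1)] scale_eq[OF Q] Q by (cases "f = 0") auto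
qed

text \<open>The values of \<open>u\<close>, \<open>w\<close> and \<open>z\<close> determine all values at a pole of \<open>u\<close>.\<close>

lemma unique_pole:
  assumes Q: "place K Q" "Q u < 0"
  shows "Q = P"
proof
  fix f
  show "Q f = P f"
  proof (cases "f = 0")
    case True
    then show ?thesis
      using place_0[OF Q(1)] place_0[OF P(1)] by simp
  next
    case False
    then obtain k where k: "\<And>Q. place K Q \<Longrightarrow> Q u < 0 \<Longrightarrow> Q f = k * (scale Q div int m)"
      using value_multiple by blast
    show ?thesis
      unfolding k[OF Q] k[OF P] scale_eq[OF Q] scale_eq[OF P] ..
  qed
qed

definition regular :: "'a set" where
  "regular = {f. \<forall>Q. place K Q \<longrightarrow> 0 \<le> Q u \<longrightarrow> 0 \<le> Q f}"

lemma regular_iff: "f \<in> regular \<longleftrightarrow> (\<forall>Q. place K Q \<longrightarrow> Q \<noteq> P \<longrightarrow> 0 \<le> Q f)"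
proof -
  have "Q \<noteq> P \<longleftrightarrow> 0 \<le> Q u" if "place K Q" for Q
    using unique_pole[OF that] P by (auto simp: not_less[symmetric])
  then show ?thesis
    by (auto simp: regular_def)
qed

lemma regular_subring: "subring_of_type regular"
proof -
  have "regular = (\<Inter>Q\<in>{Q. place K Q \<and> 0 \<le> Q u}. {f. 0 \<le> Q f})"
    by (auto simp: regular_def)
  moreover have "subring_of_type {f. 0 \<le> Q f}" if "place K Q" for Q
    by (rule subring_regular[OF that])
  ultimately show ?thesis
    by (auto simp: subring_of_type_def)
qed

lemma A_regular: "ring_adjoin K u \<subseteq> regular"
  using regular_ring_adjoin by (auto simp: regular_def)

lemma spanned: "lin_combs L (\<lambda>(j, i). w ^ i * z ^ j) ({..<m} \<times> {..<q}) = UNIV"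
proof -
  have "f \<in> lin_combs L (\<lambda>(j, i). w ^ i * z ^ j) ({..<m} \<times> {..<q})" for f
  proof -
    obtain p where p: "p \<in> polys_over E" "degree p < m" "f = poly p z"
      by (rule z_rep)
    have "\<exists>s. s \<in> polys_over L \<and> degree s < q \<and> coeff p j = poly s w" for j
    proof -
      have "coeff p j \<in> E"
        using p(1) by (simp add: polys_over_def)
      from E_rep[OF this] show ?thesis by metis
    qed
    then obtain s where s: "\<And>j. s j \<in> polys_over L" "\<And>j. degree (s j) < q" "\<And>j. coeff p j = poly (s j) w"
      by metis
    have "f = (\<Sum>j<m. \<Sum>i<q. coeff (s j) i * (w ^ i * z ^ j))"
      unfolding p(3) poly_eq_sum_lessThan[OF p(2)] s(3) poly_eq_sum_lessThan[OF s(2)]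
      by (simp add: sum_distrib_right mult.assoc)
    also have "\<dots> = (\<Sum>x\<in>{..<m} \<times> {..<q}. (case x of (j, i) \<Rightarrow> coeff (s j) i) * (case x of (j, i) \<Rightarrow> w ^ i * z ^ j))"
      by (simp add: sum.cartesian_product case_prod_unfold)
    finally show ?thesis
      unfolding lin_combs_def using s(1)
      by (intro CollectI exI[of _ "\<lambda>(j, i). coeff (s j) i"]) (auto simp: polys_over_def)
  qed
  then show ?thesis by blast
qed

text \<open>Regularity is closed under the ring operations, whereas integrality passes to conjugates; the
  descents below rely on both.\<close>

lemma integral_iff_regular: "integral_over (ring_adjoin K u) f \<longleftrightarrow> f \<in> regular"
proof
  assume "integral_over (ring_adjoin K u) f"
  then show "f \<in> regular"
    using regular_if_integral[of K] regular_ring_adjoin[of K] unfolding regular_def by blast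
next
  assume "f \<in> regular"
  then show "integral_over (ring_adjoin K u) f"
    using exists_place_with_pole[OF K trans_u _ spanned, of f] by (force simp: regular_def)
qed

lemma w_regular: "w \<in> regular"
  using Mw_A Mw(2,4) by (auto simp: integral_over_def simp flip: integral_iff_regular)

lemma coeffs_regular:
  assumes "card S > 0" "S \<subseteq> K" "degree p < card S" "\<And>c. c \<in> S \<Longrightarrow> poly p c \<in> regular"
  shows "coeff p i \<in> regular"
proof (rule coeffs_in_module[OF K _ _ _ card_ge_0_finite[OF assms(1)] assms(2-4)])
  show "0 \<in> regular"
    by (rule subringD(1)[OF regular_subring])
  show "f + g \<in> regular" if "f \<in> regular" "g \<in> regular" for f g
    using that by (rule subringD(3)[OF regular_subring])
  show "c * f \<in> regular" if "c \<in> K" "f \<in> regular" for c f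
    using that A_regular in_A by (intro subringD(4)[OF regular_subring]) auto
qed

text \<open>The conjugates \<open>p(c z)\<close> with \<open>c\<^sup>m = 1\<close> are the values at the constants \<open>c\<close> of the polynomial \<open>p(z X)\<close>,
  which has the components as its coefficients.\<close>

lemma z_component_regular:
  assumes p: "p \<in> polys_over E" "degree p < m" and f: "poly p z \<in> regular"
  shows "coeff p j * z ^ j \<in> regular"
proof -
  define p' where "p' = pcompose p [:0, z:]"
  have co: "coeff p' j = coeff p j * z ^ j"
    by (simp add: p'_def coeff_pcompose_linear mult.commute)
  have "coeff p' j \<in> regular"
  proof (rule coeffs_regular)
    show "card {c\<in>K. c ^ m = 1} > 0"
      using roots m by simp
    show "degree p' < card {c\<in>K. c ^ m = 1}"
      using p(2) roots degree_pcompose_le[of p "[:0, z:]"] z_nonzero by (simp add: p'_def)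
    fix c assume c: "c \<in> {c\<in>K. c ^ m = 1}"
    have "integral_over (ring_adjoin K u) (poly p (c * z))"
    proof (rule integral_conjugate[OF ER _ Mz(1,2,4) _ _ p(1)])
      show "ring_adjoin K u \<subseteq> E"
        using A_sub_L L_sub_E by blast
      show "poly Mz (c * z) = 0"
        using c by (simp add: Mz_def poly_monom power_mult_distrib)
      show "s = 0" if "s \<in> polys_over E" "degree s < degree Mz" "poly s z = 0" for s
        using z_sum_value[OF that(1)] that(2,3) Mz(3) by auto
      show "integral_over (ring_adjoin K u) (poly p z)"
        using f integral_iff_regular by blast
    qed
    then show "poly p' c \<in> regular"
      by (simp add: p'_def poly_pcompose integral_iff_regular)
  qed simp
  then show ?thesis
    by (simp add: co)
qed

text \<open>The conjugates \<open>p(w + c)\<close> with \<open>c\<^sup>q + c = 0\<close> are the values at the constants \<open>c\<close> of \<open>p(w + X)\<close>.  So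
  the coefficients of this polynomial, and then those of \<open>p\<close>, are regular; being in \<open>K(u)\<close>, they are
  polynomials.\<close>

lemma E_regular_coeffs:
  assumes p: "p \<in> polys_over L" "degree p < q" and f: "poly p w \<in> regular"
  shows "coeff p i \<in> ring_adjoin K u"
proof -
  define p' where "p' = pcompose p [:w, 1:]"
  have "coeff p' j \<in> regular" for j
  proof (rule coeffs_regular)
    show "card {c\<in>K. c ^ q + c = 0} > 0"
      using kernel q by simp
    show "degree p' < card {c\<in>K. c ^ q + c = 0}"
      using p(2) kernel by (simp add: p'_def degree_pcompose)
    fix c assume c: "c \<in> {c\<in>K. c ^ q + c = 0}"
    have "integral_over (ring_adjoin K u) (poly p (w + c))"
    proof (rule integral_conjugate[OF LR A_sub_L Mw(1,2,4) _ _ p(1)])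
      have "poly Mw (w + c) = poly Mw w + (c ^ q + c)"
        by (simp add: Mw_def poly_monom frobenius)
      then show "poly Mw (w + c) = 0"
        using c Mw(4) by simp
      show "s = 0" if "s \<in> polys_over L" "degree s < degree Mw" "poly s w = 0" for s
        using E_value[OF that(1)] that(2,3) Mw(3) by auto
      show "integral_over (ring_adjoin K u) (poly p w)"
        using f integral_iff_regular by blast
    qed
    then show "poly p' c \<in> regular"
      by (simp add: p'_def poly_pcompose integral_iff_regular)
  qed simp
  then have "p' \<in> polys_over regular"
    by (simp add: polys_over_def)
  then have "pcompose p' [:- w, 1:] \<in> polys_over regular"
    using w_regular subringD[OF regular_subring]
    by (intro polys_over_pcompose[OF regular_subring] polys_over_closed[OF regular_subring]) auto
  also have "pcompose p' [:- w, 1:] = p"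
    by (simp add: p'_def pcompose_assoc[symmetric] pcompose_pCons)
  finally have "coeff p i \<in> regular"
    by (simp add: polys_over_def)
  then show ?thesis
    using polynomial_ring_integrally_closed[OF K trans_u, of "coeff p i"] p(1)
    by (auto simp: integral_iff_regular polys_over_def)
qed

lemma E_regular_value:
  assumes g: "g \<in> E" "g \<in> regular" "g \<noteq> 0"
  shows "\<exists>a i. P g = - int (m * (q * a + (q + 1) * i))"
proof -
  obtain p where p: "p \<in> polys_over L" "degree p < q" "g = poly p w"
    by (rule E_rep[OF g(1)])
  have co: "coeff p i \<in> ring_adjoin K u" for i
    using E_regular_coeffs[OF p(1,2)] g p(3) by auto
  define T where "T i = coeff p i * w ^ i" for i
  have w0: "w \<noteq> 0"
    using pole_values[OF P] place_0[OF P(1)] by auto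
  have "\<exists>a. coeff p i \<noteq> 0 \<longrightarrow> P (T i) = - int (m * (q * a + (q + 1) * i))" for i
  proof (cases "coeff p i = 0")
    case False
    obtain s where s: "s \<in> polys_over K" "coeff p i = poly s u"
      using co[of i] by (auto simp: ring_adjoin_def)
    then have "s \<noteq> 0" using False by auto
    then have "P (coeff p i) = int (degree s) * P u"
      using place_poly_const_at_pole[OF P(1) K P(2) s(1)] s(2) by simp
    then have "P (T i) = - int (m * (q * degree s + (q + 1) * i))"
      using False w0 unfolding normalized_values(1)[OF P]
      by (simp add: T_def place_mult[OF P(1)] place_power[OF P(1)] normalized_values(2)[OF P] algebra_simps)
    then show ?thesis by blast
  qed simp
  then obtain a where a: "\<And>i. coeff p i \<noteq> 0 \<Longrightarrow> P (T i) = - int (m * (q * a i + (q + 1) * i))"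
    by metis
  have "inj_on (\<lambda>i. P (T i)) {i\<in>{..<q}. T i \<noteq> 0}"
  proof (rule inj_onI)
    fix i j assume ij: "i \<in> {i\<in>{..<q}. T i \<noteq> 0}" "j \<in> {i\<in>{..<q}. T i \<noteq> 0}" "P (T i) = P (T j)"
    then have "coeff p i \<noteq> 0" "coeff p j \<noteq> 0"
      by (auto simp: T_def)
    then have "q * a i + (q + 1) * i = q * a j + (q + 1) * j"
      using ij(3) a m by (simp del: of_nat_mult of_nat_add)
    then have "int (q * a i + (q + 1) * i) = int (q * a j + (q + 1) * j)"
      by (rule arg_cong)
    then have "int i - int j = int q * (int (a j) - int (a i) + int j - int i)"
      by (simp add: algebra_simps)
    then have "int q dvd int i - int j"
      by simp
    then show "i = j"
      using ij by (intro eq_if_dvd_diff[of i q j]) auto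
  qed
  moreover have "T (degree p) \<noteq> 0"
    using g(3) p(3) w0 by (auto simp: T_def)
  then have "\<exists>i\<in>{..<q}. T i \<noteq> 0"
    using p(2) by blast
  ultimately obtain i where i: "T i \<noteq> 0" "P (sum T {..<q}) = P (T i)"
    using place_sum_distinct[OF P(1), of "{..<q}" T] by blast
  have "g = sum T {..<q}"
    unfolding T_def p(3) by (rule poly_eq_sum_lessThan[OF p(2)])
  then show ?thesis
    using i a[of i] by (auto simp: T_def)
qed

text \<open>At the places away from \<open>P\<close> where \<open>z\<close> has a zero or a pole, functions of \<open>E\<close> have values
  divisible by \<open>m\<close>.  Therefore a bound for the value of \<open>g z\<^sup>j\<close> can be rounded up to a bound for
  \<open>g\<close> alone, and the poles of \<open>z\<close> force \<open>g\<close> to have zeros that \<open>t\<^sup>c\<close> absorbs.\<close>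

lemma pole_value_decomposition:
  assumes t: "t \<in> E" "t \<noteq> 0" and s: "s > 0" and md: "m = s * d + 1"
    and others: "\<And>Q. place K Q \<Longrightarrow> Q \<noteq> P \<Longrightarrow>
       Q z = 0 \<and> 0 \<le> Q t \<or>
       Q z = 1 \<and> 0 \<le> Q t \<and> (\<forall>g\<in>E. int m dvd Q g) \<or>
       Q z = - int d \<and> - int m \<le> Q t \<and> (\<forall>g\<in>E. int m dvd Q g)"
    and f: "f \<in> regular" "f \<noteq> 0"
  shows "\<exists>a i j c. j \<le> c * s \<and> P f = - int (m * (q * a + (q + 1) * i)) - int c * P t + int j * r"
proof -
  obtain p where p: "p \<in> polys_over E" "degree p < m" "f = poly p z"
    by (rule z_rep)
  then have "p \<noteq> 0"
    using f(2) by auto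
  then obtain j where j: "j < m" "coeff p j \<noteq> 0" "P f = P (coeff p j * z ^ j)"
    using z_sum_value[OF p(1,2)] P p(3) by blast
  define g where "g = coeff p j"
  have g: "g \<in> E" "g \<noteq> 0" "g * z ^ j \<in> regular"
    using z_component_regular[OF p(1,2)] p f j by (auto simp: g_def polys_over_def)
  define c where "c = (j + s - 1) div s"
  have jc: "j \<le> c * s"
  proof -
    have "j + s - 1 < c * s + s"
    proof -
      have "(j + s - 1) mod s < s"
        using s by simp
      moreover have "j + s - 1 = c * s + (j + s - 1) mod s"
        unfolding c_def by simp
      ultimately show ?thesis by linarith
    qed
    then show ?thesis by simp
  qed
  \<comment> \<open>The bound \<open>c \<le> d\<close>, which comes from \<open>j \<le> s d\<close>, absorbs the difference between \<open>m\<close> and \<open>s d\<close>.\<close>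
  have cd: "(int c - 1) * int m < int j * int d" if "j > 0"
  proof -
    have "c * s \<le> j + s - 1"
      unfolding c_def by simp
    then have 1: "int c * int s \<le> int j + int s - 1"
      using s that by (simp flip: of_nat_mult)
    have "int j \<le> int s * int d"
      using j md by (simp flip: of_nat_mult)
    then have "int c * int s \<le> int s * (int d + 1) - 1"
      using 1 by (simp add: algebra_simps)
    then have "int s * int c < int s * (int d + 1)"
      by (simp add: mult.commute)
    then have 2: "int c - 1 < int d"
      using s by simp
    have "(int c - 1) * int m = (int c - 1) * int s * int d + (int c - 1)"
      using md by (simp add: algebra_simps)
    also have "\<dots> \<le> (int j - 1) * int d + (int c - 1)"
      using 1 by (intro add_right_mono mult_right_mono) (auto simp: algebra_simps)
    also have "\<dots> < int j * int d"
      using 2 by (simp add: algebra_simps)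
    finally show ?thesis .
  qed
  \<comment> \<open>The fraction \<open>j d / m\<close> is at most \<open>j / s\<close> and, if \<open>j > 0\<close>, larger than \<open>c - 1\<close>; so both have
    the ceiling \<open>c\<close>.\<close>
  have round: "int c \<le> k" if "(k * int m) \<ge> int j * int d" for k
  proof (cases "j = 0")
    case True
    then have "c = 0"
      using s by (simp add: c_def)
    then show ?thesis
      using that True m by (simp add: zero_le_mult_iff)
  next
    case False
    then have "(int c - 1) * int m < k * int m"
      using cd that by linarith
    then have "int c - 1 < k"
      using m by (simp only: mult_less_cancel_right_pos of_nat_0_less_iff)
    then show ?thesis by simp
  qed
  have "g * t ^ c \<in> regular"
    unfolding regular_iff
  proof (intro allI impI)
    fix Q assume Q: "place K Q" "Q \<noteq> P"
    have gz: "0 \<le> Q g + int j * Q z"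
      using g Q z_nonzero unfolding regular_iff
      by (auto simp: place_mult[OF Q(1)] place_power[OF Q(1)])
    have gt: "Q (g * t ^ c) = Q g + int c * Q t"
      using g t by (simp add: place_mult[OF Q(1)] place_power[OF Q(1)])
    consider "Q z = 0" "0 \<le> Q t" | "Q z = 1" "0 \<le> Q t" "int m dvd Q g" |
      "Q z = - int d" "- int m \<le> Q t" "int m dvd Q g"
      using others[OF Q] g(1) by blast
    then show "0 \<le> Q (g * t ^ c)"
    proof cases
      case 1
      then show ?thesis using gz gt by simp
    next
      case 2
      then obtain k where k: "Q g = int m * k" by (auto elim: dvdE)
      have "- int m < int m * k"
        using gz k 2 j(1) by simp
      then have "int m * (-1) < int m * k"
        by simp
      then have "- 1 < k"
        using m by (simp only: mult_less_cancel_left_pos of_nat_0_less_iff)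
      then show ?thesis using gt k 2 by simp
    next
      case 3
      then obtain k where k: "Q g = int m * k" by (auto elim: dvdE)
      then have "int c \<le> k"
        using round[of k] gz 3 by (simp add: mult.commute)
      then have "int c * int m \<le> Q g"
        using k by (simp add: mult.commute mult_right_mono)
      moreover have "int c * (- int m) \<le> int c * Q t"
        using 3 by (intro mult_left_mono) auto
      ultimately show ?thesis using gt by simp
    qed
  qed
  moreover have "g * t ^ c \<in> E" "g * t ^ c \<noteq> 0"
    using g t by (auto intro: subringD(4)[OF ER] subringD(7)[OF ER])
  ultimately obtain a i where "P (g * t ^ c) = - int (m * (q * a + (q + 1) * i))"
    using E_regular_value by blast
  moreover have "P (g * t ^ c) = P g + int c * P t"
    using g t by (simp add: place_mult[OF P(1)] place_power[OF P(1)])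
  moreover have "P f = P g + int j * r"
    using j g z_nonzero normalized_values(3)[OF P]
    by (simp add: g_def place_mult[OF P(1)] place_power[OF P(1)])
  ultimately have "P f = - int (m * (q * a + (q + 1) * i)) - int c * P t + int j * r"
    by linarith
  then show ?thesis
    using jc by blast
qed

end

section \<open>Roots in a finite field\<close>

context
  fixes K :: "'a::field set"
  assumes K: "subfield_of_type K" and fin: "finite K"
begin

lemma finite_field_power:
  assumes c: "c \<in> K"
  shows "c ^ card K = c"
proof (cases "c = 0")
  case True
  have "card K > 0"
    using c fin by (auto simp: card_gt_0_iff)
  then show ?thesis
    using True by simp
next
  case False
  note R = subfield_imp_subring[OF K]
  define U where "U = K - {0}"
  have "bij_betw (\<lambda>x. c * x) U U"
  proof (rule bij_betwI[where g = "\<lambda>x. inverse c * x"])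
    show "(\<lambda>x. c * x) \<in> U \<rightarrow> U" "(\<lambda>x. inverse c * x) \<in> U \<rightarrow> U"
      using c False subringD(4)[OF R] subfieldD(1)[OF K] by (auto simp: U_def)
  qed (use False in auto)
  then have "(\<Prod>x\<in>U. c * x) = \<Prod>U"
    by (rule prod.reindex_bij_betw)
  then have "c ^ card U * \<Prod>U = \<Prod>U"
    by (simp add: prod.distrib)
  moreover have "\<Prod>U \<noteq> 0"
    using fin by (simp add: U_def)
  ultimately have "c ^ card U = 1"
    by simp
  moreover have "card K = Suc (card U)"
    unfolding U_def using card_Suc_Diff1[OF fin subringD(1)[OF R]] by simp
  ultimately show ?thesis by simp
qed

lemma card_times_1: "of_nat (card K) = (0 :: 'a)"
proof -
  note R = subfield_imp_subring[OF K]
  have "bij_betw (\<lambda>x. x + 1) K K"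
    by (rule bij_betwI[where g = "\<lambda>x. x - 1"]) (auto intro: subringD[OF R])
  then have "(\<Sum>x\<in>K. x + 1) = \<Sum>K"
    by (rule sum.reindex_bij_betw)
  then show ?thesis
    by (simp add: sum.distrib)
qed

lemma power_char_additive:
  assumes q: "primepow q" and cK: "card K = q ^ e"
  shows "(f + g :: 'a) ^ q = f ^ q + g ^ q"
proof -
  obtain p k where p: "prime p" "q = p ^ k"
    using q by (auto simp: primepow_def)
  have "of_nat (p ^ (k * e)) = (0 :: 'a)"
    using card_times_1 cK p(2) by (simp add: power_mult)
  then have d: "CHAR('a) dvd p ^ (k * e)"
    by (simp only: of_nat_eq_0_iff_char_dvd)
  have "CHAR('a) > 0"
    using d p(1) by (auto intro!: Nat.gr0I simp: prime_gt_0_nat)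
  then have "prime CHAR('a)"
    by (rule prime_CHAR_semidom)
  then have "CHAR('a) = p"
    using d p(1) prime_dvd_power primes_dvd_imp_eq by blast
  then show ?thesis
    using p freshmans_dream'[of q k f g] by simp
qed

text \<open>A divisor of \<open>X\<^sup>|\<^sup>K\<^sup>| - X\<close> has as many roots in \<open>K\<close> as its degree, since its cofactor cannot
  account for more of the \<open>|K|\<close> roots than its own degree.\<close>

lemma card_roots_of_divisor:
  assumes p: "p dvd monom 1 (card K) - monom 1 1"
  shows "card {c\<in>K. poly p c = 0} = degree p"
proof -
  note R = subfield_imp_subring[OF K]
  define N where "N = card K"
  define F where "F = monom (1::'a) N - monom 1 1"
  have "card {0, 1::'a} \<le> N"
    unfolding N_def using fin subringD(1,2)[OF R] by (intro card_mono) auto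
  then have N: "N > 1" by simp
  have "coeff F N = 1"
    using N by (simp add: F_def)
  then have F0: "F \<noteq> 0" by auto
  have degF: "degree F \<le> N"
    by (rule degree_le) (use N in \<open>auto simp: F_def\<close>)
  obtain s where s: "F = p * s"
    using p by (auto simp: F_def N_def elim: dvdE)
  have nz: "p \<noteq> 0" "s \<noteq> 0"
    using F0 s by auto
  have "K \<subseteq> {c\<in>K. poly p c = 0} \<union> {c. poly s c = 0}"
  proof
    fix c assume "c \<in> K"
    then have "poly F c = 0"
      by (simp add: F_def poly_monom N_def finite_field_power)
    then show "c \<in> {c\<in>K. poly p c = 0} \<union> {c. poly s c = 0}"
      using s \<open>c \<in> K\<close> by auto
  qed
  then have "N \<le> card ({c\<in>K. poly p c = 0} \<union> {c. poly s c = 0})"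
    unfolding N_def using fin nz poly_roots_finite by (intro card_mono) auto
  also have "\<dots> \<le> card {c\<in>K. poly p c = 0} + card {c. poly s c = 0}"
    by (rule card_Un_le)
  also have "\<dots> \<le> card {c\<in>K. poly p c = 0} + degree s"
    using card_poly_roots_bound[OF nz(2)] by simp
  finally have "N \<le> card {c\<in>K. poly p c = 0} + degree s" .
  moreover have "degree p + degree s \<le> N"
    using degF s nz by (simp add: degree_mult_eq)
  moreover have "card {c\<in>K. poly p c = 0} \<le> card {c. poly p c = 0}"
    using nz poly_roots_finite by (intro card_mono) auto
  moreover have "card {c. poly p c = 0} \<le> degree p"
    by (rule card_poly_roots_bound[OF nz(1)])
  ultimately show ?thesis by linarith
qed

lemma split_divisor:
  assumes p: "p dvd monom 1 (card K) - monom 1 1" "lead_coeff p = 1"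
  shows "poly p x = (\<Prod>c\<in>{c\<in>K. poly p c = 0}. x - c)"
proof -
  define S where "S = {c\<in>K. poly p c = 0}"
  have S: "finite S" "card S = degree p"
    using fin card_roots_of_divisor[OF p(1)] by (auto simp: S_def)
  define g where "g = (\<Prod>c\<in>S. [:- c, 1:])"
  have g: "degree g = card S" "lead_coeff g = 1"
    unfolding g_def lead_coeff_prod by (simp_all add: degree_prod_eq_sum_degree)
  have "p - g = 0"
  proof (rule ccontr)
    assume nz: "p - g \<noteq> 0"
    have "S \<subseteq> {c. poly (p - g) c = 0}"
      using S(1) by (auto simp: S_def g_def poly_prod)
    then have "card S \<le> card {c. poly (p - g) c = 0}"
      using poly_roots_finite[OF nz] by (intro card_mono)
    also have "\<dots> \<le> degree (p - g)"
      by (rule card_poly_roots_bound[OF nz])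
    finally have "degree p \<le> degree (p - g)"
      using S by simp
    moreover have "degree (p - g) \<le> degree p"
      using g S by (intro degree_diff_le) auto
    ultimately have d: "degree (p - g) = degree p" by simp
    have "coeff (p - g) (degree p) = 0"
      using p(2) g S by simp
    then show False
      using nz unfolding d[symmetric] leading_coeff_0_iff by blast
  qed
  then have "poly p x = poly g x"
    by simp
  also have "\<dots> = (\<Prod>c\<in>S. x - c)"
    by (simp add: g_def poly_prod)
  finally show ?thesis
    unfolding S_def .
qed

end

lemma power_minus_one_dvd:
  fixes x :: "'b::comm_ring_1"
  assumes "k dvd l"
  shows "x ^ k - 1 dvd x ^ l - 1"
proof -
  obtain j where l: "l = k * j" using assms by (auto elim: dvdE)
  have "x ^ k - 1 dvd (x ^ k) ^ j - 1 ^ j"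
    by (metis dvd_triv_left power_diff_sumr2)
  then show ?thesis
    by (simp add: l power_mult)
qed

lemma place_prod_pos:
  assumes Q: "place K Q" and S: "finite S" "\<And>c. c \<in> S \<Longrightarrow> f - c \<noteq> 0"
    and pos: "0 < Q (\<Prod>c\<in>S. f - c)"
  shows "\<exists>c\<in>S. 0 < Q (f - c)"
proof (rule ccontr)
  assume *: "\<not> ?thesis"
  have "(\<Prod>c\<in>S. f - c) \<noteq> 0 \<and> Q (\<Prod>c\<in>S. f - c) \<le> 0"
    using S *
  proof (induction S rule: finite_induct)
    case empty
    then show ?case using place_1[OF Q] by simp
  next
    case (insert c S)
    have "(\<Prod>c\<in>S. f - c) \<noteq> 0 \<and> Q (\<Prod>c\<in>S. f - c) \<le> 0" "f - c \<noteq> 0" "Q (f - c) \<le> 0"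
      using insert by (auto simp: not_less)
    then show ?case
      using insert.hyps by (simp add: place_mult[OF Q])
  qed
  then show False using pos by simp
qed

section \<open>The curve\<close>

locale gk_curve = gk_function_field K q n x y z
  for K :: "'a::field set" and q n :: nat and x y z :: 'a +
  assumes primepow_q: "primepow q" and n: "n \<ge> 3" "odd n"
begin

abbreviation "m \<equiv> gk_m q n"
abbreviation "s \<equiv> gk_s q n"
abbreviation "d \<equiv> q\<^sup>2 - q"

lemma KR: "subring_of_type K"
  by (rule subfield_imp_subring[OF subfield_K])

lemma q2: "q \<ge> 2"
  using primepow_gt_Suc_0[OF primepow_q] by simp

lemma finite_K: "finite K"
  using card_K q2 by (intro card_ge_0_finite) simp

lemma m_mult: "m * (q + 1) = q ^ n + 1"
  by (rule gk_m_exact[OF n(2)])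

lemma m_pos: "m > 0"
  using m_mult by (cases "m = 0") auto

lemma m_eq: "m = s * d + 1"
  using gk_s_exact[OF n(2), of q] q2 m_pos by simp

lemma s_pos: "s > 0"
proof (rule ccontr)
  assume "\<not> s > 0"
  then have "m = 1"
    using m_eq by simp
  then have "q ^ n = q ^ 1"
    using m_mult by simp
  then have "n = 1"
    using q2 by (subst (asm) power_inject_exp) auto
  then show False
    using n by simp
qed

lemma d_le: "int d = int q ^ 2 - int q"
proof -
  have "q \<le> q\<^sup>2"
    using q2 by (simp add: power2_eq_square)
  then show ?thesis
    by (simp add: of_nat_diff)
qed

lemma frobenius: "(f + g :: 'a) ^ q = f ^ q + g ^ q"
  by (rule power_char_additive[OF subfield_K finite_K primepow_q card_K])

lemma frobenius_minus_1: "(- 1 :: 'a) ^ q = - 1"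
proof -
  have "0 = (1 + (- 1) :: 'a) ^ q"
    using q2 by simp
  also have "\<dots> = 1 + (- 1) ^ q"
    unfolding frobenius by simp
  finally show ?thesis
    by (metis add_eq_0_iff)
qed

lemma frobenius_minus: "(- f :: 'a) ^ q = - (f ^ q)"
proof -
  have "(- f) ^ q = ((- 1) * f) ^ q"
    by simp
  also have "\<dots> = - (f ^ q)"
    unfolding power_mult_distrib frobenius_minus_1 by simp
  finally show ?thesis .
qed

lemma frobenius_diff: "(f - g :: 'a) ^ q = f ^ q - g ^ q"
  using frobenius[of f "- g"] by (simp add: frobenius_minus)

lemma power_q2: "f ^ q\<^sup>2 = (f ^ q) ^ q" for f :: 'a
  by (simp add: power2_eq_square power_mult)

lemma q2n: "q ^ (2 * n) - 1 = (q ^ n - 1) * (q ^ n + 1)"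
proof -
  have "q ^ (2 * n) = q ^ n * q ^ n"
    by (simp add: mult_2 power_add)
  then show ?thesis
    by (simp add: algebra_simps)
qed

lemma order_divisors: "q + 1 dvd card K - 1" "m dvd card K - 1" "q\<^sup>2 - 1 dvd card K - 1"
proof -
  have "q ^ n + 1 dvd card K - 1"
    unfolding card_K q2n by (rule dvd_triv_right)
  moreover have "q + 1 dvd q ^ n + 1" "m dvd q ^ n + 1"
    using m_mult by (metis dvd_triv_right, metis dvd_triv_left)
  ultimately show "q + 1 dvd card K - 1" "m dvd card K - 1"
    using dvd_trans by blast+
  have "int q ^ 2 - 1 dvd (int q ^ 2) ^ n - 1 ^ n"
    by (metis dvd_triv_left power_diff_sumr2)
  then have "int q ^ 2 - 1 dvd int q ^ (2 * n) - 1"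
    by (simp add: power_mult)
  then have "int (q\<^sup>2 - 1) dvd int (card K - 1)"
    using q2 by (simp add: card_K of_nat_diff)
  then show "q\<^sup>2 - 1 dvd card K - 1"
    by (simp only: int_dvd_int_iff)
qed

lemma card_K_pos: "card K = Suc (card K - 1)"
  using card_K q2 by simp

lemma field_poly: "monom 1 (card K) - monom 1 1 = monom (1::'a) 1 * (monom 1 1 ^ (card K - 1) - 1)"
  by (subst card_K_pos) (simp add: monom_power algebra_simps mult_monom)

lemma unity_poly_dvd:
  assumes "k dvd card K - 1"
  shows "monom 1 k - 1 dvd monom 1 (card K) - monom (1::'a) 1"
proof -
  have "monom (1::'a) k - 1 = monom 1 1 ^ k - 1"
    by (simp add: monom_power)
  also have "\<dots> dvd monom 1 1 ^ (card K - 1) - 1"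
    by (rule power_minus_one_dvd[OF assms])
  finally show ?thesis
    unfolding field_poly by (rule dvd_mult)
qed

lemma unity_poly:
  assumes "k > 0"
  shows "degree (monom (1::'a) k - 1) = k" "lead_coeff (monom (1::'a) k - 1) = 1"
  using monom_minus_const[OF assms, of "1 :: 'a"] by (simp_all only: one_pCons[symmetric])

lemma card_unity_roots:
  assumes "k dvd card K - 1" "k > 0"
  shows "card {c\<in>K. c ^ k = 1} = k"
  using card_roots_of_divisor[OF subfield_K finite_K unity_poly_dvd[OF assms(1)]] unity_poly(1)[OF assms(2)]
  by (simp add: poly_monom)

lemma prod_unity_roots:
  assumes "k dvd card K - 1" "k > 0"
  shows "f ^ k - 1 = (\<Prod>c\<in>{c\<in>K. c ^ k = 1}. f - c)"
  using split_divisor[OF subfield_K finite_K unity_poly_dvd[OF assms(1)] unity_poly(2)[OF assms(2)], of f]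
  by (simp add: poly_monom)

text \<open>In terms of \<open>Y = X\<^sup>q\<^sup>-\<^sup>1\<close>, the polynomial \<open>Y + 1\<close> divides \<open>Y\<^sup>q\<^sup>+\<^sup>1 - 1\<close>, because \<open>(-1)\<^sup>q\<^sup>+\<^sup>1 = 1\<close> in the
  field, whatever its characteristic.\<close>

lemma card_kernel: "card {c\<in>K. c ^ q + c = 0} = q"
proof -
  define Y where "Y = monom (1::'a) (q - 1)"
  have "Y - (- 1) dvd Y ^ (q + 1) - (- 1) ^ (q + 1)"
    by (metis dvd_triv_left power_diff_sumr2)
  moreover have "(- 1 :: 'a poly) ^ (q + 1) = 1"
  proof -
    have "(- 1 :: 'a poly) = [:- 1:]"
      by (simp add: one_pCons)
    then have "(- 1 :: 'a poly) ^ (q + 1) = [:(- 1) ^ (q + 1):]"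
      by (simp only: poly_const_pow)
    then show ?thesis
      using frobenius_minus_1 by (simp add: one_pCons)
  qed
  moreover have "(q - 1) * (q + 1) = q\<^sup>2 - 1"
    using q2 by (simp add: power2_eq_square algebra_simps)
  then have "Y ^ (q + 1) = monom 1 1 ^ (q\<^sup>2 - 1)"
    by (simp add: Y_def monom_power del: power_Suc)
  ultimately have "Y + 1 dvd monom 1 1 ^ (q\<^sup>2 - 1) - 1"
    by (simp only: diff_minus_eq_add)
  also have "\<dots> dvd monom 1 1 ^ (card K - 1) - 1"
    by (rule power_minus_one_dvd[OF order_divisors(3)])
  finally have "monom 1 1 * (Y + 1) dvd monom 1 (card K) - monom 1 1"
    unfolding field_poly by (rule mult_dvd_mono[OF dvd_refl])
  moreover have "monom 1 1 * (Y + 1) = monom 1 q + monom 1 1"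
    using q2 by (simp add: Y_def algebra_simps mult_monom)
  ultimately have dv: "monom 1 q + monom 1 1 dvd monom 1 (card K) - monom (1::'a) 1"
    by simp
  have "degree (monom (1::'a) q + monom 1 1) = q"
    using q2 by (subst degree_add_eq_left) (auto simp: degree_monom_eq)
  then show ?thesis
    using card_roots_of_divisor[OF subfield_K finite_K dv] by (simp add: poly_monom)
qed

lemma q2_minus_1_pos: "q\<^sup>2 - 1 > 0"
proof -
  have "1 < q\<^sup>2"
    using q2 by (intro one_less_power) auto
  then show ?thesis by simp
qed

lemma F_q2_iff: "c \<in> F_q2 K q \<longleftrightarrow> c \<in> K \<and> (c ^ q) ^ q = c"
  by (simp add: F_q2_def power_q2)

lemma unity_root_in_F_q2:
  assumes "c \<in> K" "c ^ (q + 1) = 1"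
  shows "c \<in> F_q2 K q"
proof -
  have 1: "c ^ q * c = 1"
    using assms(2) by (simp add: mult.commute)
  then have "(c ^ q) ^ q * c ^ q = 1"
    by (metis power_mult_distrib power_one)
  then have "(c ^ q) ^ q = c"
    using 1 by (metis mult.assoc mult.commute mult_1)
  then show ?thesis
    using assms(1) F_q2_iff by blast
qed

lemma power_q2_minus:
  fixes f :: 'a
  shows "f ^ q\<^sup>2 - f = f * (f ^ (q\<^sup>2 - 1) - 1)"
proof -
  have "q\<^sup>2 = Suc (q\<^sup>2 - 1)"
    using q2_minus_1_pos by simp
  then have "f ^ q\<^sup>2 = f ^ Suc (q\<^sup>2 - 1)"
    by (rule arg_cong)
  then show ?thesis
    by (simp add: algebra_simps)
qed

text \<open>The function \<open>f ^ q\<^sup>2 - f\<close> is the product of the \<open>f - a\<close> over \<open>0\<close> and the roots of unity \<open>a\<close> of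
  order dividing \<open>q\<^sup>2 - 1\<close>.\<close>

lemma zero_in_F_q2:
  assumes Q: "place K Q" and f: "f \<notin> K" "0 < Q (f ^ q\<^sup>2 - f)"
  shows "\<exists>a\<in>F_q2 K q. 0 < Q (f - a)"
proof -
  have f0: "f \<noteq> 0"
    using f subringD(1)[OF KR] by auto
  note d1 = q2_minus_1_pos
  define p where "p = f ^ (q\<^sup>2 - 1) - 1"
  have prod: "p = (\<Prod>c\<in>{c\<in>K. c ^ (q\<^sup>2 - 1) = 1}. f - c)"
    unfolding p_def by (rule prod_unity_roots[OF order_divisors(3) d1])
  have nz: "f - c \<noteq> 0" if "c \<in> K" for c
    using f that by auto
  have p0: "p \<noteq> 0"
    unfolding prod using finite_K nz by simp
  have "0 < Q f + Q p"
    using f(2) f0 p0 place_mult[OF Q, of f p] by (simp add: power_q2_minus p_def)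
  then consider "0 < Q f" | "0 < Q p" by linarith
  then show ?thesis
  proof cases
    case 1
    then show ?thesis
      using subringD(1)[OF KR] q2 by (intro bexI[of _ 0]) (auto simp: F_q2_def)
  next
    case 2
    have "\<exists>c\<in>{c\<in>K. c ^ (q\<^sup>2 - 1) = 1}. 0 < Q (f - c)"
      using 2 finite_K nz by (intro place_prod_pos[OF Q]) (auto simp: prod)
    then obtain c where c: "c \<in> K" "c ^ (q\<^sup>2 - 1) = 1" "0 < Q (f - c)" by auto
    then have "c ^ q\<^sup>2 = c"
      using power_q2_minus[of c] by simp
    then show ?thesis
      using c by (auto simp: F_q2_def)
  qed
qed

lemma x_not_algebraic: "p \<in> polys_over K \<Longrightarrow> p \<noteq> 0 \<Longrightarrow> poly p x \<noteq> 0"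
  using transcendental_x by (auto simp: transcendental_over_def polys_over_def)

lemma x_power_not_const:
  assumes "k > 0" "c \<in> K"
  shows "x ^ k \<noteq> c"
proof
  assume "x ^ k = c"
  have "monom 1 k - [:c:] \<in> polys_over K"
    using assms subringD[OF KR] by (intro polys_over_closed[OF KR])
  moreover have "monom 1 k - [:c:] \<noteq> 0"
    using monom_minus_const(1)[OF assms(1), of c] assms(1) by (metis degree_0 less_irrefl)
  ultimately have "poly (monom 1 k - [:c:]) x \<noteq> 0"
    by (rule x_not_algebraic)
  then show False
    using \<open>x ^ k = c\<close> by (simp add: poly_monom)
qed

lemma x_notin_K: "x \<notin> K"
  using x_power_not_const[of 1 x] by auto

lemma y_notin_K: "y \<notin> K"
proof
  assume "y \<in> K"
  then have "y ^ (q + 1) + 1 \<in> K"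
    by (intro subringD(2,3,7)[OF KR])
  then show False
    using x_power_not_const[of "q + 1" "y ^ (q + 1) + 1"] hermitian_eq by simp
qed

lemma nonzero: "x \<noteq> 0" "y \<noteq> 0"
  using x_notin_K y_notin_K subringD(1)[OF KR] by auto

lemma x_q2_nonzero: "x ^ q\<^sup>2 - x \<noteq> 0"
proof -
  show ?thesis
    unfolding power_q2_minus using nonzero x_power_not_const[OF q2_minus_1_pos subringD(2)[OF KR]] by simp
qed

lemma z_eq: "z ^ m * y ^ q = x ^ q\<^sup>2 - x"
proof -
  have "x ^ (q + 1) - 1 = y * y ^ q"
    using hermitian_eq by simp
  then show ?thesis
    using nonzero by (simp add: gk_eq)
qed

lemma z_nonzero: "z \<noteq> 0"
  using z_eq x_q2_nonzero m_pos by (auto simp: zero_power)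

lemma xy: "x ^ q * x - y ^ q * y = 1"
  using hermitian_eq by (simp add: mult.commute)

definition H where "H = field_adjoin K {x, y}"

lemma subfield_H: "subfield_of_type H"
  unfolding H_def field_adjoin_def subfield_of_type_def by blast

lemma H_mem: "K \<subseteq> H" "x \<in> H" "y \<in> H"
  unfolding H_def field_adjoin_def by blast+

lemma H_least: "subfield_of_type F \<Longrightarrow> K \<subseteq> F \<Longrightarrow> x \<in> F \<Longrightarrow> y \<in> F \<Longrightarrow> H \<subseteq> F"
  unfolding H_def field_adjoin_def by blast

lemma HR: "subring_of_type H"
  by (rule subfield_imp_subring[OF subfield_H])

lemma zm_H: "z ^ m \<in> H"
proof -
  have "z ^ m = (x ^ q\<^sup>2 - x) / y ^ q"
    using z_eq nonzero by (simp add: nonzero_eq_divide_eq)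
  also have "\<dots> \<in> H"
    using H_mem by (intro subfieldD(2)[OF subfield_H] subringD(6,7)[OF HR])
  finally show ?thesis .
qed

lemma H_z_UNIV: "ring_adjoin H z = UNIV"
proof -
  define M where "M = monom 1 m - [:z ^ m:]"
  have dM: "degree M = m" "lead_coeff M = 1"
    unfolding M_def using monom_minus_const[OF m_pos] by blast+
  have "M \<in> polys_over H"
    unfolding M_def using zm_H subringD[OF HR] by (intro polys_over_closed[OF HR]) auto
  moreover have "poly M z = 0"
    by (simp add: M_def poly_monom)
  ultimately have sub: "subfield_of_type (ring_adjoin H z)"
    using dM m_pos by (intro subfield_ring_adjoin[OF subfield_H, of M]) auto
  have "field_adjoin K {x, y, z} \<subseteq> ring_adjoin H z"
    unfolding field_adjoin_def
    using sub ring_adjoin_base[OF HR, of z] H_mem by (intro Inter_lower) auto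
  then show ?thesis
    using generated by auto
qed

text \<open>The coordinates at every rational point generate the same field, so that facts about the values of
  its elements at different points can be combined.\<close>

lemma adjoin2_eq_H:
  assumes c: "hermitian_coordinates K q u w eps"
    and uw: "u \<in> H" "w \<in> H" and xy: "x \<in> adjoin2 K u w" "y \<in> adjoin2 K u w"
  shows "adjoin2 K u w = H"
proof
  interpret hermitian_coordinates K q u w eps by (rule c)
  have "ring_adjoin K u \<subseteq> H"
    using uw H_mem by (intro ring_adjoin_least[OF HR])
  then have "fractions (ring_adjoin K u) \<subseteq> H"
    using subfieldD(2)[OF subfield_H] by (auto simp: fractions_def)
  then show "adjoin2 K u w \<subseteq> H"
    unfolding adjoin2_def using uw by (intro ring_adjoin_least[OF HR])
  show "H \<subseteq> adjoin2 K u w"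
    using xy in_A A_sub_L L_sub_E by (intro H_least[OF E_subfield]) auto
qed

end

section \<open>Coordinates at the rational points\<close>

context gk_curve
begin

lemma F_q2D: "c \<in> F_q2 K q \<Longrightarrow> c \<in> K" "c \<in> F_q2 K q \<Longrightarrow> (c ^ q) ^ q = c"
  by (auto simp: F_q2_iff)

text \<open>The equation of the tangent of the Hermitian curve at \<open>(a, b)\<close>, and that of another line
  through that point.\<close>

definition aff_t where "aff_t a b = a ^ q * x - b ^ q * y - 1"
definition aff_v where "aff_v a b = b * x - a * y"
abbreviation "aff_u a b \<equiv> aff_v a b / aff_t a b"

context
  fixes a b assumes ab: "a \<in> F_q2 K q" "b \<in> F_q2 K q" "a ^ q * a - b ^ q * b = 1"
begin

lemma aff_x: "x - a = a * aff_t a b - b ^ q * aff_v a b"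
proof -
  have "a * aff_t a b - b ^ q * aff_v a b = (a ^ q * a - b ^ q * b) * x - a"
    by (simp add: aff_t_def aff_v_def algebra_simps)
  then show ?thesis using ab(3) by simp
qed

lemma aff_y: "y - b = b * aff_t a b - a ^ q * aff_v a b"
proof -
  have "b * aff_t a b - a ^ q * aff_v a b = (a ^ q * a - b ^ q * b) * y - b"
    by (simp add: aff_t_def aff_v_def algebra_simps)
  then show ?thesis using ab(3) by simp
qed

text \<open>The transformation from \<open>(x - a, y - b)\<close> to \<open>(t, v)\<close> preserves the Hermitian form
  \<open>X\<^sup>q\<^sup>+\<^sup>1 - Y\<^sup>q\<^sup>+\<^sup>1\<close>, as \<open>(a, b)\<close> lies on the curve.  So this is the equation of the curve in the new
  coordinates; the linear terms are those of the tangent and its conjugate.\<close>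

lemma aff_eq: "aff_t a b + aff_t a b ^ q = aff_v a b ^ q * aff_v a b - aff_t a b ^ q * aff_t a b"
proof -
  define A B X Y where "A = a ^ q" "B = b ^ q" "X = x ^ q" "Y = y ^ q"
  have t: "aff_t a b ^ q = a * X - b * Y - 1"
    using F_q2D(2)[OF ab(1)] F_q2D(2)[OF ab(2)]
    by (simp add: aff_t_def frobenius_diff power_mult_distrib A_B_X_Y_def)
  have v: "aff_v a b ^ q = B * X - A * Y"
    by (simp add: aff_v_def frobenius_diff power_mult_distrib A_B_X_Y_def)
  have 1: "A * a - B * b = 1" "X * x - Y * y = 1"
    using ab(3) xy by (simp_all add: A_B_X_Y_def)
  have "(B * X - A * Y) * (b * x - a * y) - (a * X - b * Y - 1) * (A * x - B * y - 1)
    = a * X - b * Y + A * x - B * y - 1 - (A * a - B * b) * (X * x - Y * y)"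
    by (simp add: algebra_simps)
  also have "\<dots> = (A * x - B * y - 1) + (a * X - b * Y - 1)"
    unfolding 1 by simp
  finally show ?thesis
    unfolding t v by (simp add: aff_t_def aff_v_def A_B_X_Y_def)
qed

lemma aff_t_nonzero: "aff_t a b \<noteq> 0"
proof
  assume t0: "aff_t a b = 0"
  then have "aff_v a b = 0"
    using aff_eq q2 by (auto simp: zero_power)
  then show False
    using aff_x t0 x_notin_K F_q2D(1)[OF ab(1)] by simp
qed

lemma aff_hermitian: "hermitian_coordinates K q (aff_u a b) (1 / aff_t a b) (- 1)"
proof
  show "subfield_of_type K" "q \<ge> 2" "- 1 \<in> K"
    using subfield_K q2 subringD[OF KR] by auto
  have "(aff_u a b) ^ (q + 1) + (- 1) = (aff_v a b ^ q * aff_v a b - aff_t a b ^ q * aff_t a b) / (aff_t a b ^ q * aff_t a b)"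
    using aff_t_nonzero by (simp add: power_divide diff_divide_distrib mult.commute)
  also have "\<dots> = (1 / aff_t a b) ^ q + 1 / aff_t a b"
    unfolding aff_eq[symmetric] using aff_t_nonzero by (simp add: power_divide add_divide_distrib)
  finally show "(1 / aff_t a b) ^ q + 1 / aff_t a b = (aff_u a b) ^ (q + 1) + (- 1)" ..
qed

lemma aff_in_H: "aff_t a b \<in> H" "aff_v a b \<in> H"
proof -
  have "a \<in> H" "b \<in> H"
    using ab F_q2D(1) H_mem(1) by auto
  then show "aff_t a b \<in> H" "aff_v a b \<in> H"
    unfolding aff_t_def aff_v_def using H_mem
    by (auto intro!: subringD(6)[OF HR] subringD(4)[OF HR] subringD(7)[OF HR] subringD(2)[OF HR])
qed

lemma aff_adjoin2: "adjoin2 K (aff_u a b) (1 / aff_t a b) = H"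
proof (rule adjoin2_eq_H[OF aff_hermitian])
  interpret hermitian_coordinates K q "aff_u a b" "1 / aff_t a b" "- 1"
    by (rule aff_hermitian)
  show "aff_u a b \<in> H" "1 / aff_t a b \<in> H"
    using aff_in_H subringD(2)[OF HR] by (auto intro: subfieldD(2)[OF subfield_H])
  have u: "aff_u a b \<in> E"
    using in_A(2) A_sub_L L_sub_E by blast
  have "inverse (1 / aff_t a b) \<in> E"
    using w_E by (rule subfieldD(1)[OF E_subfield])
  then have t: "aff_t a b \<in> E"
    by simp
  have "aff_v a b = aff_t a b * (aff_u a b)"
    using aff_t_nonzero by simp
  then have v: "aff_v a b \<in> E"
    using subringD(4)[OF ER t u] by metis
  have const: "a \<in> E"
     "b \<in> E"
    using F_q2D(1) ab in_A(1) A_sub_L L_sub_E by blast+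
  have "x = a + (a * aff_t a b - b ^ q * aff_v a b)" "y = b + (b * aff_t a b - a ^ q * aff_v a b)"
    using aff_x aff_y by (simp_all add: algebra_simps)
  moreover have "a + (a * aff_t a b - b ^ q * aff_v a b) \<in> E"
    "b + (b * aff_t a b - a ^ q * aff_v a b) \<in> E"
    using t v const by (auto intro!: subringD(3)[OF ER] subringD(6)[OF ER] subringD(4)[OF ER] subringD(7)[OF ER])
  ultimately show "x \<in> E"
    "y \<in> E"
    by metis+
qed

text \<open>By \<open>z ^ m * y ^ q = x ^ q\<^sup>2 - x\<close>, where \<open>x ^ q\<^sup>2 - x\<close> has the order of \<open>x - a\<close>.  If \<open>b \<noteq> 0\<close>, then \<open>x - a\<close> is a
  local parameter and \<open>y\<close> is a unit.  If \<open>b = 0\<close>, then the tangent is \<open>x = a\<close>, the order of \<open>x - a\<close> is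
  \<open>q + 1\<close>, and \<open>y\<close> is a local parameter.\<close>

lemma aff_z_value:
  assumes Q: "place K Q" "Q (aff_u a b) < 0"
  shows "int m * Q z = 1 * (Q (aff_u a b) - Q (1 / aff_t a b))"
proof -
  interpret hermitian_coordinates K q "aff_u a b" "1 / aff_t a b" "- 1"
    by (rule aff_hermitian)
  define e where "e = scale Q"
  have e: "e > 0" "Q (aff_u a b) = - int q * e" "Q (1 / aff_t a b) = - int (q + 1) * e"
    using pole_values[OF Q] by (simp_all add: e_def)
  have v0: "aff_v a b \<noteq> 0"
    using Q(2) place_0[OF Q(1)] by auto
  have t: "Q (aff_t a b) = int (q + 1) * e"
    using e(3) aff_t_nonzero by (simp add: place_divide[OF Q(1)] place_1[OF Q(1)] algebra_simps)
  then have v: "Q (aff_v a b) = e"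
    using e(2) v0 aff_t_nonzero by (simp add: place_divide[OF Q(1)] algebra_simps)
  have qe: "e < int (q + 1) * e"
  proof -
    have "1 * e < int (q + 1) * e"
      using e(1) q2 by (intro mult_strict_right_mono) auto
    then show ?thesis by simp
  qed
  have aK: "a \<in> K" "b \<in> K"
    using ab F_q2D by auto
  have xa: "x - a \<noteq> 0" and yb: "y - b \<noteq> 0"
    using x_notin_K y_notin_K aK by auto
  have x_large: "x ^ q\<^sup>2 - x = - (x - a) + (x - a) ^ q\<^sup>2"
    using F_q2D(2)[OF ab(1)] by (simp add: power_q2 frobenius_diff)
  have main: "int m * Q z + int q * Q y = Q (x - a)" if pos: "Q (x - a) > 0"
  proof -
    have "int 1 < int (q\<^sup>2)"
      unfolding of_nat_less_iff using q2_minus_1_pos by linarith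
    then have "Q (x - a) * int 1 < Q (x - a) * int (q\<^sup>2)"
      using pos by (rule mult_strict_left_mono)
    then have "at_least Q (Q (- (x - a)) + 1) ((x - a) ^ q\<^sup>2)"
      unfolding at_least_def place_power[OF Q(1)] place_minus[OF Q(1)]
      by (simp add: mult.commute del: of_nat_power)
    then have "Q (x ^ q\<^sup>2 - x) = Q (- (x - a))"
      unfolding x_large using xa dominant_summand[OF Q(1), of "- (x - a)"] by auto
    then have "Q (z ^ m * y ^ q) = Q (x - a)"
      unfolding z_eq place_minus[OF Q(1)] .
    then show ?thesis
      using z_nonzero nonzero by (simp add: place_mult[OF Q(1)] place_power[OF Q(1)])
  qed
  have "int m * Q z = e"
  proof (cases "b = 0")
    case True
    have a0: "a \<noteq> 0"
      using ab(3) True q2 by auto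
    have xy: "x - a = a * aff_t a b" "y = - (a ^ q * aff_v a b)"
      using aff_x aff_y True q2 by (simp_all add: zero_power)
    have "Q (x - a) = Q (a * aff_t a b)" "Q y = Q (- (a ^ q * aff_v a b))"
      by (rule arg_cong[OF xy(1)], rule arg_cong[OF xy(2)])
    then have "Q (x - a) = int (q + 1) * e" "Q y = e"
      using a0 aff_t_nonzero v0 t v place_const[OF Q(1) aK(1)]
      by (simp_all add: place_mult[OF Q(1)] place_minus[OF Q(1)] place_power[OF Q(1)])
    then show ?thesis
      using main e(1) qe by (simp add: algebra_simps)
  next
    case False
    have bv: "Q (- (b ^ q * aff_v a b)) = e"
      using False v0 v place_const[OF Q(1) aK(2)]
      by (simp add: place_mult[OF Q(1)] place_minus[OF Q(1)] place_power[OF Q(1)])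
    have at: "at_least Q (int (q + 1) * e) (c * aff_t a b)" if "c \<in> K" for c
      using t place_const[OF Q(1) that] by (cases "c = 0")
       (auto simp: at_least_def place_mult[OF Q(1)] aff_t_nonzero)
    have "at_least Q (Q (- (b ^ q * aff_v a b)) + 1) (a * aff_t a b)"
      unfolding bv using at[OF aK(1)] qe by (intro at_least_mono[OF Q(1) at[OF aK(1)]]) simp
    moreover have "- (b ^ q * aff_v a b) \<noteq> 0"
      using False v0 by simp
    ultimately have "Q (- (b ^ q * aff_v a b) + a * aff_t a b) = e"
      using dominant_summand[OF Q(1)] bv by blast
    then have X: "Q (x - a) = e"
      unfolding aff_x by simp
    have "at_least Q e (a ^ q * aff_v a b)"
      using v0 v q2 place_const[OF Q(1) aK(1)]
      by (cases "a = 0") (auto simp: at_least_def place_mult[OF Q(1)] place_power[OF Q(1)])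
    then have "at_least Q e (y - b)"
      unfolding aff_y using at[OF aK(2)] qe
      by (intro at_least_diff[OF Q(1)] at_least_mono[OF Q(1) at[OF aK(2)]]) auto
    then have "at_least Q (Q b + 1) (y - b)"
      using e(1) place_const[OF Q(1) aK(2)] by (auto simp: at_least_def)
    then have "Q y = 0"
      using dominant_summand[OF Q(1) False, of "y - b"] place_const[OF Q(1) aK(2)] by simp
    then show ?thesis
      using main X e(1) by simp
  qed
  then show ?thesis
    using e by (simp add: algebra_simps)
qed

lemma aff_pole:
  assumes P: "place K P" "has_value_at P x a" "has_value_at P y b"
  shows "P (aff_u a b) < 0"
proof -
  interpret hermitian_coordinates K q "aff_u a b" "1 / aff_t a b" "- 1"
    by (rule aff_hermitian)
  have aK: "a \<in> K" "b \<in> K"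
    using ab F_q2D by auto
  have pos: "P (x - a) > 0" "P (y - b) > 0"
    using P x_notin_K y_notin_K aK by (auto simp: has_value_at_def)
  have const: "at_least P 1 (c * f)" if "c \<in> K" "P f > 0" for c f
    using that place_const[OF P(1)] place_0[OF P(1)]
    by (cases "c = 0 \<or> f = 0") (auto simp: at_least_def place_mult[OF P(1)])
  have "aff_t a b = a ^ q * (x - a) - b ^ q * (y - b)"
    using ab(3) by (simp add: aff_t_def algebra_simps)
  moreover have "at_least P 1 (a ^ q * (x - a) - b ^ q * (y - b))"
    using pos aK by (intro at_least_diff[OF P(1)] const subringD(7)[OF KR])
  ultimately have "P (aff_t a b) > 0"
    using aff_t_nonzero by (simp add: at_least_def)
  then have "P (1 / aff_t a b) < 0"
    using aff_t_nonzero by (simp add: place_divide[OF P(1)] place_1[OF P(1)])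
  then show ?thesis
    by (rule pole_u_if_pole_w[OF P(1)])
qed

lemma aff_adapted:
  assumes P: "place K P" "P (aff_u a b) < 0"
  shows "adapted_coordinates K q (aff_u a b) (1 / aff_t a b) (- 1) m z 1 P"
proof -
  interpret hermitian_coordinates K q "aff_u a b" "1 / aff_t a b" "- 1"
    by (rule aff_hermitian)
  show ?thesis
  proof
    show "ring_adjoin (adjoin2 K (aff_u a b) (1 / aff_t a b)) z = UNIV"
      "z ^ m \<in> adjoin2 K (aff_u a b) (1 / aff_t a b)"
      unfolding aff_adjoin2 using H_z_UNIV zm_H by auto
    show "card {c\<in>K. c ^ m = 1} = m"
      by (rule card_unity_roots[OF order_divisors(2) m_pos])
  qed (use m_pos frobenius card_kernel z_nonzero P aff_z_value in auto)
qed

end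

text \<open>The tangent at the ideal point \<open>(1 : a : 0)\<close>.  Here the line at infinity is the other line through
  the point, so \<open>u\<close> is \<open>1 / t\<close>.\<close>

definition ide_t where "ide_t a = x - a ^ q * y"

context
  fixes a assumes a: "a \<in> F_q2 K q" "a ^ (q + 1) = 1"
begin

lemma ide_norm: "a ^ q * a = 1" "a \<noteq> 0"
  using a(2) by (auto simp: mult.commute)

lemma ide_y: "y = a * (x - ide_t a)"
  using ide_norm(1) by (simp add: ide_t_def mult.commute mult.left_commute)

lemma ide_t_factor: "ide_t a = - (a ^ q * x * (y / x - a))"
proof -
  have "a ^ q * x * (y / x - a) = a ^ q * y - (a ^ q * a) * x"
    using nonzero by (simp add: algebra_simps)
  then show ?thesis
    using ide_norm(1) by (simp add: ide_t_def)
qed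

lemma ide_eq: "x ^ q * ide_t a + x * ide_t a ^ q = ide_t a ^ q * ide_t a + 1"
proof -
  define A X Y where "A = a ^ q" "X = x ^ q" "Y = y ^ q"
  have t: "ide_t a ^ q = X - a * Y"
    using F_q2D(2)[OF a(1)] by (simp add: ide_t_def frobenius_diff power_mult_distrib A_X_Y_def)
  have "X * (x - A * y) + x * (X - a * Y) - (X - a * Y) * (x - A * y) = X * x - (A * a) * (Y * y)"
    by (simp add: algebra_simps)
  also have "\<dots> = 1"
    using ide_norm(1) xy by (simp add: A_X_Y_def)
  finally have "X * (x - A * y) + x * (X - a * Y) = (X - a * Y) * (x - A * y) + 1"
    by (simp add: algebra_simps)
  then show ?thesis
    unfolding t by (simp add: ide_t_def A_X_Y_def)
qed

lemma ide_t_nonzero: "ide_t a \<noteq> 0"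
  using ide_eq q2 by (auto simp: zero_power)

lemma ide_hermitian: "hermitian_coordinates K q (1 / ide_t a) (x / ide_t a) 1"
proof
  show "subfield_of_type K" "q \<ge> 2" "1 \<in> K"
    using subfield_K q2 subringD[OF KR] by auto
  have "(x / ide_t a) ^ q + x / ide_t a = (x ^ q * ide_t a + x * ide_t a ^ q) / (ide_t a ^ q * ide_t a)"
    using ide_t_nonzero by (simp add: power_divide add_divide_distrib)
  also have "\<dots> = (1 / ide_t a) ^ (q + 1) + 1"
    unfolding ide_eq using ide_t_nonzero by (simp add: power_divide add_divide_distrib mult.commute)
  finally show "(x / ide_t a) ^ q + x / ide_t a = (1 / ide_t a) ^ (q + 1) + 1" .
qed

lemma ide_in_H: "ide_t a \<in> H"
proof -
  have "a \<in> H"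
    using a F_q2D(1) H_mem(1) by auto
  then show ?thesis
    unfolding ide_t_def using H_mem
    by (auto intro!: subringD(6)[OF HR] subringD(4)[OF HR] subringD(7)[OF HR])
qed

lemma ide_adjoin2: "adjoin2 K (1 / ide_t a) (x / ide_t a) = H"
proof (rule adjoin2_eq_H[OF ide_hermitian])
  interpret hermitian_coordinates K q "1 / ide_t a" "x / ide_t a" 1
    by (rule ide_hermitian)
  show "1 / ide_t a \<in> H" "x / ide_t a \<in> H"
    using ide_in_H H_mem subringD(2)[OF HR] by (auto intro: subfieldD(2)[OF subfield_H])
  have "1 / ide_t a \<in> E"
    using in_A(2) A_sub_L L_sub_E by blast
  then have "inverse (1 / ide_t a) \<in> E"
    by (rule subfieldD(1)[OF E_subfield])
  then have t: "ide_t a \<in> E"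
    by simp
  have "x = ide_t a * (x / ide_t a)"
    using ide_t_nonzero by simp
  then show x: "x \<in> E"
    using subringD(4)[OF ER t w_E] by metis
  have aE: "a \<in> E"
    using F_q2D(1) a in_A(1) A_sub_L L_sub_E by blast
  have "a * (x - ide_t a) \<in> E"
    using t x aE by (intro subringD(4)[OF ER] subringD(6)[OF ER])
  then show "y \<in> E"
    using ide_y by metis
qed

lemma ide_xy_value:
  assumes Q: "place K Q" "Q (1 / ide_t a) < 0"
  shows "Q x = Q (x / ide_t a) - Q (1 / ide_t a)" "Q y = Q x" "Q x < 0"
proof -
  interpret hermitian_coordinates K q "1 / ide_t a" "x / ide_t a" 1
    by (rule ide_hermitian)
  show 1: "Q x = Q (x / ide_t a) - Q (1 / ide_t a)"
    using ide_t_nonzero nonzero by (simp add: place_divide[OF Q(1)] place_1[OF Q(1)])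
  show 2: "Q x < 0"
    using 1 pole_values(1)[OF Q] by (simp add: scale_def)
  have "Q (ide_t a) > 0"
    using Q(2) ide_t_nonzero by (simp add: place_divide[OF Q(1)] place_1[OF Q(1)])
  then have "at_least Q (Q x + 1) (- ide_t a)"
    using 2 by (simp add: at_least_def place_minus[OF Q(1)])
  then have "x + (- ide_t a) \<noteq> 0 \<and> Q (x + (- ide_t a)) = Q x"
    by (rule dominant_summand[OF Q(1) nonzero(1)])
  then show "Q y = Q x"
    using ide_norm(2) place_const[OF Q(1)] a F_q2D(1) by (subst ide_y) (simp add: place_mult[OF Q(1)])
qed

text \<open>On the Hermitian curve, \<open>x\<close> and \<open>y\<close> have simple poles at the ideal points; now use
  \<open>z ^ m * y ^ q = x ^ q\<^sup>2 - x\<close>.\<close>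

lemma ide_z_value:
  assumes Q: "place K Q" "Q (1 / ide_t a) < 0"
  shows "int m * Q z = - int d * (Q (1 / ide_t a) - Q (x / ide_t a))"
proof -
  note v = ide_xy_value[OF Q]
  have "int 1 < int (q\<^sup>2)"
    unfolding of_nat_less_iff using q2_minus_1_pos by linarith
  then have "int (q\<^sup>2) * Q x < int 1 * Q x"
    using v(3) by (rule mult_strict_right_mono_neg)
  then have "at_least Q (Q (x ^ q\<^sup>2) + 1) (- x)"
    by (simp add: at_least_def place_power[OF Q(1)] place_minus[OF Q(1)] del: of_nat_power)
  then have "Q (x ^ q\<^sup>2 + (- x)) = int (q\<^sup>2) * Q x"
    using dominant_summand[OF Q(1), of "x ^ q\<^sup>2" "- x"] nonzero(1) place_power[OF Q(1)] by auto
  then have "int m * Q z + int q * Q y = int (q\<^sup>2) * Q x"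
    using z_nonzero nonzero z_eq
    by (metis place_mult[OF Q(1)] place_power[OF Q(1)] power_not_zero diff_conv_add_uminus)
  then show ?thesis
    using v(1,2) by (simp add: d_le algebra_simps)
qed

text \<open>As \<open>y / x\<close> takes the value \<open>a\<close>, the order of \<open>t = x (1 - a\<^sup>q y / x)\<close> exceeds that of \<open>x\<close>; hence
  \<open>w = x / t\<close> has a pole, and with it \<open>u\<close>.\<close>

lemma ide_pole:
  assumes P: "place K P" "has_value_at P (y / x) a" "has_value_at P (1 / x) 0"
  shows "P (1 / ide_t a) < 0"
proof -
  interpret hermitian_coordinates K q "1 / ide_t a" "x / ide_t a" 1
    by (rule ide_hermitian)
  have "P (1 / x) > 0"
    using P(3) nonzero by (simp add: has_value_at_def)
  have ne: "y / x - a \<noteq> 0"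
    using ide_t_nonzero ide_t_factor by auto
  then have "P (y / x - a) > 0"
    using P(2) by (simp add: has_value_at_def)
  moreover have "P (ide_t a) = P x + P (y / x - a)"
    unfolding ide_t_factor using ne ide_norm(2) nonzero place_const[OF P(1)] a(1) F_q2D(1)
    by (simp add: place_minus[OF P(1)] place_mult[OF P(1)] place_power[OF P(1)])
  ultimately have "P (x / ide_t a) < 0"
    using ide_t_nonzero nonzero by (simp add: place_divide[OF P(1)])
  then show ?thesis
    by (rule pole_u_if_pole_w[OF P(1)])
qed

lemma ide_adapted:
  assumes P: "place K P" "P (1 / ide_t a) < 0"
  shows "adapted_coordinates K q (1 / ide_t a) (x / ide_t a) 1 m z (- int d) P"
proof -
  interpret hermitian_coordinates K q "1 / ide_t a" "x / ide_t a" 1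
    by (rule ide_hermitian)
  show ?thesis
  proof
    show "ring_adjoin (adjoin2 K (1 / ide_t a) (x / ide_t a)) z = UNIV"
      "z ^ m \<in> adjoin2 K (1 / ide_t a) (x / ide_t a)"
      unfolding ide_adjoin2 using H_z_UNIV zm_H by auto
    show "card {c\<in>K. c ^ m = 1} = m"
      by (rule card_unity_roots[OF order_divisors(2) m_pos])
    have "coprime (int d) (int d * int s + 1)"
    proof (rule coprimeI)
      fix c assume "c dvd int d" "c dvd int d * int s + 1"
      then show "is_unit c"
        using dvd_add_right_iff[of c "int d * int s" 1] by simp
    qed
    then show "coprime (- int d) (int m)"
      by (simp add: m_eq mult.commute add.commute)
  qed (use m_pos frobenius card_kernel z_nonzero P ide_z_value in auto)
qed

end

end

section \<open>Numerical semigroups\<close>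

lemma submonoid_gen_add:
  "k \<in> submonoid_gen A \<Longrightarrow> l \<in> submonoid_gen A \<Longrightarrow> k + l \<in> submonoid_gen A"
  by (induction k rule: submonoid_gen.induct) (auto intro: submonoid_gen.intros simp: add.assoc)

lemma submonoid_gen_mult: "a \<in> A \<Longrightarrow> c * a \<in> submonoid_gen A"
  by (induction c) (auto intro: submonoid_gen.intros)

lemma submonoid_gen_least:
  assumes "0 \<in> S" "\<And>k l. k \<in> S \<Longrightarrow> l \<in> S \<Longrightarrow> k + l \<in> S" "A \<subseteq> S"
  shows "submonoid_gen A \<subseteq> S"
proof
  fix k assume "k \<in> submonoid_gen A"
  then show "k \<in> S"
    by induction (use assms in auto)
qed

text \<open>Any \<open>j \<le> c s\<close> is a sum of \<open>c\<close> numbers that are at most \<open>s\<close>.\<close>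

lemma submonoid_gen_progression:
  assumes gen: "\<And>i. i \<le> s \<Longrightarrow> \<exists>a\<in>A. int a = \<alpha> + int i * \<beta>" and j: "j \<le> c * s"
  shows "\<exists>b\<in>submonoid_gen A. int b = int c * \<alpha> + int j * \<beta>"
  using j
proof (induction c arbitrary: j)
  case 0
  then show ?case by (auto intro: submonoid_gen.zero)
next
  case (Suc c)
  define i where "i = min j s"
  have "j - i \<le> c * s"
    using Suc.prems by (auto simp: i_def min_def)
  then obtain b where b: "b \<in> submonoid_gen A" "int b = int c * \<alpha> + int (j - i) * \<beta>"
    using Suc.IH by blast
  obtain a where a: "a \<in> A" "int a = \<alpha> + int i * \<beta>"
    using gen[of i] by (auto simp: i_def)
  have "int (j - i) = int j - int i"
    by (simp add: i_def of_nat_diff)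
  then have "int (a + b) = int (Suc c) * \<alpha> + int j * \<beta>"
    using a b by (simp add: algebra_simps)
  then show ?case
    using submonoid_gen.add[OF a(1) b(1)] by blast
qed

lemma weierstrass_semigroupI:
  assumes P: "place K P" and f: "f \<noteq> 0" "P f = - int k" "\<And>Q. place K Q \<Longrightarrow> Q \<noteq> P \<Longrightarrow> 0 \<le> Q f"
  shows "k \<in> weierstrass_semigroup K P"
  unfolding weierstrass_semigroup_def pole_order_def using f by (intro CollectI exI[of _ f]) auto

lemma weierstrass_semigroup_submonoid:
  assumes P: "place K P" and A: "A \<subseteq> weierstrass_semigroup K P"
  shows "submonoid_gen A \<subseteq> weierstrass_semigroup K P"
proof (rule submonoid_gen_least[OF _ _ A])
  show "0 \<in> weierstrass_semigroup K P"
    by (rule weierstrass_semigroupI[OF P, of 1]) (auto simp: place_1[OF P] dest: place_1)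
  fix k l assume "k \<in> weierstrass_semigroup K P" "l \<in> weierstrass_semigroup K P"
  then obtain f g where f: "f \<noteq> 0" "\<And>Q. place K Q \<Longrightarrow> pole_order Q f = (if Q = P then k else 0)"
    and g: "g \<noteq> 0" "\<And>Q. place K Q \<Longrightarrow> pole_order Q g = (if Q = P then l else 0)"
    unfolding weierstrass_semigroup_def by blast
  have reg: "0 \<le> Q f" "0 \<le> Q g" if "place K Q" "Q \<noteq> P" for Q
    using f(2)[OF that(1)] g(2)[OF that(1)] that(2) by (simp_all add: pole_order_def)
  have nonneg: "pole_order P h = 0 \<or> P h = - int (pole_order P h)" for h
    by (auto simp: pole_order_def)
  show "k + l \<in> weierstrass_semigroup K P"
  proof (cases "k = 0 \<or> l = 0")
    case True
    then show ?thesis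
      using \<open>k \<in> weierstrass_semigroup K P\<close> \<open>l \<in> weierstrass_semigroup K P\<close> by auto
  next
    case False
    then have "P f = - int k" "P g = - int l"
      using f(2)[OF P] g(2)[OF P] nonneg[of f] nonneg[of g] by auto
    then show ?thesis
      using f(1) g(1) reg
      by (intro weierstrass_semigroupI[OF P, of "f * g"]) (auto simp: place_mult[OF P] place_mult)
  qed
qed

section \<open>The Weierstrass semigroups at the rational points\<close>

context gk_curve
begin

lemma ideal_adapted:
  assumes "P \<in> gk_ideal_points K q x y"
  obtains a where "a \<in> F_q2 K q" "a ^ (q + 1) = 1" "place K P" "has_value_at P (y / x) a"
    "P (1 / ide_t a) < 0"
  using assms ide_pole by (auto simp: gk_ideal_points_def)

lemma affine_adapted:
  assumes "P \<in> gk_affine_points K q x y"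
  obtains a b where "a \<in> F_q2 K q" "b \<in> F_q2 K q" "a ^ q * a - b ^ q * b = 1" "place K P"
    "P (aff_u a b) < 0"
proof -
  obtain a b where *: "place K P" "a \<in> F_q2 K q" "b \<in> F_q2 K q" "b ^ (q + 1) = a ^ (q + 1) - 1"
    "has_value_at P x a" "has_value_at P y b"
    using assms by (auto simp: gk_affine_points_def)
  then have "a ^ q * a - b ^ q * b = 1"
    by (simp add: mult.commute)
  then show thesis
    using that * aff_pole by blast
qed

lemma ideal_values:
  assumes "Q \<in> gk_ideal_points K q x y"
  shows "place K Q" "Q z = - int d" "Q x = - int m" "Q y = - int m" "\<forall>g\<in>H. int m dvd Q g"
proof -
  obtain a where a: "a \<in> F_q2 K q" "a ^ (q + 1) = 1" and Q: "place K Q" "Q (1 / ide_t a) < 0"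
    using ideal_adapted[OF assms] by metis
  interpret adapted_coordinates K q "1 / ide_t a" "x / ide_t a" 1 m z "- int d" Q
    by (rule ide_adapted[OF a Q])
  note v = normalized_values[OF Q]
  show "place K Q" by (rule Q)
  show "Q z = - int d" by (rule v(3))
  show x: "Q x = - int m"
    using ide_xy_value(1)[OF a Q] v(1,2) by (simp add: algebra_simps)
  then show "Q y = - int m"
    using ide_xy_value(2)[OF a Q] by simp
  show "\<forall>g\<in>H. int m dvd Q g"
    using v(4) unfolding ide_adjoin2[OF a] by blast
qed

lemma affine_values:
  assumes "Q \<in> gk_affine_points K q x y"
  shows "place K Q" "Q z = 1" "\<forall>g\<in>H. int m dvd Q g"
proof -
  obtain a b where ab: "a \<in> F_q2 K q" "b \<in> F_q2 K q" "a ^ q * a - b ^ q * b = 1"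
    and Q: "place K Q" "Q (aff_u a b) < 0"
    using affine_adapted[OF assms] by metis
  interpret adapted_coordinates K q "aff_u a b" "1 / aff_t a b" "- 1" m z 1 Q
    by (rule aff_adapted[OF ab Q])
  note v = normalized_values[OF Q]
  show "place K Q" by (rule Q)
  show "Q z = 1" by (rule v(3))
  show "\<forall>g\<in>H. int m dvd Q g"
    using v(4) unfolding aff_adjoin2[OF ab] by blast
qed

text \<open>At a pole of \<open>x\<close> the function \<open>(y / x)\<^sup>q\<^sup>+\<^sup>1 - 1 = - 1 / x\<^sup>q\<^sup>+\<^sup>1\<close> vanishes, so \<open>y / x\<close> takes a root of unity as
  its value.\<close>

lemma pole_of_x_ideal:
  assumes Q: "place K Q" "Q x < 0"
  shows "Q \<in> gk_ideal_points K q x y"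
proof -
  have yx: "y / x \<notin> K"
  proof
    assume "y / x \<in> K"
    define c where "c = y / x"
    have y: "y = c * x"
      using nonzero by (simp add: c_def)
    have "c ^ (q + 1) * x ^ (q + 1) = x ^ (q + 1) - 1"
      using hermitian_eq unfolding y power_mult_distrib .
    then have c: "c \<in> K" "x ^ (q + 1) * (1 - c ^ (q + 1)) = 1"
      using \<open>y / x \<in> K\<close> by (simp_all add: c_def right_diff_distrib mult.commute del: power_Suc)
    then have "x ^ (q + 1) = inverse (1 - c ^ (q + 1))"
      by (metis inverse_unique mult.commute)
    moreover have "inverse (1 - c ^ (q + 1)) \<in> K"
      using c by (intro subfieldD(1)[OF subfield_K] subringD(2,6,7)[OF KR])
    ultimately show False
      using x_power_not_const[of "q + 1"] by auto
  qed
  have "(y / x) ^ (q + 1) - 1 = - (1 / x ^ (q + 1))"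
    unfolding power_divide hermitian_eq using nonzero by (simp add: diff_divide_distrib)
  then have "Q ((y / x) ^ (q + 1) - 1) = - (int (q + 1) * Q x)"
    using nonzero by (simp only: place_minus[OF Q(1)] place_divide[OF Q(1)] place_1[OF Q(1)]
        place_power[OF Q(1)] power_not_zero one_neq_zero simp_thms diff_0 not_False_eq_True)
  then have "0 < Q ((y / x) ^ (q + 1) - 1)"
    using Q(2) by (simp add: mult_pos_neg)
  then have pos: "0 < Q (\<Prod>c\<in>{c\<in>K. c ^ (q + 1) = 1}. y / x - c)"
    using prod_unity_roots[OF order_divisors(1), of "y / x"] by simp
  have "\<exists>c\<in>{c\<in>K. c ^ (q + 1) = 1}. 0 < Q (y / x - c)"
    using finite_K yx by (intro place_prod_pos[OF Q(1) _ _ pos]) auto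
  then obtain c where c: "c \<in> K" "c ^ (q + 1) = 1" "0 < Q (y / x - c)" by blast
  have "c \<in> F_q2 K q"
    by (rule unity_root_in_F_q2[OF c(1,2)])
  moreover have "Q (1 / x) > 0"
    using Q nonzero by (simp add: place_divide[OF Q(1)] place_1[OF Q(1)])
  ultimately show ?thesis
    using Q(1) c by (auto simp: gk_ideal_points_def has_value_at_def)
qed

lemma regular_y:
  assumes Q: "place K Q" "0 \<le> Q x"
  shows "0 \<le> Q y"
proof -
  have "x ^ (q + 1) - 1 \<in> {f. 0 \<le> Q f}"
    using Q(2) by (intro subringD(2,6,7)[OF subring_regular[OF Q(1)]]) auto
  then have "0 \<le> int (q + 1) * Q y"
    using place_power[OF Q(1), of y "q + 1"] hermitian_eq by simp
  then show ?thesis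
    by (simp add: zero_le_mult_iff)
qed

text \<open>If \<open>y\<close> vanishes at \<open>Q\<close>, so does \<open>x\<^sup>q\<^sup>+\<^sup>1 - 1\<close>.  Otherwise \<open>x ^ q\<^sup>2 - x\<close> vanishes, and so does
  \<open>y ^ q\<^sup>2 - y\<close> by the identity \<open>y\<^sup>q (y ^ q\<^sup>2 - y) = x\<^sup>q (x ^ q\<^sup>2 - x)\<close>.  In both cases \<open>x\<close> and \<open>y\<close> take values
  in the field with \<open>q\<^sup>2\<close> elements, and these satisfy the equation of the curve because a constant that
  vanishes at a place is \<open>0\<close>.\<close>

lemma zero_of_z_affine:
  assumes Q: "place K Q" "0 \<le> Q x" and z: "Q z \<noteq> 0"
  shows "Q \<in> gk_affine_points K q x y"
proof -
  note R = subring_regular[OF Q(1)]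
  note Qy = regular_y[OF Q]
  have reg: "0 \<le> Q (f ^ k)" if "0 \<le> Q f" for f k
    using that by (simp add: place_power[OF Q(1)])
  have zv: "int m * Q z + int q * Q y = Q (x ^ q\<^sup>2 - x)"
    using z_nonzero nonzero
    by (simp add: place_mult[OF Q(1)] place_power[OF Q(1)] flip: z_eq)
  have y_eq: "y ^ q * (y ^ q\<^sup>2 - y) = x ^ q * (x ^ q\<^sup>2 - x)"
  proof -
    have "(y ^ q * y) ^ q = (x ^ q * x - 1) ^ q"
      using xy by (simp add: algebra_simps)
    then have 1: "(y ^ q) ^ q * y ^ q = (x ^ q) ^ q * x ^ q - 1"
      by (simp add: power_mult_distrib frobenius_diff)
    have 2: "y ^ q * y = x ^ q * x - 1"
      using xy by (simp add: algebra_simps)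
    have "y ^ q * ((y ^ q) ^ q - y) = (y ^ q) ^ q * y ^ q - y ^ q * y"
      by (simp add: right_diff_distrib mult.commute)
    also have "\<dots> = x ^ q * ((x ^ q) ^ q - x)"
      unfolding 1 2 by (simp add: right_diff_distrib mult.commute)
    finally show ?thesis
      by (simp only: power_q2)
  qed
  have x1: "0 \<le> Q (x ^ q\<^sup>2 - x)"
    using subringD(6)[OF R, of "x ^ q\<^sup>2" x] reg[OF Q(2), of "q\<^sup>2"] Q(2) by simp
  have pos: "(\<exists>a\<in>F_q2 K q. 0 < Q (x - a)) \<and> (0 < Q y \<or> 0 < Q (y ^ q\<^sup>2 - y))"
  proof (cases "Q y = 0")
    case True
    have "int m * Q z \<noteq> 0"
      using z m_pos by simp
    then have "0 < Q (x ^ q\<^sup>2 - x)"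
      using zv x1 unfolding True by linarith
    moreover from this have "0 < Q (y ^ q * (y ^ q\<^sup>2 - y))"
      unfolding y_eq using nonzero(1) x_q2_nonzero Q(2)
      by (simp add: place_mult[OF Q(1)] place_power[OF Q(1)] add_nonneg_pos)
    then have "y ^ q * (y ^ q\<^sup>2 - y) \<noteq> 0"
      by (metis place_0[OF Q(1)] less_irrefl)
    then have "Q (y ^ q * (y ^ q\<^sup>2 - y)) = int q * Q y + Q (y ^ q\<^sup>2 - y)"
      by (simp add: place_mult[OF Q(1)] place_power[OF Q(1)])
    ultimately show ?thesis
      using zero_in_F_q2[OF Q(1) x_notin_K] True \<open>0 < Q (y ^ q * (y ^ q\<^sup>2 - y))\<close> by simp
  next
    case False
    then have y: "0 < Q y" using Qy by simp
    have "0 < Q (x ^ (q + 1) - 1)"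
    proof -
      have "0 < int (q + 1) * Q y"
        using y by simp
      then show ?thesis
        using place_power[OF Q(1), of y "q + 1"] unfolding hermitian_eq by simp
    qed
    then have "0 < Q (\<Prod>c\<in>{c\<in>K. c ^ (q + 1) = 1}. x - c)"
      using prod_unity_roots[OF order_divisors(1), of x] by simp
    then have "\<exists>c\<in>{c\<in>K. c ^ (q + 1) = 1}. 0 < Q (x - c)"
      using finite_K x_notin_K by (intro place_prod_pos[OF Q(1)]) auto
    then obtain c where c: "c \<in> K" "c ^ (q + 1) = 1" "0 < Q (x - c)" by blast
    have "c \<in> F_q2 K q"
      by (rule unity_root_in_F_q2[OF c(1,2)])
    then show ?thesis
      using c(3) y by blast
  qed
  obtain a where a: "a \<in> F_q2 K q" "0 < Q (x - a)"
    using pos by blast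
  obtain b where b: "b \<in> F_q2 K q" "0 < Q (y - b)"
  proof -
    have "0 \<in> F_q2 K q"
      using subringD(1)[OF KR] q2 by (auto simp: F_q2_def)
    then show thesis
      using pos zero_in_F_q2[OF Q(1) y_notin_K] that by (metis diff_zero)
  qed
  have aK: "a \<in> K" "b \<in> K"
    using a b F_q2D by auto
  define M where "M = {f. at_least Q 1 f}"
  have M_mult: "f * g \<in> M" if "f \<in> M" "0 \<le> Q g" for f g
    using at_least_mult[OF Q(1), of 1 f 0 g] that by (simp add: M_def at_least_0[OF Q(1)])
  have pow: "f ^ k - c ^ k \<in> M" if "0 < Q (f - c)" "0 \<le> Q f" "c \<in> K" for f c k
  proof -
    have "f ^ k - c ^ k = (f - c) * (\<Sum>i<k. c ^ (k - Suc i) * f ^ i)"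
      by (rule power_diff_sumr2)
    moreover have "(\<Sum>i<k. c ^ (k - Suc i) * f ^ i) \<in> {f. 0 \<le> Q f}"
      using that place_const[OF Q(1)] by (intro subring_sum[OF R] subringD(4,7)[OF R]) auto
    moreover have "f - c \<in> M"
      using that by (simp add: M_def at_least_def)
    ultimately show ?thesis
      using M_mult by auto
  qed
  define c where "c = b ^ (q + 1) - (a ^ (q + 1) - 1)"
  have "c = (x ^ (q + 1) - a ^ (q + 1)) - (y ^ (q + 1) - b ^ (q + 1))"
    unfolding hermitian_eq c_def by simp
  moreover have "(x ^ (q + 1) - a ^ (q + 1)) - (y ^ (q + 1) - b ^ (q + 1)) \<in> M"
    using pow[OF a(2) Q(2) aK(1), of "q + 1"] pow[OF b(2) Qy aK(2), of "q + 1"]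
    by (simp add: M_def at_least_diff[OF Q(1)] del: power_Suc)
  ultimately have "at_least Q 1 c"
    by (simp add: M_def)
  moreover have "c \<in> K"
    unfolding c_def using aK by (intro subringD(2,6,7)[OF KR])
  ultimately have "c = 0"
    using place_const[OF Q(1)] by (auto simp: at_least_def)
  then have "b ^ (q + 1) = a ^ (q + 1) - 1"
    by (simp add: c_def)
  then show ?thesis
    using Q(1) a b by (auto simp: gk_affine_points_def has_value_at_def)
qed

lemma place_cases:
  assumes Q: "place K Q"
  obtains (general) "Q z = 0" "0 \<le> Q x" "0 \<le> Q y"
    | (affine) "Q \<in> gk_affine_points K q x y" "Q z = 1" "0 \<le> Q x" "0 \<le> Q y" "\<forall>g\<in>H. int m dvd Q g"
    | (ideal) "Q \<in> gk_ideal_points K q x y" "Q z = - int d" "Q x = - int m" "Q y = - int m"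
       "\<forall>g\<in>H. int m dvd Q g"
proof (cases "Q x < 0")
  case True
  then show thesis
    using ideal ideal_values[OF pole_of_x_ideal[OF Q True]] pole_of_x_ideal[OF Q True] by blast
next
  case False
  then have Qx: "0 \<le> Q x" by simp
  show thesis
  proof (cases "Q z = 0")
    case True
    then show thesis
      using general Qx regular_y[OF Q Qx] by blast
  next
    case False
    note Qa = zero_of_z_affine[OF Q Qx False]
    show thesis
      using affine Qx regular_y[OF Q Qx] affine_values[OF Qa] Qa by blast
  qed
qed

lemma linear_value:
  assumes Q: "place K Q" and f: "f = \<alpha> * x + \<beta> * y + \<gamma>" "\<alpha> \<in> K" "\<beta> \<in> K" "\<gamma> \<in> K"
  shows "0 \<le> Q x \<Longrightarrow> 0 \<le> Q y \<Longrightarrow> 0 \<le> Q f"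
    and "Q x = - int m \<Longrightarrow> Q y = - int m \<Longrightarrow> - int m \<le> Q f"
proof -
  have 0: "at_least Q 0 c" if "c \<in> K" for c
    using that place_const[OF Q] by (simp add: at_least_0[OF Q])
  have *: "at_least Q k f" if "at_least Q k x" "at_least Q k y" "k \<le> 0" for k
    unfolding f(1) using that 0[OF f(4)] at_least_mult[OF Q 0[OF f(2)] that(1)]
      at_least_mult[OF Q 0[OF f(3)] that(2)]
    by (intro at_least_add[OF Q]) (auto intro: at_least_mono[OF Q])
  show "0 \<le> Q f" if "0 \<le> Q x" "0 \<le> Q y"
    using *[of 0] that by (simp add: at_least_0[OF Q])
  show "- int m \<le> Q f" if "Q x = - int m" "Q y = - int m"
    using *[of "- int m"] that place_0[OF Q] by (auto simp: at_least_def)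
qed

lemma m_mult': "m * (q + 1) = q ^ n + 1" "m * q = q ^ n + 1 - m"
  using m_mult by (auto simp: algebra_simps)

lemma d_times_s: "k \<le> s \<Longrightarrow> k * d < m"
  using m_eq mult_le_mono1[of k s d] by linarith

lemma value_times_z_power:
  assumes "place K Q" "g \<noteq> 0"
  shows "Q (g * z ^ i) = Q g + int i * Q z"
  using z_nonzero assms(2) by (simp add: place_mult[OF assms(1)] place_power[OF assms(1)])

text \<open>The generators are the pole orders of \<open>u z\<^sup>i\<close> and of \<open>w\<close>.  At the other ideal points \<open>z\<^sup>i\<close> has a pole of
  order \<open>i d < m\<close>, which the zero of order \<open>m\<close> of \<open>u = 1 / t\<close> compensates.\<close>

theorem weierstrass_semigroup_ideal:
  assumes P: "P \<in> gk_ideal_points K q x y"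
  shows "weierstrass_semigroup K P = submonoid_gen ({m * q + i * d | i. i \<le> s} \<union> {q ^ n + 1})"
    (is "_ = submonoid_gen ?A")
proof
  obtain a where a: "a \<in> F_q2 K q" "a ^ (q + 1) = 1" and pP: "place K P" "P (1 / ide_t a) < 0"
    using ideal_adapted[OF P] by metis
  interpret adapted_coordinates K q "1 / ide_t a" "x / ide_t a" 1 m z "- int d" P
    by (rule ide_adapted[OF a pP])
  note v = normalized_values[OF pP]
  note t0 = ide_t_nonzero[OF a]
  have Pt: "P (ide_t a) = int (q * m)"
    using v(1) t0 by (simp add: place_divide[OF pP(1)] place_1[OF pP(1)])
  have t_lin: "ide_t a = 1 * x + (- (a ^ q)) * y + 0"
    by (simp add: ide_t_def)
  have linK: "1 \<in> K" "- (a ^ q) \<in> K" "0 \<in> K"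
    using a F_q2D(1) by (auto intro: subringD[OF KR])
  have others: "Q z = 0 \<and> 0 \<le> Q (ide_t a) \<or>
       Q z = 1 \<and> 0 \<le> Q (ide_t a) \<and> (\<forall>g\<in>E. int m dvd Q g) \<or>
       Q z = - int d \<and> - int m \<le> Q (ide_t a) \<and> (\<forall>g\<in>E. int m dvd Q g)"
    if Q: "place K Q" for Q
    using linear_value[OF Q t_lin linK] unfolding ide_adjoin2[OF a]
    by (cases rule: place_cases[OF Q]) auto
  show "weierstrass_semigroup K P \<subseteq> submonoid_gen ?A"
  proof
    fix k assume "k \<in> weierstrass_semigroup K P"
    then obtain f where f: "f \<noteq> 0" "\<And>Q. place K Q \<Longrightarrow> pole_order Q f = (if Q = P then k else 0)"
      unfolding weierstrass_semigroup_def by blast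
    have "f \<in> regular"
      unfolding regular_iff using f(2) by (force simp: pole_order_def)
    then obtain e i j c where *: "j \<le> c * s"
      "P f = - int (m * (q * e + (q + 1) * i)) - int c * P (ide_t a) + int j * (- int d)"
      using pole_value_decomposition[OF _ t0 s_pos m_eq others] f(1) ide_in_H[OF a]
      unfolding ide_adjoin2[OF a] by metis
    obtain b where b: "b \<in> submonoid_gen ?A" "int b = int c * int (m * q) + int j * int d"
      using submonoid_gen_progression[of s ?A "int (m * q)" "int d" j c] *(1) by fastforce
    have "e * (m * q) \<in> submonoid_gen ?A" "i * (q ^ n + 1) \<in> submonoid_gen ?A"
      by (rule submonoid_gen_mult; force)+
    then have mem: "e * (m * q) + i * (q ^ n + 1) + b \<in> submonoid_gen ?A"
      using b by (intro submonoid_gen_add)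
    have "P f = - int (e * (m * q) + i * (q ^ n + 1) + b)"
      unfolding *(2) Pt m_mult'(1)[symmetric] of_nat_add b(2) by (simp add: algebra_simps)
    then have "pole_order P f = e * (m * q) + i * (q ^ n + 1) + b"
      by (simp only: pole_order_def minus_minus nat_int)
    then have "k = e * (m * q) + i * (q ^ n + 1) + b"
      using f(2)[OF pP(1)] by simp
    then show "k \<in> submonoid_gen ?A"
      using mem by simp
  qed
  have u: "1 / ide_t a \<in> regular"
    using A_regular in_A(2) by blast
  \<comment> \<open>At another ideal point \<open>y / x\<close> takes a value different from \<open>a\<close>, so \<open>t\<close> has a pole of the same
    order as \<open>x\<close>.\<close>
  have u_ideal: "int m \<le> Q (1 / ide_t a)" if Q: "Q \<in> gk_ideal_points K q x y" "Q \<noteq> P" for Q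
  proof -
    obtain a' where a': "a' \<in> F_q2 K q" "a' ^ (q + 1) = 1" "place K Q" "has_value_at Q (y / x) a'"
      "Q (1 / ide_t a') < 0"
      using ideal_adapted[OF Q(1)] by metis
    have ne: "a' \<noteq> a"
      using a'(3,5) unique_pole Q(2) by auto
    have aK: "a' - a \<in> K" "a \<in> K"
      using a a' F_q2D(1) by (auto intro: subringD[OF KR])
    have "at_least Q (Q (a' - a) + 1) (y / x - a')"
      using a'(4) place_const[OF a'(3) aK(1)] by (auto simp: at_least_def has_value_at_def)
    then have "(a' - a) + (y / x - a') \<noteq> 0 \<and> Q ((a' - a) + (y / x - a')) = Q (a' - a)"
      using ne by (intro dominant_summand[OF a'(3)]) simp_all
    moreover have "(a' - a) + (y / x - a') = y / x - a"
      by simp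
    ultimately have yx: "y / x - a \<noteq> 0" "Q (y / x - a) = 0"
      using place_const[OF a'(3) aK(1)] by metis+
    have "Q (ide_t a) = - int m"
      unfolding ide_t_factor[OF a] using yx ide_norm(2)[OF a] nonzero place_const[OF a'(3) aK(2)] ideal_values(3)[OF Q(1)]
      by (simp add: place_minus[OF a'(3)] place_mult[OF a'(3)] place_power[OF a'(3)])
    then show ?thesis
      using t0 by (simp add: place_divide[OF a'(3)] place_1[OF a'(3)])
  qed
  have gen: "m * q + i * d \<in> weierstrass_semigroup K P" if i: "i \<le> s" for i
  proof (rule weierstrass_semigroupI[OF pP(1)])
    show "1 / ide_t a * z ^ i \<noteq> 0"
      using t0 z_nonzero by simp
    have "P (1 / ide_t a * z ^ i) = P (1 / ide_t a) + int i * P z"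
      using t0 by (intro value_times_z_power[OF pP(1)]) simp
    then show "P (1 / ide_t a * z ^ i) = - int (m * q + i * d)"
      unfolding v(1,3) by (simp only: of_nat_add of_nat_mult mult_minus_right minus_add_distrib mult.commute)
    fix Q assume Q: "place K Q" "Q \<noteq> P"
    have Qv: "Q (1 / ide_t a * z ^ i) = Q (1 / ide_t a) + int i * Q z"
      using t0 by (intro value_times_z_power[OF Q(1)]) simp
    have u0: "0 \<le> Q (1 / ide_t a)"
      using u Q unfolding regular_iff by blast
    show "0 \<le> Q (1 / ide_t a * z ^ i)"
    proof (cases rule: place_cases[OF Q(1)])
      case 3
      have "int i * int d < int m"
        using d_times_s[OF i] by (simp flip: of_nat_mult)
      then show ?thesis
        using Qv 3 u_ideal[OF 3(1) Q(2)] by simp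
    qed (use Qv u0 in auto)
  qed
  have "q ^ n + 1 \<in> weierstrass_semigroup K P"
  proof (rule weierstrass_semigroupI[OF pP(1)])
    show "x / ide_t a \<noteq> 0"
      using t0 nonzero by simp
    show "P (x / ide_t a) = - int (q ^ n + 1)"
      unfolding v(2) m_mult[symmetric] by simp
    show "0 \<le> Q (x / ide_t a)" if "place K Q" "Q \<noteq> P" for Q
      using w_regular that unfolding regular_iff by blast
  qed
  then show "submonoid_gen ?A \<subseteq> weierstrass_semigroup K P"
    using gen by (intro weierstrass_semigroup_submonoid[OF pP(1)]) auto
qed

text \<open>The generators are the pole orders of \<open>u\<close> and of \<open>w z\<^sup>k\<close>.  The pole of \<open>z\<^sup>k\<close> at an ideal point has order
  \<open>k d < m\<close>, and \<open>w = 1 / t\<close> has a zero of order \<open>m\<close> there.\<close>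

theorem weierstrass_semigroup_affine:
  assumes P: "P \<in> gk_affine_points K q x y"
  shows "weierstrass_semigroup K P = submonoid_gen ({q ^ n + 1 - m} \<union> {q ^ n + 1 - k | k. k \<le> s})"
    (is "_ = submonoid_gen ?A")
proof
  obtain a b where ab: "a \<in> F_q2 K q" "b \<in> F_q2 K q" "a ^ q * a - b ^ q * b = 1"
    and pP: "place K P" "P (aff_u a b) < 0"
    using affine_adapted[OF P] by metis
  interpret adapted_coordinates K q "aff_u a b" "1 / aff_t a b" "- 1" m z 1 P
    by (rule aff_adapted[OF ab pP])
  note v = normalized_values[OF pP]
  note t0 = aff_t_nonzero[OF ab]
  have Pt: "P (aff_t a b) = int ((q + 1) * m)"
    using v(2) t0 by (simp add: place_divide[OF pP(1)] place_1[OF pP(1)] algebra_simps)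
  have t_lin: "aff_t a b = a ^ q * x + (- (b ^ q)) * y + (- 1)"
    by (simp add: aff_t_def)
  have linK: "a ^ q \<in> K" "- (b ^ q) \<in> K" "- 1 \<in> K"
    using ab F_q2D(1) by (auto intro: subringD[OF KR])
  have others: "Q z = 0 \<and> 0 \<le> Q (aff_t a b) \<or>
       Q z = 1 \<and> 0 \<le> Q (aff_t a b) \<and> (\<forall>g\<in>E. int m dvd Q g) \<or>
       Q z = - int d \<and> - int m \<le> Q (aff_t a b) \<and> (\<forall>g\<in>E. int m dvd Q g)"
    if Q: "place K Q" for Q
    using linear_value[OF Q t_lin linK] unfolding aff_adjoin2[OF ab]
    by (cases rule: place_cases[OF Q]) auto
  have s_le: "s \<le> m" "m \<le> q ^ n + 1"
  proof -
    have "q * 1 < q * q"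
      using q2 by (intro mult_strict_left_mono) auto
    then have "1 \<le> d"
      unfolding power2_eq_square by linarith
    then have "s * 1 \<le> s * d"
      by (intro mult_left_mono) auto
    then show "s \<le> m"
      unfolding m_eq by linarith
    have "m * 1 \<le> m * (q + 1)"
      by (intro mult_left_mono) auto
    then show "m \<le> q ^ n + 1"
      unfolding m_mult by simp
  qed
  show "weierstrass_semigroup K P \<subseteq> submonoid_gen ?A"
  proof
    fix k assume "k \<in> weierstrass_semigroup K P"
    then obtain f where f: "f \<noteq> 0" "\<And>Q. place K Q \<Longrightarrow> pole_order Q f = (if Q = P then k else 0)"
      unfolding weierstrass_semigroup_def by blast
    have "f \<in> regular"
      unfolding regular_iff using f(2) by (force simp: pole_order_def)
    then obtain e i j c where *: "j \<le> c * s"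
      "P f = - int (m * (q * e + (q + 1) * i)) - int c * P (aff_t a b) + int j * 1"
      using pole_value_decomposition[OF _ t0 s_pos m_eq others] f(1) aff_in_H(1)[OF ab]
      unfolding aff_adjoin2[OF ab] by metis
    have "\<exists>a\<in>?A. int a = int (q ^ n + 1) + int i * (- 1)" if "i \<le> s" for i
      using that s_le by (intro bexI[of _ "q ^ n + 1 - i"]) (auto simp: of_nat_diff)
    then obtain h where h: "h \<in> submonoid_gen ?A" "int h = int c * int (q ^ n + 1) + int j * (- 1)"
      using submonoid_gen_progression[of s ?A "int (q ^ n + 1)" "- 1" j c] *(1) by blast
    have "e * (q ^ n + 1 - m) \<in> submonoid_gen ?A" "i * (q ^ n + 1) \<in> submonoid_gen ?A"
      by (rule submonoid_gen_mult; force)+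
    then have mem: "e * (q ^ n + 1 - m) + i * (q ^ n + 1) + h \<in> submonoid_gen ?A"
      using h by (intro submonoid_gen_add)
    have "P f = - int (e * (q ^ n + 1 - m) + i * (q ^ n + 1) + h)"
      unfolding *(2) Pt m_mult'(2)[symmetric] of_nat_add[of _ h] h(2)
      unfolding m_mult'(1)[symmetric] by (simp add: algebra_simps)
    then have "pole_order P f = e * (q ^ n + 1 - m) + i * (q ^ n + 1) + h"
      by (simp only: pole_order_def minus_minus nat_int)
    then have "k = e * (q ^ n + 1 - m) + i * (q ^ n + 1) + h"
      using f(2)[OF pP(1)] by simp
    then show "k \<in> submonoid_gen ?A"
      using mem by simp
  qed
  \<comment> \<open>The tangent at an affine rational point does not pass through an ideal point, so \<open>t\<close> has a pole
    of the same order as \<open>x\<close> there.\<close>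
  have w_ideal: "int m \<le> Q (1 / aff_t a b)" if Q: "Q \<in> gk_ideal_points K q x y" for Q
  proof -
    obtain a' where a': "a' \<in> F_q2 K q" "a' ^ (q + 1) = 1" "place K Q" "has_value_at Q (y / x) a'"
      using ideal_adapted[OF Q] by metis
    define c where "c = a ^ q - b ^ q * a'"
    have cK: "c \<in> K" "b ^ q \<in> K"
      unfolding c_def using ab a' F_q2D(1) by (auto intro!: subringD(6,4,7)[OF KR])
    have c0: "c \<noteq> 0"
    proof
      assume "c = 0"
      then have aq: "a ^ q = b ^ q * a'"
        by (simp add: c_def)
      have "(a ^ q) ^ q = (b ^ q) ^ q * a' ^ q"
        unfolding aq power_mult_distrib ..
      then have "a = b * a' ^ q"
        unfolding F_q2D(2)[OF ab(1)] F_q2D(2)[OF ab(2)] .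
      with aq have "a ^ q * a = (b ^ q * a') * (b * a' ^ q)"
        by (rule arg_cong2)
      also have "\<dots> = b ^ q * b * a' ^ (q + 1)"
        by simp
      finally show False
        using ab(3) unfolding a'(2) by simp
    qed
    have "at_least Q (0 + 1) (- (b ^ q) * (y / x - a'))"
    proof (rule at_least_mult[OF a'(3)])
      show "at_least Q 0 (- (b ^ q))"
        using place_const[OF a'(3) cK(2)] by (simp add: at_least_0[OF a'(3)] place_minus[OF a'(3)])
      show "at_least Q 1 (y / x - a')"
        using a'(4) by (auto simp: at_least_def has_value_at_def)
    qed
    then have "at_least Q (Q c + 1) (- (b ^ q) * (y / x - a'))"
      using place_const[OF a'(3) cK(1)] by simp
    then have *: "c + - (b ^ q) * (y / x - a') \<noteq> 0 \<and> Q (c + - (b ^ q) * (y / x - a')) = 0"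
      using dominant_summand[OF a'(3) c0] unfolding place_const[OF a'(3) cK(1)] by blast
    define g where "g = x * (c + - (b ^ q) * (y / x - a'))"
    have g: "g \<noteq> 0" "Q g = - int m"
      using * nonzero ideal_values(3)[OF Q] by (simp_all add: g_def place_mult[OF a'(3)])
    have "aff_t a b = g + (- 1)"
      using nonzero by (simp add: g_def c_def aff_t_def algebra_simps)
    moreover have "at_least Q (Q g + 1) (- 1)"
      using g(2) m_pos place_const[OF a'(3) linK(3)] by (simp add: at_least_def)
    ultimately have "Q (aff_t a b) = - int m"
      using dominant_summand[OF a'(3) g(1), of "- 1"] g(2) by simp
    then show ?thesis
      using t0 by (simp add: place_divide[OF a'(3)] place_1[OF a'(3)])
  qed
  have gen: "q ^ n + 1 - k \<in> weierstrass_semigroup K P" if k: "k \<le> s" for k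
  proof (rule weierstrass_semigroupI[OF pP(1)])
    show "1 / aff_t a b * z ^ k \<noteq> 0"
      using t0 z_nonzero by simp
    have "k \<le> q ^ n + 1"
      using k s_le by linarith
    then have "int (q ^ n + 1 - k) = int (q ^ n + 1) - int k"
      by (rule of_nat_diff)
    moreover have "q ^ n + 1 = (q + 1) * m"
      unfolding m_mult[symmetric] by (rule mult.commute)
    moreover have "P (1 / aff_t a b * z ^ k) = P (1 / aff_t a b) + int k * P z"
      using t0 by (intro value_times_z_power[OF pP(1)]) simp
    ultimately show "P (1 / aff_t a b * z ^ k) = - int (q ^ n + 1 - k)"
      unfolding v(2,3) by linarith
    fix Q assume Q: "place K Q" "Q \<noteq> P"
    have Qv: "Q (1 / aff_t a b * z ^ k) = Q (1 / aff_t a b) + int k * Q z"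
      using t0 by (intro value_times_z_power[OF Q(1)]) simp
    have u0: "0 \<le> Q (1 / aff_t a b)"
      using w_regular Q unfolding regular_iff by blast
    show "0 \<le> Q (1 / aff_t a b * z ^ k)"
    proof (cases rule: place_cases[OF Q(1)])
      case 3
      have "int k * int d < int m"
        using d_times_s[OF k] by (simp flip: of_nat_mult)
      then show ?thesis
        using Qv 3 w_ideal[OF 3(1)] by simp
    qed (use Qv u0 in auto)
  qed
  have "q ^ n + 1 - m \<in> weierstrass_semigroup K P"
  proof (rule weierstrass_semigroupI[OF pP(1)])
    show "aff_u a b \<noteq> 0"
      using pP place_0[OF pP(1)] by auto
    show "P (aff_u a b) = - int (q ^ n + 1 - m)"
      unfolding v(1) m_mult'(2)[symmetric] by simp
    have "aff_u a b \<in> regular"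
      using A_regular in_A(2) by blast
    then show "0 \<le> Q (aff_u a b)" if "place K Q" "Q \<noteq> P" for Q
      using that unfolding regular_iff by blast
  qed
  then show "submonoid_gen ?A \<subseteq> weierstrass_semigroup K P"
    using gen by (intro weierstrass_semigroup_submonoid[OF pP(1)]) auto
qed

end

theorem theorem1p1:
  fixes K :: "'a::field set" and x y z :: 'a and P :: "'a \<Rightarrow> int" and q n m s :: nat
  assumes "primepow q" and "n \<ge> 5" and "odd n"
    and "m = gk_m q n" and "s = gk_s q n"
    and "gk_function_field K q n x y z"
    and "P \<in> gk_rational_points K q x y"
  shows "weierstrass_semigroup K P =
    (if P \<in> gk_ideal_points K q x y
     then submonoid_gen ({m * q + i * (q\<^sup>2 - q) | i. i \<le> s} \<union> {q ^ n + 1})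
     else submonoid_gen ({q ^ n + 1 - m} \<union> {q ^ n + 1 - k | k. k \<le> s}))"
proof -
  interpret gk_function_field K q n x y z by (rule assms(6))
  interpret gk_curve K q n x y z
    using assms(1-3) by unfold_locales auto
  show ?thesis
  proof (cases "P \<in> gk_ideal_points K q x y")
    case True
    then show ?thesis
      unfolding assms(4,5) by (simp only: weierstrass_semigroup_ideal if_True)
  next
    case False
    then have "P \<in> gk_affine_points K q x y"
      using assms(7) by (simp add: gk_rational_points_def)
    with False show ?thesis
      unfolding assms(4,5) by (simp only: weierstrass_semigroup_affine if_False)
  qed
qed

end
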